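(* Assume hypothesis (Q) of the context, and let $\tilde\nu=1-g_\kappa^{\{1\}}(R)>0$. Then for each $m\in\mathbb N$, under the measures $\mathbb P_N$, $$\frac{1}{N\tilde\nu}(L_1,\dots,L_m)\longrightarrow(X_1,\dots,X_m)\quad\text{in distribution as }N\to\infty,$$ where $X_n=\mathbf 1_{\{\tau_1=n\}}$ and $\tau_1$ is a random variable with geometric distribution $\mathbb P\{\tau_1=k\}=(1-\tilde\nu)^{k-1}\tilde\nu$, $k\in\mathbb N$.
   Context: Model: for $N\in\mathbb N$, $S_N$ is the symmetric group on $\{1,\dots,N\}$; for $\sigma\in S_N$, $C_j(\sigma)$ is the number of cycles of length $j$. Given nonnegative sequences $(\theta_j)_{j\ge1},(\kappa_j)_{j\ge1}$, $\mathbb P_N(\sigma)=\frac{1}{N!H_N}\prod_{j=1}^N(\theta_j+N\kappa_j)^{C_j}$, $H_N=\frac1{N!}\sum_{\sigma\in S_N}\prod_{j=1}^N(\theta_j+N\kappa_j)^{C_j}$. Lexicographic ordering: $L_1(\sigma)$ is the length of the cycle containing $1$, $L_2(\sigma)$ the length of the cycle containing the smallest element not in the first cycle, etc. $g_\theta(z)=\sum_{j\ge1}\theta_jz^j/j$, $g_\kappa(z)=\sum_{j\ge1}\kappa_jz^j/j$; $g^{\{n\}}(z):=z^ng^{(n)}(z)$; $R$ is the radius of convergence of $g_\kappa$ and $g_\kappa^{\{n\}}(R)=\lim_{r\uparrow R}g_\kappa^{\{n\}}(r)\in[0,\infty]$. Standing assumption: $(\kappa_j)$ is non-arithmetic (no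 integer $j_0>1$ such that $\kappa_j\ne0$ implies $j_0\mid j$) and $\kappa_j>0$ for some $j\ge2$. $\Delta_0=\{z:|z|<R|1+\eta e^{i\varphi}|,\ z\neq R,\ |\arg(z-R)|>\varphi\}$ for some $\eta>0$, $\varphi\in(0,\pi/2)$. Principal branches are used for powers. Hypothesis (Q): $g_\kappa$ has radius of convergence $R>0$ and is holomorphic in some $\Delta_0$; $g_\kappa^{\{1\}}(R)<1$; there is a non-integer $s>1$ with $g_\kappa^{\{n\}}(R)<\infty$ for integers $n<s$ and $g_\kappa^{\{n\}}(R)=\infty$ for $n>s$, and for every $n\in\mathbb N_0$ there is $\delta_n>0$ such that as $z\to R$, $z\in\Delta_0$, $g_\kappa^{\{n\}}(z)=(z/R)^n\Big\{\sum_{n\le j<s}\frac{(-1)^{j-n}g_\kappa^{\{j\}}(R)}{(j-n)!}(1-z/R)^{j-n}+\frac{\Gamma(n-s)a_s}{\Gamma(-s)}(1-z/R)^{s-n}\Big\}+O((1-z/R)^{s-n+\delta_n})$ with a constant $a_s>0$ (the sum being empty if $n>s$); $g_\theta$ is holomorphic in $\Delta_0$ and regular (holomorphic in a neighbourhood of) at $z=R$. *)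

theory Defs
  imports "HOL-Probability.Probability" "HOL-Library.Landau_Symbols"
begin

definition cyc :: "(nat \<Rightarrow> nat) \<Rightarrow> nat \<Rightarrow> nat set" where
  "cyc \<sigma> x = {(\<sigma> ^^ k) x | k. True}"

definition cycle_count :: "nat \<Rightarrow> (nat \<Rightarrow> nat) \<Rightarrow> nat \<Rightarrow> nat" where
  "cycle_count N \<sigma> j = card {c. (\<exists>x\<in>{1..N}. c = cyc \<sigma> x) \<and> card c = j}"

fun covered :: "nat \<Rightarrow> (nat \<Rightarrow> nat) \<Rightarrow> nat \<Rightarrow> nat set" where
  "covered N \<sigma> 0 = {}"
| "covered N \<sigma> (Suc k) =
     (let U = {1..N} - covered N \<sigma> k in
      if U = {} then covered N \<sigma> k else covered N \<sigma> k \<union> cyc \<sigma> (Min U))"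

text \<open>L_k(sigma), k >= 1: length of the cycle containing the smallest element not
  in the first k-1 cycles (0 if sigma has fewer than k cycles).\<close>
definition lexL :: "nat \<Rightarrow> (nat \<Rightarrow> nat) \<Rightarrow> nat \<Rightarrow> nat" where
  "lexL N \<sigma> k = (let U = {1..N} - covered N \<sigma> (k - 1) in
                   if U = {} then 0 else card (cyc \<sigma> (Min U)))"

definition weight :: "(nat \<Rightarrow> real) \<Rightarrow> (nat \<Rightarrow> real) \<Rightarrow> nat \<Rightarrow> (nat \<Rightarrow> nat) \<Rightarrow> real" where
  "weight \<theta> \<kappa> N \<sigma> = (\<Prod>j=1..N. (\<theta> j + real N * \<kappa> j) ^ cycle_count N \<sigma> j)"

definition HN :: "(nat \<Rightarrow> real) \<Rightarrow> (nat \<Rightarrow> real) \<Rightarrow> nat \<Rightarrow> real" where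
  "HN \<theta> \<kappa> N = (\<Sum>\<sigma> | \<sigma> permutes {1..N}. weight \<theta> \<kappa> N \<sigma>) / fact N"

definition PN :: "(nat \<Rightarrow> real) \<Rightarrow> (nat \<Rightarrow> real) \<Rightarrow> nat \<Rightarrow> (nat \<Rightarrow> nat) \<Rightarrow> real" where
  "PN \<theta> \<kappa> N \<sigma> = weight \<theta> \<kappa> N \<sigma> / (fact N * HN \<theta> \<kappa> N)"

definition EN :: "(nat \<Rightarrow> real) \<Rightarrow> (nat \<Rightarrow> real) \<Rightarrow> nat \<Rightarrow> ((nat \<Rightarrow> nat) \<Rightarrow> real) \<Rightarrow> real" where
  "EN \<theta> \<kappa> N F = (\<Sum>\<sigma> | \<sigma> permutes {1..N}. PN \<theta> \<kappa> N \<sigma> * F \<sigma>)"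

text \<open>g(z) = sum_{j>=1} c_j z^j / j (the j = 0 term vanishes since x/0 = 0).\<close>
definition gfun :: "(nat \<Rightarrow> real) \<Rightarrow> complex \<Rightarrow> complex" where
  "gfun c z = (\<Sum>j. of_real (c j / real j) * z ^ j)"

definition gcoeff :: "(nat \<Rightarrow> real) \<Rightarrow> nat \<Rightarrow> complex" where
  "gcoeff c j = of_real (c j / real j)"

definition gbr :: "(complex \<Rightarrow> complex) \<Rightarrow> nat \<Rightarrow> complex \<Rightarrow> complex" where
  "gbr g n z = z ^ n * (deriv ^^ n) g z"

definition gbrR :: "(nat \<Rightarrow> real) \<Rightarrow> real \<Rightarrow> nat \<Rightarrow> ereal" where
  "gbrR c R n = Lim (at_left R) (\<lambda>r. ereal (Re (gbr (gfun c) n (complex_of_real r))))"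

definition Delta0 :: "real \<Rightarrow> real \<Rightarrow> real \<Rightarrow> complex set" where
  "Delta0 R \<eta> \<phi> = {z. norm z < R * norm (1 + complex_of_real \<eta> * exp (\<i> * complex_of_real \<phi>))
                       \<and> z \<noteq> complex_of_real R \<and> \<bar>Arg (z - complex_of_real R)\<bar> > \<phi>}"

definition non_arithmetic :: "(nat \<Rightarrow> real) \<Rightarrow> bool" where
  "non_arithmetic \<kappa> \<longleftrightarrow> \<not> (\<exists>j0::nat. j0 > 1 \<and> (\<forall>j\<ge>1. \<kappa> j \<noteq> 0 \<longrightarrow> j0 dvd j))"

definition hypQ :: "(nat \<Rightarrow> real) \<Rightarrow> (nat \<Rightarrow> real) \<Rightarrow> real \<Rightarrow> bool" where
  "hypQ \<theta> \<kappa> R \<longleftrightarrow>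
     R > 0 \<and> conv_radius (gcoeff \<kappa>) = ereal R \<and>
     (\<exists>\<eta> \<phi> G\<kappa> G\<theta> \<epsilon> s a.
        \<eta> > 0 \<and> 0 < \<phi> \<and> \<phi> < pi / 2 \<and>
        \<comment> \<open>g_kappa is holomorphic in Delta_0 (analytic continuation of the series)\<close>
        G\<kappa> holomorphic_on Delta0 R \<eta> \<phi> \<and>
        (\<forall>z\<in>ball 0 R. G\<kappa> z = gfun \<kappa> z) \<and>
        \<comment> \<open>g_theta is holomorphic in Delta_0 and in a neighbourhood of R\<close>
        \<epsilon> > 0 \<and> G\<theta> holomorphic_on (Delta0 R \<eta> \<phi> \<union> ball (complex_of_real R) \<epsilon>) \<and>
        (\<forall>z\<in>ball 0 R. (\<lambda>j. gcoeff \<theta> j * z ^ j) sums G\<theta> z) \<and>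
        \<comment> \<open>g_kappa^{1}(R) < 1\<close>
        gbrR \<kappa> R 1 < 1 \<and>
        \<comment> \<open>the non-integer exponent s > 1\<close>
        s > 1 \<and> s \<notin> \<int> \<and>
        (\<forall>n::nat. real n < s \<longrightarrow> gbrR \<kappa> R n < \<infinity>) \<and>
        (\<forall>n::nat. real n > s \<longrightarrow> gbrR \<kappa> R n = \<infinity>) \<and>
        \<comment> \<open>the singular expansion\<close>
        a > 0 \<and>
        (\<forall>n::nat. \<exists>\<delta>>0.
           (\<lambda>z. gbr G\<kappa> n z
                 - (z / complex_of_real R) ^ n *
                   ((\<Sum>j | n \<le> j \<and> real j < s.
                       of_real ((-1) ^ (j - n) * real_of_ereal (gbrR \<kappa> R j) / fact (j - n))
                       * (1 - z / complex_of_real R) ^ (j - n))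
                    + of_real (Gamma (real n - s) * a / Gamma (- s))
                       * (1 - z / complex_of_real R) powr complex_of_real (s - real n)))
           \<in> bigo (at (complex_of_real R) within Delta0 R \<eta> \<phi>)
               (\<lambda>z. (1 - z / complex_of_real R) powr complex_of_real (s - real n + \<delta>))))"

text \<open>R^m is realised as the subspace of (nat => real) (product topology) of functions
  vanishing outside {1..m}.\<close>
definition Rm :: "nat \<Rightarrow> (nat \<Rightarrow> real) set" where
  "Rm m = {x. \<forall>i. i \<notin> {1..m} \<longrightarrow> x i = 0}"

definition Lvec :: "real \<Rightarrow> nat \<Rightarrow> nat \<Rightarrow> (nat \<Rightarrow> nat) \<Rightarrow> (nat \<Rightarrow> real)" where
  "Lvec \<nu> m N \<sigma> = (\<lambda>i. if i \<in> {1..m} then real (lexL N \<sigma> i) / (real N * \<nu>) else 0)"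

definition Xvec :: "nat \<Rightarrow> nat \<Rightarrow> (nat \<Rightarrow> real)" where
  "Xvec m t = (\<lambda>n. if n \<in> {1..m} \<and> n = t then 1 else 0)"

end

theory Submission
  imports Defs "HOL-Complex_Analysis.Complex_Analysis" "HOL-Real_Asymp.Real_Asymp"
begin

text \<open>
  Let \<open>h\<^sub>n = R\<^sup>n [z\<^sup>n] exp (g\<^sub>\<theta>(z) + N g\<^sub>\<kappa>(z))\<close>. Removing the cycle of the smallest element shows that
  \<open>L\<^sub>1, L\<^sub>2, \<dots>\<close> are the steps of a Markov chain: from \<open>n\<close> remaining points the next cycle has
  length \<open>l\<close> with probability \<open>(\<theta>\<^sub>l + N \<kappa>\<^sub>l) R\<^sup>l h\<^sub>n\<^sub>-\<^sub>l / (n h\<^sub>n)\<close>. Up to normalisation \<open>h\<close> is the law of a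
  compound Poisson variable of mean about \<open>(1 - \<nu>) N\<close>, and the singular expansion gives
  \<open>\<kappa>\<^sub>l R\<^sup>l \<sim> c l\<^sup>-\<^sup>s\<close>. So \<open>h\<^sub>N\<close>, a deviation of order \<open>N\<close> above the mean, is governed by one big
  jump of size about \<open>\<nu> N\<close>, which yields \<open>h\<^sub>N\<^sub>-\<^sub>d / h\<^sub>N \<rightarrow> 1\<close>. Hence short cycles have asymptotic law
  \<open>\<kappa>\<^sub>l R\<^sup>l\<close>, of total mass \<open>1 - \<nu>\<close>, and the remaining mass \<open>\<nu>\<close> sits at lengths near \<open>\<nu> N\<close>. Lower bounds
  for the events ``the giant cycle is the \<open>k\<close>-th one'' suffice, since their limits add up to one.
\<close>

section \<open>Decomposition along the first cycle\<close>

text \<open>For \<open>s < 2\<close> the jumps have finite mean but infinite variance, so the law of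
  large numbers is obtained from Laplace transforms; it controls averages against \<open>h\<close>
  but no single value. Single values are reached through
  \<open>X d N = h N (N - d) * N powr s / Z N\<close>. Splitting the recursion of \<open>h\<close>
  at a small multiple of \<open>N\<close> gives in the limit
  \<open>x = (1 - \<nu>) * x + c * \<nu> powr - s\<close>: a short jump leads to a quantity of the
  same kind, and a long one leaves a remainder averaged by the law of large numbers. Since
  \<open>1 - \<nu> < 1\<close>, a uniform bound on \<open>X\<close> forces convergence to the fixed
  point, the same for every \<open>d\<close>; that bound needs an induction of its own. The tail of
  \<open>\<kappa>\<close> is read off from a derivative of order well beyond \<open>s\<close>. There
  the regular part of the expansion is absent, and main term and remainder both blow up, so
  integrals over circles inside the disc suffice and no contour around the singularity is
  needed.\<close>

lemma cyc_self: "x \<in> cyc f x"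
  by (auto simp: cyc_def intro!: exI[of _ "0::nat"])

lemma cyc_closed: "y \<in> cyc f x \<Longrightarrow> f y \<in> cyc f x"
  unfolding cyc_def by (auto intro: exI[of _ "Suc _"])

lemma cyc_subset:
  assumes "f ` B \<subseteq> B" "x \<in> B"
  shows "cyc f x \<subseteq> B"
proof -
  have "(f ^^ k) x \<in> B" for k
    by (induction k) (use assms in auto)
  then show ?thesis by (auto simp: cyc_def)
qed

lemma cyc_cong:
  assumes "f ` B \<subseteq> B" "x \<in> B" "\<And>y. y \<in> B \<Longrightarrow> f y = g y"
  shows "cyc f x = cyc g x"
proof -
  have "(f ^^ k) x = (g ^^ k) x \<and> (f ^^ k) x \<in> B" for k
    by (induction k) (use assms in auto)
  then show ?thesis by (auto simp: cyc_def)
qed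

text \<open>The identity outside \<open>B\<close>, as \<open>permutes\<close> requires; restrictions
  to complementary invariant sets then compose to the original permutation.\<close>

definition restr :: "(nat \<Rightarrow> nat) \<Rightarrow> nat set \<Rightarrow> nat \<Rightarrow> nat" where
  "restr f B = (\<lambda>y. if y \<in> B then f y else y)"

lemma restr_permutes:
  assumes "finite B" "f ` B \<subseteq> B" "inj f"
  shows "restr f B permutes B"
proof (rule inj_imp_permutes)
  show "inj_on (restr f B) B"
    using inj_on_subset[OF assms(3), of B] by (simp add: restr_def cong: inj_on_cong)
qed (use assms in \<open>auto simp: restr_def\<close>)

lemma permutes_cyc_split:
  assumes "f permutes A" "finite A" "x \<in> A"
  shows "cyc f x \<subseteq> A" "restr f (cyc f x) permutes cyc f x"
    "restr f (A - cyc f x) permutes (A - cyc f x)"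
    "restr f (cyc f x) \<circ> restr f (A - cyc f x) = f"
    "cyc (restr f (cyc f x)) x = cyc f x"
proof -
  let ?B = "cyc f x"
  show B: "?B \<subseteq> A"
    using assms by (intro cyc_subset) (auto simp: permutes_in_image)
  have fin: "finite ?B" using B assms(2) finite_subset by blast
  have cl: "f ` ?B \<subseteq> ?B" using cyc_closed by auto
  have inj: "inj f" using assms(1) permutes_inj by blast
  show 1: "restr f ?B permutes ?B"
    by (rule restr_permutes[OF fin cl inj])
  \<comment> \<open>An injection of a finite set into itself is onto, so no point outside the cycle
    can be sent into it.\<close>
  have surj: "f ` ?B = ?B"
    using endo_inj_surj[OF fin cl inj_on_subset[OF inj]] by auto
  have cl2: "f ` (A - ?B) \<subseteq> A - ?B"
    by (metis (no_types, lifting) assms(1) image_set_diff inj permutes_image subset_refl surj)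
  show "restr f (A - ?B) permutes (A - ?B)"
    by (rule restr_permutes) (use assms cl2 inj in auto)
  show "restr f ?B \<circ> restr f (A - ?B) = f"
  proof
    fix y
    show "(restr f ?B \<circ> restr f (A - ?B)) y = f y"
      using B cl2 assms(1) by (auto simp: restr_def permutes_def)
  qed
  show "cyc (restr f ?B) x = ?B"
    by (rule sym, rule cyc_cong[of _ ?B]) (use cl cyc_self in \<open>auto simp: restr_def\<close>)
qed

lemma permutes_combine:
  assumes "c permutes B" "\<tau> permutes (A - B)" "B \<subseteq> A" "finite A"
  shows "(c \<circ> \<tau>) permutes A"
    "\<And>y. y \<in> B \<Longrightarrow> (c \<circ> \<tau>) y = c y"
    "\<And>y. y \<in> A - B \<Longrightarrow> (c \<circ> \<tau>) y = \<tau> y"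
    "\<And>y. y \<in> B \<Longrightarrow> cyc (c \<circ> \<tau>) y = cyc c y"
    "\<And>y. y \<in> A - B \<Longrightarrow> cyc (c \<circ> \<tau>) y = cyc \<tau> y"
    "restr (c \<circ> \<tau>) B = c" "restr (c \<circ> \<tau>) (A - B) = \<tau>"
proof -
  show "(c \<circ> \<tau>) permutes A"
    using assms by (intro permutes_compose) (auto intro: permutes_subset)
  show 1: "\<And>y. y \<in> B \<Longrightarrow> (c \<circ> \<tau>) y = c y"
    using assms(2) by (auto simp: permutes_def)
  show 2: "\<And>y. y \<in> A - B \<Longrightarrow> (c \<circ> \<tau>) y = \<tau> y"
    using assms(1) permutes_in_image[OF assms(2)] by (auto simp: permutes_def)
  show "\<And>y. y \<in> B \<Longrightarrow> cyc (c \<circ> \<tau>) y = cyc c y"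
    by (rule sym, rule cyc_cong[of _ B])
       (use 1 permutes_in_image[OF assms(1)] in auto)
  show "\<And>y. y \<in> A - B \<Longrightarrow> cyc (c \<circ> \<tau>) y = cyc \<tau> y"
    by (rule sym, rule cyc_cong[of _ "A - B"])
       (use 2 permutes_in_image[OF assms(2)] in auto)
  show "restr (c \<circ> \<tau>) B = c"
    using 1 assms(1) by (auto simp: restr_def fun_eq_iff permutes_def)
  show "restr (c \<circ> \<tau>) (A - B) = \<tau>"
    using 2 assms(2) by (auto simp: restr_def fun_eq_iff permutes_def)
qed

definition cyclic_perms :: "nat set \<Rightarrow> nat \<Rightarrow> (nat \<Rightarrow> nat) set" where
  "cyclic_perms B x = {c. c permutes B \<and> cyc c x = B}"

lemma finite_cyclic_perms: "finite B \<Longrightarrow> finite (cyclic_perms B x)"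
  unfolding cyclic_perms_def by (rule finite_subset[OF _ finite_permutations]) auto

text \<open>The bijection sends \<open>\<sigma>\<close> to its cycle through \<open>x\<close> and
  its restrictions to that cycle and to the complement; composition is the inverse.\<close>

lemma sum_permutations_by_cycle:
  fixes \<Phi> :: "(nat \<Rightarrow> nat) \<Rightarrow> real"
  assumes "finite A" "x \<in> A"
  shows "(\<Sum>\<sigma> | \<sigma> permutes A. \<Phi> \<sigma>) =
    (\<Sum>B | B \<subseteq> A \<and> x \<in> B. \<Sum>c\<in>cyclic_perms B x. \<Sum>\<tau> | \<tau> permutes (A - B). \<Phi> (c \<circ> \<tau>))"
proof -
  have fin: "finite {B. B \<subseteq> A \<and> x \<in> B}" using assms by auto
  have "(\<Sum>\<sigma> | \<sigma> permutes A. \<Phi> \<sigma>) =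
    (\<Sum>(B, c, \<tau>) \<in> (SIGMA B:{B. B \<subseteq> A \<and> x \<in> B}. cyclic_perms B x \<times> {\<tau>. \<tau> permutes (A - B)}).
       \<Phi> (c \<circ> \<tau>))"
  proof (rule sum.reindex_bij_witness[where
          j = "\<lambda>\<sigma>. (cyc \<sigma> x, restr \<sigma> (cyc \<sigma> x), restr \<sigma> (A - cyc \<sigma> x))"
          and i = "\<lambda>(B, c, \<tau>). c \<circ> \<tau>"])
    fix \<sigma> assume "\<sigma> \<in> {\<sigma>. \<sigma> permutes A}"
    then have "\<sigma> permutes A" by simp
    note s = permutes_cyc_split[OF this assms]
    show "(case (cyc \<sigma> x, restr \<sigma> (cyc \<sigma> x), restr \<sigma> (A - cyc \<sigma> x)) of (B, c, \<tau>) \<Rightarrow> c \<circ> \<tau>) = \<sigma>"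
      "(case (cyc \<sigma> x, restr \<sigma> (cyc \<sigma> x), restr \<sigma> (A - cyc \<sigma> x)) of (B, c, \<tau>) \<Rightarrow> \<Phi> (c \<circ> \<tau>)) = \<Phi> \<sigma>"
      by (simp_all only: prod.case s(4))
    show "(cyc \<sigma> x, restr \<sigma> (cyc \<sigma> x), restr \<sigma> (A - cyc \<sigma> x))
      \<in> (SIGMA B:{B. B \<subseteq> A \<and> x \<in> B}. cyclic_perms B x \<times> {\<tau>. \<tau> permutes (A - B)})"
      using s(1-3,5) by (simp add: cyclic_perms_def cyc_self)
  next
    fix b assume b: "b \<in> (SIGMA B:{B. B \<subseteq> A \<and> x \<in> B}. cyclic_perms B x \<times> {\<tau>. \<tau> permutes (A - B)})"
    then obtain B c \<tau> where [simp]: "b = (B, c, \<tau>)" and B: "B \<subseteq> A" "x \<in> B" "c permutes B" "cyc c x = B" "\<tau> permutes (A - B)"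
      by (cases b) (auto simp: cyclic_perms_def)
    note p = permutes_combine[OF B(3,5,1) assms(1)]
    show "(case b of (B, c, \<tau>) \<Rightarrow> c \<circ> \<tau>) \<in> {\<sigma>. \<sigma> permutes A}"
      using p(1) by simp
    have "cyc (c \<circ> \<tau>) x = B" using p(4)[OF B(2)] B(4) by simp
    then show "(cyc (case b of (B, c, \<tau>) \<Rightarrow> c \<circ> \<tau>) x,
        restr (case b of (B, c, \<tau>) \<Rightarrow> c \<circ> \<tau>) (cyc (case b of (B, c, \<tau>) \<Rightarrow> c \<circ> \<tau>) x),
        restr (case b of (B, c, \<tau>) \<Rightarrow> c \<circ> \<tau>) (A - cyc (case b of (B, c, \<tau>) \<Rightarrow> c \<circ> \<tau>) x)) = b"
      using p(6,7) by (simp del: o_apply)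
  qed
  also have "\<dots> = (\<Sum>B | B \<subseteq> A \<and> x \<in> B. \<Sum>(c,\<tau>)\<in>cyclic_perms B x \<times> {\<tau>. \<tau> permutes (A - B)}. \<Phi> (c \<circ> \<tau>))"
    by (rule sum.Sigma[symmetric])
       (use assms in \<open>auto intro!: finite_cyclic_perms finite_permutations intro: finite_subset\<close>)
  also have "\<dots> = (\<Sum>B | B \<subseteq> A \<and> x \<in> B. \<Sum>c\<in>cyclic_perms B x. \<Sum>\<tau> | \<tau> permutes (A - B). \<Phi> (c \<circ> \<tau>))"
    by (simp add: sum.cartesian_product)
  finally show ?thesis .
qed

lemma sum_subsets_containing:
  fixes f :: "nat \<Rightarrow> real"
  assumes "finite A" "x \<in> A"
  shows "(\<Sum>B | B \<subseteq> A \<and> x \<in> B. f (card B)) =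
    (\<Sum>l=1..card A. real ((card A - 1) choose (l - 1)) * f l)"
proof -
  have cA: "card A \<ge> 1" using assms by (auto simp: Suc_le_eq card_gt_0_iff)
  have "(\<Sum>B | B \<subseteq> A \<and> x \<in> B. f (card B)) = (\<Sum>C\<in>Pow (A - {x}). f (Suc (card C)))"
    by (rule sum.reindex_bij_witness[where j = "\<lambda>B. B - {x}" and i = "insert x"])
       (use assms card.remove[of _ x] in \<open>auto dest: finite_subset\<close>)
  also have "\<dots> = (\<Sum>k\<in>{0..card A - 1}. \<Sum>C\<in>{C\<in>Pow (A - {x}). card C = k}. f (Suc (card C)))"
    using assms by (intro sum.group[symmetric])
      (use card_mono[of "A - {x}"] in \<open>auto simp: card_Diff_singleton\<close>)
  also have "\<dots> = (\<Sum>k\<in>{0..card A - 1}. real ((card A - 1) choose k) * f (Suc k))"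
  proof (rule sum.cong[OF refl])
    fix k
    have "card {C. C \<subseteq> A - {x} \<and> card C = k} = (card A - 1) choose k"
      using n_subsets[of "A - {x}" k] assms by (simp add: card_Diff_singleton)
    then show "(\<Sum>C\<in>{C\<in>Pow (A - {x}). card C = k}. f (Suc (card C))) = real ((card A - 1) choose k) * f (Suc k)"
      by (simp add: Pow_def)
  qed
  also have "\<dots> = (\<Sum>l=1..card A. real ((card A - 1) choose (l - 1)) * f l)"
    by (rule sum.reindex_bij_witness[where j = Suc and i = "\<lambda>l. l - 1"]) (use cA in auto)
  finally show ?thesis .
qed

text \<open>Choosing the other points of a cycle of length \<open>l\<close>, ordering them
  cyclically and permuting the rest can be done in \<open>(n - 1)!\<close> ways whatever
  \<open>l\<close> is. This independence turns sums over permutations into plain recursions.\<close>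

lemma choose_fact_fact:
  assumes "1 \<le> l" "l \<le> n"
  shows "real ((n - 1) choose (l - 1)) * fact (l - 1) * fact (n - l) = fact (n - 1)"
proof -
  have 1: "n - 1 - (l - 1) = n - l" "l - 1 \<le> n - 1" using assms by auto
  have "fact (l - 1) * fact (n - l) * ((n - 1) choose (l - 1)) = (fact (n - 1) :: nat)"
    using binomial_fact_lemma[OF 1(2)] unfolding 1(1) .
  then have "real (fact (l - 1) * fact (n - l) * ((n - 1) choose (l - 1))) = real (fact (n - 1))"
    by (rule arg_cong)
  then show ?thesis
    unfolding of_nat_mult of_nat_fact by (simp only: mult_ac)
qed

text \<open>Sorting all \<open>n!\<close> permutations by the cycle of \<open>x\<close> determines the number of cyclic ones.\<close>
lemma card_cyclic_perms:
  assumes "finite A" "x \<in> A"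
  shows "real (card (cyclic_perms A x)) = fact (card A - 1)"
  using assms
proof (induction "card A" arbitrary: A rule: less_induct)
  case less
  let ?n = "card A"
  let ?S = "{B. B \<subseteq> A \<and> x \<in> B}"
  have finS: "finite ?S" using less.prems by auto
  have n1: "?n \<ge> 1" using less.prems by (auto simp: Suc_le_eq card_gt_0_iff)
  have "fact ?n = (\<Sum>\<sigma> | \<sigma> permutes A. 1::real)"
    using card_permutations[OF refl less.prems(1)] by simp
  also have "\<dots> = (\<Sum>B\<in>?S. \<Sum>c\<in>cyclic_perms B x. \<Sum>\<tau> | \<tau> permutes (A - B). 1)"
    by (rule sum_permutations_by_cycle[OF less.prems])
  also have "\<dots> = (\<Sum>B\<in>?S. real (card (cyclic_perms B x)) * fact (?n - card B))"
  proof (rule sum.cong[OF refl])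
    fix B assume B: "B \<in> ?S"
    then have "card (A - B) = ?n - card B" using less.prems by (auto intro: card_Diff_subset finite_subset)
    then have "real (card {\<tau>. \<tau> permutes (A - B)}) = fact (?n - card B)"
      using card_permutations[of "A - B"] less.prems by (metis finite_Diff of_nat_fact)
    then show "(\<Sum>c\<in>cyclic_perms B x. \<Sum>\<tau> | \<tau> permutes (A - B). 1) = real (card (cyclic_perms B x)) * fact (?n - card B)"
      by simp
  qed
  also have "\<dots> = real (card (cyclic_perms A x)) + (\<Sum>B\<in>?S - {A}. real (card (cyclic_perms B x)) * fact (?n - card B))"
    using finS less.prems by (subst sum.remove[of _ A]) auto
  also have "(\<Sum>B\<in>?S - {A}. real (card (cyclic_perms B x)) * fact (?n - card B)) =
     (\<Sum>B\<in>?S - {A}. fact (card B - 1) * fact (?n - card B))"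
  proof (rule sum.cong[OF refl])
    fix B assume B: "B \<in> ?S - {A}"
    then have "card B < ?n" using less.prems by (intro psubset_card_mono) auto
    then have "real (card (cyclic_perms B x)) = fact (card B - 1)"
      using less B finite_subset by blast
    then show "real (card (cyclic_perms B x)) * fact (?n - card B) = fact (card B - 1) * fact (?n - card B)" by simp
  qed
  \<comment> \<open>Adding and subtracting the expected value for \<open>A\<close> itself completes
    the sum over subsets.\<close>
  also have "\<dots> = (\<Sum>B\<in>?S. fact (card B - 1) * fact (?n - card B)) - fact (?n - 1)"
    using finS less.prems by (subst (2) sum.remove[of _ A]) auto
  also have "(\<Sum>B\<in>?S. fact (card B - 1) * fact (?n - card B)) = (\<Sum>l=1..?n. real ((?n - 1) choose (l - 1)) * (fact (l - 1) * fact (?n - l)))"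
    by (rule sum_subsets_containing[OF less.prems, of "\<lambda>k. fact (k - 1) * fact (?n - k)"])
  also have "\<dots> = (\<Sum>l=1..?n. fact (?n - 1))"
    by (rule sum.cong[OF refl], subst mult.assoc[symmetric], rule choose_fact_fact) auto
  also have "\<dots> = fact ?n"
    using n1 fact_reduce[of ?n, where 'a=real] by simp
  finally show ?case by simp
qed

section \<open>Weights and lexicographic lengths under removal of a cycle\<close>

definition cycle_weight :: "(nat \<Rightarrow> real) \<Rightarrow> nat set \<Rightarrow> (nat \<Rightarrow> nat) \<Rightarrow> real" where
  "cycle_weight w A \<sigma> = (\<Prod>c\<in>cyc \<sigma> ` A. w (card c))"

lemma weight_eq_cycle_weight:
  assumes "\<sigma> permutes {1..N}"
  shows "weight \<theta> \<kappa> N \<sigma> = cycle_weight (\<lambda>j. \<theta> j + real N * \<kappa> j) {1..N} \<sigma>"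
proof -
  have sub: "card ` (cyc \<sigma> ` {1..N}) \<subseteq> {1..N}"
  proof (clarsimp)
    fix x assume x: "Suc 0 \<le> x" "x \<le> N"
    then have s: "cyc \<sigma> x \<subseteq> {1..N}"
      using permutes_cyc_split(1)[OF assms, of x] by auto
    then have "finite (cyc \<sigma> x)" using finite_subset by blast
    then show "Suc 0 \<le> card (cyc \<sigma> x) \<and> card (cyc \<sigma> x) \<le> N"
      using cyc_self[of x \<sigma>] card_mono[OF _ s] by (auto simp: Suc_le_eq card_gt_0_iff)
  qed
  have "(\<Prod>c\<in>cyc \<sigma> ` {1..N}. \<theta> (card c) + real N * \<kappa> (card c)) =
    (\<Prod>j\<in>{1..N}. \<Prod>c\<in>{c\<in>cyc \<sigma> ` {1..N}. card c = j}. \<theta> (card c) + real N * \<kappa> (card c))"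
    by (rule prod.group[symmetric]) (use sub in auto)
  also have "\<dots> = (\<Prod>j\<in>{1..N}. (\<theta> j + real N * \<kappa> j) ^ card {c\<in>cyc \<sigma> ` {1..N}. card c = j})"
    by (rule prod.cong[OF refl]) simp
  also have "\<dots> = weight \<theta> \<kappa> N \<sigma>"
    unfolding weight_def cycle_count_def
    by (intro prod.cong refl arg_cong2[where f=power] arg_cong[where f=card]) auto
  finally show ?thesis by (simp add: cycle_weight_def)
qed

text \<open>\<open>covered\<close> over an arbitrary ground set: deleting a cycle from
  \<open>{1..N}\<close> in general leaves no initial segment, and the recursion has to continue
  there.\<close>

fun cov :: "nat set \<Rightarrow> (nat \<Rightarrow> nat) \<Rightarrow> nat \<Rightarrow> nat set" where
  "cov A \<sigma> 0 = {}"
| "cov A \<sigma> (Suc k) = (let U = A - cov A \<sigma> k in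
      if U = {} then cov A \<sigma> k else cov A \<sigma> k \<union> cyc \<sigma> (Min U))"

definition lex_length :: "nat set \<Rightarrow> (nat \<Rightarrow> nat) \<Rightarrow> nat \<Rightarrow> nat" where
  "lex_length A \<sigma> i = (let U = A - cov A \<sigma> i in if U = {} then 0 else card (cyc \<sigma> (Min U)))"

lemma lexL_eq_lex_length: "lexL N \<sigma> (Suc i) = lex_length {1..N} \<sigma> i"
proof -
  have "covered N \<sigma> k = cov {1..N} \<sigma> k" for k
    by (induction k) simp_all
  then show ?thesis by (simp add: lexL_def lex_length_def)
qed

text \<open>The first step removes exactly \<open>B\<close>; from then on the smallest uncovered
  points and their cycles are those of \<open>\<tau>\<close> on \<open>A - B\<close>. Hence the
  shift by one.\<close>

lemma cov_combine:
  assumes "c \<in> cyclic_perms B (Min A)" "\<tau> permutes (A - B)" "B \<subseteq> A" "finite A" "A \<noteq> {}"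
  shows "cov A (c \<circ> \<tau>) (Suc k) = B \<union> cov (A - B) \<tau> k"
proof -
  have cp: "c permutes B" and cB: "cyc c (Min A) = B" using assms(1) by (auto simp: cyclic_perms_def)
  note pc = permutes_combine[OF cp assms(2-4)]
  have mB: "Min A \<in> B" using cB cyc_self by metis
  show ?thesis
  proof (induction k)
    case 0
    have "cyc (c \<circ> \<tau>) (Min A) = B" using pc(4)[OF mB] cB by simp
    then show ?case using assms(5) by (simp add: Let_def o_def)
  next
    case (Suc k)
    define U where "U = A - B - cov (A - B) \<tau> k"
    have U: "A - cov A (c \<circ> \<tau>) (Suc k) = U" unfolding Suc.IH U_def by auto
    have "cyc (c \<circ> \<tau>) (Min U) = cyc \<tau> (Min U)" if "U \<noteq> {}"
      using that assms(4) Min_in[of U] by (intro pc(5)) (auto simp: U_def)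
    moreover have "cov A (c \<circ> \<tau>) (Suc (Suc k)) =
      (if U = {} then cov A (c \<circ> \<tau>) (Suc k) else cov A (c \<circ> \<tau>) (Suc k) \<union> cyc (c \<circ> \<tau>) (Min U))"
      unfolding U[symmetric] cov.simps(2)[of _ _ "Suc k"] Let_def by (rule refl)
    moreover have "cov (A - B) \<tau> (Suc k) =
      (if U = {} then cov (A - B) \<tau> k else cov (A - B) \<tau> k \<union> cyc \<tau> (Min U))"
      unfolding U_def cov.simps(2) Let_def by (rule refl)
    ultimately show ?case using Suc.IH by (auto simp del: cov.simps o_apply)
  qed
qed

lemma lex_length_combine:
  assumes "c \<in> cyclic_perms B (Min A)" "\<tau> permutes (A - B)" "B \<subseteq> A" "finite A" "A \<noteq> {}"
  shows "lex_length A (c \<circ> \<tau>) 0 = card B"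
    "lex_length A (c \<circ> \<tau>) (Suc k) = lex_length (A - B) \<tau> k"
proof -
  have cp: "c permutes B" and cB: "cyc c (Min A) = B" using assms(1) by (auto simp: cyclic_perms_def)
  note pc = permutes_combine[OF cp assms(2-4)]
  have mB: "Min A \<in> B" using cB cyc_self by metis
  show "lex_length A (c \<circ> \<tau>) 0 = card B"
    using assms(5) pc(4)[OF mB] cB by (simp add: lex_length_def)
  define U where "U = A - B - cov (A - B) \<tau> k"
  have U: "A - cov A (c \<circ> \<tau>) (Suc k) = U" unfolding cov_combine[OF assms] U_def by auto
  have "cyc (c \<circ> \<tau>) (Min U) = cyc \<tau> (Min U)" if "U \<noteq> {}"
    using that assms(4) Min_in[of U] by (intro pc(5)) (auto simp: U_def)
  then show "lex_length A (c \<circ> \<tau>) (Suc k) = lex_length (A - B) \<tau> k"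
    by (cases "U = {}") (simp_all add: lex_length_def Let_def U[unfolded cov.simps Let_def] U U_def[symmetric] del: cov.simps)
qed

lemma cycle_weight_combine:
  assumes "c \<in> cyclic_perms B x" "\<tau> permutes (A - B)" "B \<subseteq> A" "finite A"
  shows "cycle_weight w A (c \<circ> \<tau>) = w (card B) * cycle_weight w (A - B) \<tau>"
proof -
  have cp: "c permutes B" and cB: "cyc c x = B" using assms(1) by (auto simp: cyclic_perms_def)
  note pc = permutes_combine[OF cp assms(2-4)]
  have xB: "x \<in> B" using cB cyc_self by metis
  have finB: "finite B" using assms finite_subset by blast
  \<comment> \<open>\<open>cyc\<close> contains forward iterates only. Going back from
    \<open>y\<close> to \<open>x\<close> works because the finite orbit of \<open>y\<close> is
    mapped onto itself, hence is closed under preimages.\<close>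
  have all: "cyc c y = B" if y: "y \<in> B" for y
  proof -
    have "y \<in> cyc c x" using y cB by simp
    then obtain k where k: "y = (c ^^ k) x" by (auto simp: cyc_def)
    have cl: "c ` cyc c y \<subseteq> cyc c y" using cyc_closed by auto
    have sub: "cyc c y \<subseteq> B"
      using cp y by (intro cyc_subset) (auto simp: permutes_in_image)
    have inj: "inj c" using cp permutes_inj by blast
    have im: "c ` cyc c y = cyc c y"
      by (rule endo_inj_surj[OF finite_subset[OF sub finB] cl inj_on_subset[OF inj]]) auto
    have pre: "c z \<in> cyc c y \<Longrightarrow> z \<in> cyc c y" for z
      using im injD[OF inj] by blast
    have "(c ^^ j) x \<in> cyc c y \<Longrightarrow> x \<in> cyc c y" for j
      by (induction j) (auto dest: pre)
    then have "x \<in> cyc c y" using k cyc_self by metis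
    then have "cyc c x \<subseteq> cyc c y" using cl by (intro cyc_subset)
    then show ?thesis using sub cB by auto
  qed
  have "cyc (c \<circ> \<tau>) ` A = cyc (c \<circ> \<tau>) ` (B \<union> (A - B))" using assms(3) by (simp add: Un_absorb1)
  also have "\<dots> = cyc (c \<circ> \<tau>) ` B \<union> cyc (c \<circ> \<tau>) ` (A - B)" by (rule image_Un)
  also have "cyc (c \<circ> \<tau>) ` B = {B}" using pc(4) all xB by auto
  also have "cyc (c \<circ> \<tau>) ` (A - B) = cyc \<tau> ` (A - B)" using pc(5) by (rule image_cong[OF refl])
  finally have eq: "cyc (c \<circ> \<tau>) ` A = insert B (cyc \<tau> ` (A - B))" by (simp del: o_apply)
  \<comment> \<open>\<open>B\<close> contains \<open>x\<close> and no cycle of \<open>\<tau>\<close>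
    on \<open>A - B\<close> does, so the product gains exactly one new factor.\<close>
  have "cyc \<tau> y \<subseteq> A - B" if "y \<in> A - B" for y
    using permutes_cyc_split(1)[OF assms(2) _ that] assms(4) by auto
  then have "B \<notin> cyc \<tau> ` (A - B)" using xB by auto
  then show ?thesis
    unfolding cycle_weight_def eq using assms(4) by simp
qed

text \<open>The term \<open>j = 0\<close> vanishes because \<open>w 0 / 0 = 0\<close>.\<close>
definition exp_coeff :: "(nat \<Rightarrow> real) \<Rightarrow> nat \<Rightarrow> real" where
  "exp_coeff w n = fps_nth (fps_exp 1 oo Abs_fps (\<lambda>j. w j / real j)) n"

lemma exp_coeff_0 [simp]: "exp_coeff w 0 = 1"
  by (simp add: exp_coeff_def)

text \<open>Coefficient comparison in \<open>F' = G' * F\<close>: differentiation cancels the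
  division by \<open>j\<close>, so \<open>G'\<close> has the weights \<open>w\<close> themselves as
  coefficients.\<close>

lemma exp_coeff_rec:
  assumes "n > 0"
  shows "real n * exp_coeff w n = (\<Sum>l=1..n. w l * exp_coeff w (n - l))"
proof -
  define G where "G = Abs_fps (\<lambda>j. w j / real j)"
  define F where "F = fps_exp 1 oo G"
  obtain k where k: "n = Suc k" using assms gr0_conv_Suc by auto
  have "fps_deriv F = fps_deriv G * F"
    by (simp add: F_def G_def fps_compose_deriv)
  then have "fps_nth (fps_deriv F) k = fps_nth (fps_deriv G * F) k" by simp
  then have "real n * fps_nth F n = (\<Sum>l=0..k. w (Suc l) * fps_nth F (k - l))"
    by (simp add: fps_mult_nth G_def k)
  also have "\<dots> = (\<Sum>l=1..n. w l * fps_nth F (n - l))"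
    by (rule sum.reindex_bij_witness[where j = Suc and i = "\<lambda>l. l - 1"]) (auto simp: k)
  finally show ?thesis by (simp add: exp_coeff_def F_def G_def)
qed

lemma exp_coeff_eq: "n > 0 \<Longrightarrow> exp_coeff w n = (\<Sum>l=1..n. w l * exp_coeff w (n - l)) / real n"
  using exp_coeff_rec[of n w] by (simp add: field_simps)

lemma exp_coeff_nonneg: "(\<And>j. j \<ge> 1 \<Longrightarrow> w j \<ge> 0) \<Longrightarrow> exp_coeff w n \<ge> 0"
proof (induction n rule: less_induct)
  case (less n)
  have "0 \<le> (\<Sum>l=1..n. w l * exp_coeff w (n - l))"
    using less by (intro sum_nonneg mult_nonneg_nonneg) auto
  then show ?case
    by (cases "n = 0") (simp_all add: exp_coeff_eq)
qed

text \<open>\<open>n! * cycle_coeff w n Js\<close> is the total weight of the permutations of \<open>n\<close> points whose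
  \<open>i\<close>-th lexicographic cycle length lies in the \<open>i\<close>-th set of \<open>Js\<close>.\<close>
primrec cycle_coeff :: "(nat \<Rightarrow> real) \<Rightarrow> nat \<Rightarrow> nat set list \<Rightarrow> real" where
  "cycle_coeff w n [] = exp_coeff w n"
| "cycle_coeff w n (J # Js) = (\<Sum>l\<in>{1..n} \<inter> J. w l * cycle_coeff w (n - l) Js) / real n"

definition lex_event :: "nat set \<Rightarrow> nat set list \<Rightarrow> (nat \<Rightarrow> nat) \<Rightarrow> bool" where
  "lex_event A Js \<sigma> \<longleftrightarrow> (\<forall>i<length Js. lex_length A \<sigma> i \<in> Js ! i)"

lemma lex_event_combine:
  assumes "c \<in> cyclic_perms B (Min A)" "\<tau> permutes (A - B)" "B \<subseteq> A" "finite A" "A \<noteq> {}"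
  shows "lex_event A (J # Js) (c \<circ> \<tau>) \<longleftrightarrow> card B \<in> J \<and> lex_event (A - B) Js \<tau>"
proof -
  have "lex_event A (J # Js) (c \<circ> \<tau>) \<longleftrightarrow> lex_length A (c \<circ> \<tau>) 0 \<in> J \<and>
      (\<forall>i<length Js. lex_length A (c \<circ> \<tau>) (Suc i) \<in> Js ! i)"
    unfolding lex_event_def length_Cons All_less_Suc2 by simp
  then show ?thesis
    unfolding lex_length_combine[OF assms] lex_event_def .
qed

text \<open>The inductive step shared by the total weight and by the weight of an event: subset
  count, cyclic orders and the factorial of the remainder collapse to
  \<open>(n - 1)!\<close>.\<close>

lemma sum_over_first_cycle:
  assumes "finite A" "A \<noteq> {}"
    and \<Phi>: "\<And>B c \<tau>. B \<subseteq> A \<Longrightarrow> c \<in> cyclic_perms B (Min A) \<Longrightarrow> \<tau> permutes (A - B) \<Longrightarrow>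
          \<Phi> (c \<circ> \<tau>) = a (card B) * \<Psi> (A - B) \<tau>"
    and \<Psi>: "\<And>B. B \<subseteq> A \<Longrightarrow> Min A \<in> B \<Longrightarrow>
          (\<Sum>\<tau> | \<tau> permutes (A - B). \<Psi> (A - B) \<tau>) = fact (card A - card B) * T (card A - card B)"
  shows "(\<Sum>\<sigma> | \<sigma> permutes A. \<Phi> \<sigma>) = fact (card A - 1) * (\<Sum>l=1..card A. a l * (T (card A - l) :: real))"
proof -
  let ?n = "card A"
  have M: "Min A \<in> A" using assms by simp
  have "(\<Sum>\<sigma> | \<sigma> permutes A. \<Phi> \<sigma>) =
    (\<Sum>B | B \<subseteq> A \<and> Min A \<in> B. \<Sum>c\<in>cyclic_perms B (Min A). \<Sum>\<tau> | \<tau> permutes (A - B). \<Phi> (c \<circ> \<tau>))"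
    by (rule sum_permutations_by_cycle[OF assms(1) M])
  also have "\<dots> = (\<Sum>B | B \<subseteq> A \<and> Min A \<in> B. fact (card B - 1) * (a (card B) * (fact (?n - card B) * T (?n - card B))))"
  proof (rule sum.cong[OF refl])
    fix B assume "B \<in> {B. B \<subseteq> A \<and> Min A \<in> B}"
    then have B: "B \<subseteq> A" "Min A \<in> B" "finite B" using assms(1) finite_subset by auto
    have "(\<Sum>c\<in>cyclic_perms B (Min A). \<Sum>\<tau> | \<tau> permutes (A - B). \<Phi> (c \<circ> \<tau>)) =
       (\<Sum>c\<in>cyclic_perms B (Min A). a (card B) * (fact (?n - card B) * T (?n - card B)))"
      by (intro sum.cong refl) (simp add: \<Phi>[OF B(1)] \<Psi>[OF B(1,2)] sum_distrib_left[symmetric])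
    then show "(\<Sum>c\<in>cyclic_perms B (Min A). \<Sum>\<tau> | \<tau> permutes (A - B). \<Phi> (c \<circ> \<tau>)) =
       fact (card B - 1) * (a (card B) * (fact (?n - card B) * T (?n - card B)))"
      using card_cyclic_perms[OF B(3,2)] by simp
  qed
  also have "\<dots> = (\<Sum>l=1..?n. real ((?n - 1) choose (l - 1)) * (fact (l - 1) * (a l * (fact (?n - l) * T (?n - l)))))"
    by (rule sum_subsets_containing[OF assms(1) M])
  also have "\<dots> = (\<Sum>l=1..?n. fact (?n - 1) * (a l * T (?n - l)))"
  proof (rule sum.cong[OF refl])
    fix l assume "l \<in> {1..?n}"
    then have "1 \<le> l" "l \<le> ?n" by auto
    from choose_fact_fact[OF this, symmetric]
    show "real ((?n - 1) choose (l - 1)) * (fact (l - 1) * (a l * (fact (?n - l) * T (?n - l)))) =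
      fact (?n - 1) * (a l * T (?n - l))" by (simp add: mult_ac)
  qed
  finally show ?thesis by (simp add: sum_distrib_left)
qed

lemma sum_cycle_weight:
  assumes "finite A"
  shows "(\<Sum>\<sigma> | \<sigma> permutes A. cycle_weight w A \<sigma>) = fact (card A) * exp_coeff w (card A)"
  using assms
proof (induction "card A" arbitrary: A rule: less_induct)
  case less
  show ?case
  proof (cases "A = {}")
    case True
    then show ?thesis by (simp add: cycle_weight_def)
  next
    case False
    have "(\<Sum>\<sigma> | \<sigma> permutes A. cycle_weight w A \<sigma>) =
      fact (card A - 1) * (\<Sum>l=1..card A. w l * exp_coeff w (card A - l))"
    proof (rule sum_over_first_cycle[where \<Psi> = "cycle_weight w"])
      fix B assume B: "B \<subseteq> A" "Min A \<in> B"
      then have "card (A - B) < card A"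
        using less.prems by (intro psubset_card_mono) auto
      moreover have "card (A - B) = card A - card B"
        using B less.prems by (auto intro: card_Diff_subset finite_subset)
      ultimately show "(\<Sum>\<tau> | \<tau> permutes (A - B). cycle_weight w (A - B) \<tau>) =
        fact (card A - card B) * exp_coeff w (card A - card B)"
        using less.hyps[of "A - B"] less.prems by simp
    qed (use less.prems False cycle_weight_combine in auto)
    also have "\<dots> = fact (card A - 1) * (real (card A) * exp_coeff w (card A))"
      using False less.prems by (subst exp_coeff_rec) (auto simp: card_gt_0_iff)
    also have "\<dots> = fact (card A) * exp_coeff w (card A)"
      using False less.prems by (subst (2) fact_reduce) (auto simp: card_gt_0_iff)
    finally show ?thesis .
  qed
qed

text \<open>A length \<open>0\<close> signals that no cycle is left. Excluding it makes a nonempty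
  list of conditions fail on the empty ground set, in agreement with the empty sum in
  \<open>cycle_coeff\<close>.\<close>

lemma sum_cycle_weight_event:
  assumes "finite A" "\<forall>J\<in>set Js. 0 \<notin> J"
  shows "(\<Sum>\<sigma> | \<sigma> permutes A. cycle_weight w A \<sigma> * of_bool (lex_event A Js \<sigma>)) =
    fact (card A) * cycle_coeff w (card A) Js"
  using assms
proof (induction Js arbitrary: A)
  case Nil
  then show ?case by (simp add: lex_event_def sum_cycle_weight)
next
  case (Cons J Js)
  show ?case
  proof (cases "A = {}")
    case True
    then have "\<not> lex_event A (J # Js) \<sigma>" for \<sigma>
      using Cons.prems by (auto simp: lex_event_def lex_length_def)
    then show ?thesis using True by simp
  next
    case False
    have "(\<Sum>\<sigma> | \<sigma> permutes A. cycle_weight w A \<sigma> * of_bool (lex_event A (J # Js) \<sigma>)) =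
      fact (card A - 1) * (\<Sum>l=1..card A. (w l * of_bool (l \<in> J)) * cycle_coeff w (card A - l) Js)"
    proof (rule sum_over_first_cycle[where \<Psi> = "\<lambda>A \<tau>. cycle_weight w A \<tau> * of_bool (lex_event A Js \<tau>)"])
      fix B assume B: "B \<subseteq> A" "Min A \<in> B"
      then have "card (A - B) = card A - card B"
        using B Cons.prems by (auto intro: card_Diff_subset finite_subset)
      then show "(\<Sum>\<tau> | \<tau> permutes (A - B). cycle_weight w (A - B) \<tau> * of_bool (lex_event (A - B) Js \<tau>)) =
        fact (card A - card B) * cycle_coeff w (card A - card B) Js"
        using Cons.IH[of "A - B"] Cons.prems by simp
    qed (use Cons.prems False in \<open>auto simp: cycle_weight_combine lex_event_combine\<close>)
    also have "(\<Sum>l=1..card A. (w l * of_bool (l \<in> J)) * cycle_coeff w (card A - l) Js) =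
       (\<Sum>l\<in>{1..card A} \<inter> J. w l * cycle_coeff w (card A - l) Js)"
      by (rule sum.mono_neutral_cong_right) auto
    also have "\<dots> = real (card A) * cycle_coeff w (card A) (J # Js)"
      using False Cons.prems by (simp add: card_gt_0_iff)
    also have "fact (card A - 1) * (real (card A) * cycle_coeff w (card A) (J # Js)) =
       fact (card A) * cycle_coeff w (card A) (J # Js)"
      using False Cons.prems by (subst (2) fact_reduce) (auto simp: card_gt_0_iff)
    finally show ?thesis .
  qed
qed

lemma HN_eq_exp_coeff: "HN \<theta> \<kappa> N = exp_coeff (\<lambda>j. \<theta> j + real N * \<kappa> j) N"
proof -
  have "(\<Sum>\<sigma> | \<sigma> permutes {1..N}. weight \<theta> \<kappa> N \<sigma>) =
    (\<Sum>\<sigma> | \<sigma> permutes {1..N}. cycle_weight (\<lambda>j. \<theta> j + real N * \<kappa> j) {1..N} \<sigma>)"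
    by (rule sum.cong[OF refl]) (simp add: weight_eq_cycle_weight)
  then show ?thesis by (simp add: HN_def sum_cycle_weight)
qed

lemma EN_event:
  assumes "\<forall>J\<in>set Js. 0 \<notin> J"
  shows "EN \<theta> \<kappa> N (\<lambda>\<sigma>. of_bool (lex_event {1..N} Js \<sigma>)) =
    cycle_coeff (\<lambda>j. \<theta> j + real N * \<kappa> j) N Js / exp_coeff (\<lambda>j. \<theta> j + real N * \<kappa> j) N"
proof -
  let ?w = "\<lambda>j. \<theta> j + real N * \<kappa> j"
  have "EN \<theta> \<kappa> N (\<lambda>\<sigma>. of_bool (lex_event {1..N} Js \<sigma>)) =
    (\<Sum>\<sigma> | \<sigma> permutes {1..N}. cycle_weight ?w {1..N} \<sigma> * of_bool (lex_event {1..N} Js \<sigma>)) / (fact N * HN \<theta> \<kappa> N)"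
    unfolding EN_def PN_def sum_divide_distrib
    by (rule sum.cong[OF refl]) (simp add: weight_eq_cycle_weight)
  also have "\<dots> = cycle_coeff ?w N Js / exp_coeff ?w N"
    using sum_cycle_weight_event[OF _ assms, of "{1..N}" ?w] by (simp add: HN_eq_exp_coeff)
  finally show ?thesis .
qed

text \<open>Probabilities are quotients of such coefficients and hence unaffected by the tilt; with
  \<open>r = R\<close> it moves the singularity to \<open>1\<close>.\<close>

lemma exp_coeff_tilt: "exp_coeff (\<lambda>j. w j * r ^ j) n = r ^ n * exp_coeff w n"
proof (induction n rule: less_induct)
  case (less n)
  show ?case
  proof (cases "n = 0")
    case False
    have "(\<Sum>l=1..n. w l * r ^ l * exp_coeff (\<lambda>j. w j * r ^ j) (n - l)) = (\<Sum>l=1..n. r ^ n * (w l * exp_coeff w (n - l)))"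
      by (rule sum.cong[OF refl]) (auto simp: less.IH simp flip: power_add)
    then show ?thesis using False
      by (simp add: exp_coeff_eq sum_distrib_left)
  qed simp
qed

lemma cycle_coeff_tilt: "cycle_coeff (\<lambda>j. w j * r ^ j) n Js = r ^ n * cycle_coeff w n Js"
proof (induction Js arbitrary: n)
  case Nil
  then show ?case by (simp add: exp_coeff_tilt)
next
  case (Cons J Js)
  have "(\<Sum>l\<in>{1..n} \<inter> J. w l * r ^ l * cycle_coeff (\<lambda>j. w j * r ^ j) (n - l) Js) = (\<Sum>l\<in>{1..n} \<inter> J. r ^ n * (w l * cycle_coeff w (n - l) Js))"
    by (rule sum.cong[OF refl]) (auto simp: Cons.IH simp flip: power_add)
  then show ?case by (simp add: sum_distrib_left)
qed

section \<open>The compound Poisson weights\<close>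

lemma exp_coeff_cong:
  assumes "\<And>j. j \<ge> 1 \<Longrightarrow> w j = w' j"
  shows "exp_coeff w n = exp_coeff w' n"
proof -
  have "w j / real j = w' j / real j" for j using assms[of j] by (cases j) auto
  then have "(\<lambda>j. w j / real j) = (\<lambda>j. w' j / real j)" by (rule ext)
  then show ?thesis unfolding exp_coeff_def by simp
qed

lemma cycle_coeff_cong:
  assumes "\<And>j. j \<ge> 1 \<Longrightarrow> w j = w' j"
  shows "cycle_coeff w n Js = cycle_coeff w' n Js"
proof (induction Js arbitrary: n)
  case Nil
  then show ?case using exp_coeff_cong[OF assms] by simp
next
  case (Cons J Js)
  have "(\<Sum>l\<in>{1..n} \<inter> J. w l * cycle_coeff w (n - l) Js) = (\<Sum>l\<in>{1..n} \<inter> J. w' l * cycle_coeff w' (n - l) Js)"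
    by (rule sum.cong[OF refl]) (simp add: assms Cons.IH)
  then show ?case by simp
qed

lemma cycle_coeff_nonneg: "(\<And>j. j \<ge> 1 \<Longrightarrow> w j \<ge> 0) \<Longrightarrow> cycle_coeff w n Js \<ge> 0"
proof (induction Js arbitrary: n)
  case Nil
  then show ?case by (simp add: exp_coeff_nonneg)
next
  case (Cons J Js)
  then show ?case
    unfolding cycle_coeff.simps by (intro divide_nonneg_nonneg sum_nonneg mult_nonneg_nonneg) auto
qed

text \<open>Dominated convergence for series along an arbitrary filter, in the form used
  throughout.\<close>

lemma tannery_uniform:
  fixes a :: "nat \<Rightarrow> 'b \<Rightarrow> real"
  assumes "\<And>k. ((\<lambda>x. a k x) \<longlongrightarrow> b k) F"
    and "eventually (\<lambda>x. \<forall>k. \<bar>a k x\<bar> \<le> M k) F" and "summable M" and "F \<noteq> bot"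
  shows "((\<lambda>x. \<Sum>k. a k x) \<longlongrightarrow> (\<Sum>k. b k)) F"
proof -
  have "eventually (\<lambda>(k,x). norm (a k x) \<le> M k) (at_top \<times>\<^sub>F F)"
    unfolding eventually_prod_filter using assms(2)
    by (intro exI[of _ "\<lambda>_. True"] exI[of _ "\<lambda>x. \<forall>k. \<bar>a k x\<bar> \<le> M k"]) auto
  from tannerys_theorem[OF assms(1) this assms(3,4)] show ?thesis by simp
qed

text \<open>Both sequences obey the same recursion. The complex form is needed because convergence
  is read off from holomorphy.\<close>

lemma exp_coeff_complex:
  "fps_nth (fps_exp 1 oo Abs_fps (\<lambda>j. complex_of_real (w j / real j))) n = of_real (exp_coeff w n)"
proof -
  define F where "F = fps_exp 1 oo Abs_fps (\<lambda>j. complex_of_real (w j / real j))"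
  have rec: "of_nat (Suc k) * fps_nth F (Suc k) = (\<Sum>l=0..k. of_real (w (Suc l)) * fps_nth F (k - l))" for k
  proof -
    have "fps_deriv F = fps_deriv (Abs_fps (\<lambda>j. complex_of_real (w j / real j))) * F"
      by (simp add: F_def fps_compose_deriv)
    then have "fps_nth (fps_deriv F) k = fps_nth (fps_deriv (Abs_fps (\<lambda>j. complex_of_real (w j / real j))) * F) k" by simp
    moreover have "of_nat (Suc l) * complex_of_real (w (Suc l) / real (Suc l)) = of_real (w (Suc l))" for l
      by (simp del: of_nat_Suc)
    ultimately show ?thesis
      by (simp only: fps_mult_nth fps_deriv_nth fps_nth_Abs_fps Suc_eq_plus1[symmetric])
  qed
  have "fps_nth F n = of_real (exp_coeff w n)"
  proof (induction n rule: less_induct)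
    case (less n)
    show ?case
    proof (cases n)
      case 0
      then show ?thesis by (simp add: F_def)
    next
      case (Suc k)
      have "of_nat (Suc k) * fps_nth F (Suc k) = (\<Sum>l=0..k. of_real (w (Suc l)) * of_real (exp_coeff w (k - l)))"
        unfolding rec using Suc by (intro sum.cong refl) (auto simp: less)
      also have "\<dots> = of_real (\<Sum>l=0..k. w (Suc l) * exp_coeff w (k - l))" by simp
      also have "(\<Sum>l=0..k. w (Suc l) * exp_coeff w (k - l)) = (\<Sum>l=1..Suc k. w l * exp_coeff w (Suc k - l))"
        by (rule sum.reindex_bij_witness[where j = Suc and i = "\<lambda>l. l - 1"]) auto
      also have "\<dots> = real (Suc k) * exp_coeff w (Suc k)"
        by (rule exp_coeff_rec[symmetric]) simp
      finally show ?thesis unfolding Suc of_real_mult of_real_of_nat_eq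
        by (metis mult_cancel_left of_nat_eq_0_iff nat.distinct(1))
    qed
  qed
  then show ?thesis by (simp add: F_def)
qed

lemma div_nat_le: "w / real j \<le> (w::real)" if "w \<ge> 0"
  using that mult_left_mono[of 1 "real j" w] by (cases "j = 0") (auto simp: divide_le_eq)

lemma summable_div_nat:
  fixes w :: "nat \<Rightarrow> real"
  assumes "\<And>j. w j \<ge> 0" "summable w"
  shows "summable (\<lambda>j. w j / real j)"
  by (rule summable_comparison_test'[OF assms(2), of 0]) (simp add: assms(1) div_nat_le)

text \<open>The exponential of a power series of radius at least \<open>1\<close> is holomorphic in
  the unit disc, so its Taylor series converges there.\<close>

lemma exp_coeff_sums_open:
  assumes "\<And>j. w j \<ge> 0" "summable w" "0 \<le> z" "z < 1"
  shows "(\<lambda>n. exp_coeff w n * z ^ n) sums exp (\<Sum>j. w j / real j * z ^ j)"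
proof -
  define G where "G = Abs_fps (\<lambda>j. complex_of_real (w j / real j))"
  have sw: "summable (\<lambda>j. w j / real j)"
    by (rule summable_div_nat[OF assms(1,2)])
  have "norm (1::complex) \<le> fps_conv_radius G"
    unfolding fps_conv_radius_def
    by (rule conv_radius_geI) (use sw in \<open>simp add: G_def summable_of_real del: of_real_divide\<close>)
  then have rad: "1 \<le> fps_conv_radius G" by (simp add: one_ereal_def)
  have rad0: "0 < fps_conv_radius G" using rad less_le_trans[of 0 1 "fps_conv_radius G"] by simp
  have "fps_nth G 0 = 0" by (simp add: G_def)
  then have "(exp \<circ> eval_fps G) has_fps_expansion (fps_exp 1 oo G)"
    using rad0 by (intro has_fps_expansion_compose has_fps_expansion_exp1 eval_fps_has_fps_expansion)
  moreover have "(exp \<circ> eval_fps G) holomorphic_on eball 0 1"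
  proof -
    have "eball 0 1 \<subseteq> (eball 0 (fps_conv_radius G) :: complex set)"
    proof
      fix z :: complex assume "z \<in> eball 0 1"
      then have "ereal (norm z) < 1" by (simp add: in_eball_iff)
      then have "ereal (norm z) < fps_conv_radius G" using rad by (rule less_le_trans)
      then show "z \<in> eball 0 (fps_conv_radius G)" by (simp add: in_eball_iff)
    qed
    then show ?thesis unfolding o_def by (intro holomorphic_intros)
  qed
  moreover have "ereal (norm (complex_of_real z)) < 1" using assms by (simp add: one_ereal_def)
  ultimately have "(\<lambda>n. fps_nth (fps_exp 1 oo G) n * of_real z ^ n) sums (exp \<circ> eval_fps G) (of_real z)"
    by (rule has_fps_expansion_imp_sums_complex)
  moreover have "eval_fps G (of_real z) = of_real (\<Sum>j. w j / real j * z ^ j)"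
  proof -
    have "summable (\<lambda>j. w j / real j * z ^ j)"
      by (rule summable_comparison_test'[OF sw, of 0])
         (use assms in \<open>auto intro!: divide_right_mono mult_left_le power_le_one\<close>)
    then have "(\<lambda>j. complex_of_real (w j / real j * z ^ j)) sums of_real (\<Sum>j. w j / real j * z ^ j)"
      using sums_of_real summable_sums by blast
    then show ?thesis unfolding eval_fps_def G_def by (simp add: sums_iff)
  qed
  ultimately have "(\<lambda>n. of_real (exp_coeff w n * z ^ n)) sums complex_of_real (exp (\<Sum>j. w j / real j * z ^ j))"
    using exp_coeff_complex[of w] by (simp add: G_def exp_of_real)
  then show ?thesis using sums_of_real_iff by blast
qed

text \<open>Passage to the boundary by monotonicity: with nonnegative terms, partial sums and the
  full sum can be compared with the values at \<open>z < 1\<close> from both sides.\<close>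

lemma exp_coeff_sums_one:
  assumes w: "\<And>j. w j \<ge> 0" "summable w"
  shows "exp_coeff w sums exp (\<Sum>j. w j / real j)"
proof -
  define U where "U z = (\<Sum>j. w j / real j * z ^ j)" for z :: real
  have sw: "summable (\<lambda>j. w j / real j)" by (rule summable_div_nat[OF w])
  have hn: "exp_coeff w n \<ge> 0" for n by (rule exp_coeff_nonneg) (rule w)
  have ev: "eventually (\<lambda>z::real. 0 < z \<and> z < 1) (at_left 1)"
    using eventually_at_left_real[of 0 "1::real"] by (auto elim: eventually_mono)
  have lim: "(U \<longlongrightarrow> (\<Sum>j. w j / real j)) (at_left 1)"
    unfolding U_def
  proof (rule tannery_uniform[OF _ _ sw])
    show "((\<lambda>z. w k / real k * z ^ k) \<longlongrightarrow> w k / real k) (at_left 1)" for k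
      by (rule tendsto_eq_intros refl | simp)+
    show "\<forall>\<^sub>F z in at_left 1. \<forall>k. \<bar>w k / real k * z ^ k\<bar> \<le> w k / real k"
      using ev
    proof eventually_elim
      case (elim z)
      have "w k / real k * z ^ k \<le> w k / real k" for k
        using elim w(1)[of k] by (intro mult_left_le power_le_one) auto
      then show ?case using elim w(1) by (simp add: abs_mult)
    qed
  qed simp
  then have limexp: "((\<lambda>z. exp (U z)) \<longlongrightarrow> exp (\<Sum>j. w j / real j)) (at_left 1)"
    by (rule tendsto_exp)
  have sums: "(\<lambda>n. exp_coeff w n * z ^ n) sums exp (U z)" if "0 < z" "z < 1" for z
    unfolding U_def by (rule exp_coeff_sums_open) (use w that in auto)
  have part: "sum (exp_coeff w) {..<M} \<le> exp (\<Sum>j. w j / real j)" for M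
  proof (rule tendsto_le[OF _ limexp])
    show "((\<lambda>z. \<Sum>n<M. exp_coeff w n * z ^ n) \<longlongrightarrow> sum (exp_coeff w) {..<M}) (at_left 1)"
      by (rule tendsto_eq_intros refl | simp)+
    show "\<forall>\<^sub>F z in at_left 1. (\<Sum>n<M. exp_coeff w n * z ^ n) \<le> exp (U z)"
      using ev
    proof eventually_elim
      case (elim z)
      then have "(\<Sum>n<M. exp_coeff w n * z ^ n) \<le> (\<Sum>n. exp_coeff w n * z ^ n)"
        using sums[of z] hn by (intro sum_le_suminf) (auto simp: sums_iff)
      then show ?case using sums[of z] elim by (simp add: sums_iff)
    qed
  qed simp
  have summ: "summable (exp_coeff w)"
    by (rule summableI_nonneg_bounded[OF hn part])
  have "suminf (exp_coeff w) \<le> exp (\<Sum>j. w j / real j)"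
    by (rule suminf_le_const[OF summ part])
  moreover have "exp (\<Sum>j. w j / real j) \<le> suminf (exp_coeff w)"
  proof (rule tendsto_upperbound[OF limexp])
    show "\<forall>\<^sub>F z in at_left 1. exp (U z) \<le> suminf (exp_coeff w)"
      using ev
    proof eventually_elim
      case (elim z)
      have "exp (U z) = (\<Sum>n. exp_coeff w n * z ^ n)" using sums[of z] elim by (simp add: sums_iff)
      also have "\<dots> \<le> suminf (exp_coeff w)"
        using sums[of z] elim hn by (intro suminf_le summ mult_left_le power_le_one) (auto simp: sums_iff)
      finally show ?case .
    qed
  qed simp
  ultimately show ?thesis using summ by (simp add: sums_iff)
qed

lemma exp_coeff_sums:
  assumes "\<And>j. w j \<ge> 0" "summable w" "0 \<le> z" "z \<le> 1"
  shows "(\<lambda>n. exp_coeff w n * z ^ n) sums exp (\<Sum>j. w j / real j * z ^ j)"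
  using exp_coeff_sums_open[OF assms(1-3)] exp_coeff_sums_one[OF assms(1,2)] assms(4)
  by (cases "z = 1") auto

text \<open>Below, \<open>p j = \<kappa>\<^sub>j R\<^sup>j\<close>, \<open>t j = \<theta>\<^sub>j R\<^sup>j\<close> for \<open>j \<ge> 1\<close>, and \<open>h N N = R\<^sup>N H\<^sub>N\<close>.\<close>
locale condensation =
  fixes p t :: "nat \<Rightarrow> real" and s c \<nu> :: real
  assumes p_nonneg: "p j \<ge> 0" and t_nonneg: "t j \<ge> 0"
    and p_0: "p 0 = 0" and t_0: "t 0 = 0"
    and p_sums: "p sums (1 - \<nu>)" and \<nu>: "0 < \<nu>" "\<nu> < 1"
    and t_summable: "summable t"
    and s: "s > 1" and c: "c > 0"
    and p_tail: "(\<lambda>j. p j * real j powr s) \<longlonglongrightarrow> c"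
    and t_tail: "(\<lambda>j. t j * real j powr s) \<longlonglongrightarrow> 0"
begin

section \<open>The compound Poisson law and its Laplace transform\<close>

definition u :: "nat \<Rightarrow> nat \<Rightarrow> real" where "u N j = t j + real N * p j"
definition h :: "nat \<Rightarrow> nat \<Rightarrow> real" where "h N n = exp_coeff (u N) n"
text \<open>The total mass of \<open>h N\<close>. The quotients \<open>h N n / Z N\<close> are the
  law of a sum of \<open>j\<close> times independent Poisson variables with parameters
  \<open>u N j / real j\<close>; its mean is \<open>suminf (u N)\<close>.\<close>

definition Z :: "nat \<Rightarrow> real" where "Z N = exp (\<Sum>j. u N j / real j)"

lemma p_summable: "summable p" and p_suminf: "suminf p = 1 - \<nu>"
  using p_sums by (auto simp: sums_iff)

lemma u_nonneg: "u N j \<ge> 0"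
  by (simp add: u_def p_nonneg t_nonneg)

lemma u_summable: "summable (u N)"
  unfolding u_def by (intro summable_add summable_mult t_summable p_summable)

lemma u_suminf: "suminf (u N) = suminf t + real N * (1 - \<nu>)"
  unfolding u_def using t_summable p_summable
  by (simp add: suminf_add[symmetric] suminf_mult summable_mult p_suminf)

lemma Z_pos: "Z N > 0" by (simp add: Z_def)

lemma h_nonneg: "h N n \<ge> 0"
  unfolding h_def by (rule exp_coeff_nonneg) (rule u_nonneg)

lemma h_sums: "h N sums Z N"
  unfolding h_def Z_def by (rule exp_coeff_sums_one[OF u_nonneg u_summable])

lemma h_rec: "n > 0 \<Longrightarrow> real n * h N n = (\<Sum>l=1..n. u N l * h N (n - l))"
  unfolding h_def by (rule exp_coeff_rec)

lemma sum_h_le: "finite A \<Longrightarrow> sum (h N) A \<le> Z N"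
  using sum_le_suminf[OF sums_summable[OF h_sums], of A N] h_sums[of N] h_nonneg by (simp add: sums_iff)

lemma laplace_sums:
  assumes "x \<ge> 0"
  shows "(\<lambda>n. h N n / Z N * exp (- (x / real N) * real n)) sums
    exp (\<Sum>j. u N j / real j * (exp (- (x / real N) * real j) - 1))"
proof -
  let ?z = "exp (- (x / real N))"
  have pw: "?z ^ n = exp (- (x / real N) * real n)" for n
    by (simp add: exp_of_nat2_mult[symmetric] mult_ac flip: exp_of_nat_mult)
  have z: "0 \<le> ?z" "?z \<le> 1" using assms by auto
  have s1: "summable (\<lambda>j. u N j / real j)" by (rule summable_div_nat[OF u_nonneg u_summable])
  have s2: "summable (\<lambda>j. u N j / real j * ?z ^ j)"
    by (rule summable_comparison_test'[OF s1, of 0])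
       (use u_nonneg[of N] power_le_one[OF z] in \<open>auto simp: abs_mult intro!: mult_left_le divide_right_mono\<close>)
  have "(\<lambda>n. h N n * ?z ^ n) sums exp (\<Sum>j. u N j / real j * ?z ^ j)"
    unfolding h_def by (rule exp_coeff_sums[OF u_nonneg u_summable z])
  then have "(\<lambda>n. h N n * ?z ^ n / Z N) sums (exp (\<Sum>j. u N j / real j * ?z ^ j) / Z N)"
    by (rule sums_divide)
  also have "exp (\<Sum>j. u N j / real j * ?z ^ j) / Z N = exp (\<Sum>j. u N j / real j * (?z ^ j - 1))"
    unfolding Z_def exp_diff[symmetric] right_diff_distrib
    using suminf_diff[OF s2 s1] by simp
  finally show ?thesis by (simp only: pw times_divide_eq_left)
qed

text \<open>To first order only the mean jump survives, and the weights \<open>t\<close>, lacking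
  the factor \<open>N\<close>, disappear. Domination uses
  \<open>1 - exp (- y) \<le> min 1 y\<close>: the bound \<open>1\<close> for \<open>t\<close>, and
  for \<open>p\<close> the bound \<open>y = x * j / N\<close>, which absorbs the factor
  \<open>N\<close>.\<close>

lemma laplace_limit:
  assumes x: "x \<ge> 0"
  shows "(\<lambda>N. \<Sum>n. h N n / Z N * exp (- (x / real N) * real n)) \<longlonglongrightarrow> exp (- x * (1 - \<nu>))"
proof -
  have "(\<lambda>N. \<Sum>j. u N j / real j * (exp (- (x / real N) * real j) - 1)) \<longlonglongrightarrow> (\<Sum>j. - x * p j)"
  proof (rule tannery_uniform[where M = "\<lambda>j. t j + x * p j"])
    fix j
    show "(\<lambda>N. u N j / real j * (exp (- (x / real N) * real j) - 1)) \<longlonglongrightarrow> - x * p j"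
    proof (cases "j = 0")
      case False
      then have j: "real j > 0" by simp
      have 1: "(\<lambda>N. exp (- (x / real N) * real j) - 1) \<longlonglongrightarrow> 0"
        by real_asymp
      have 2: "(\<lambda>N. real N * (exp (- (x / real N) * real j) - 1)) \<longlonglongrightarrow> - (x * real j)"
        by real_asymp
      have "(\<lambda>N. t j / real j * (exp (- (x / real N) * real j) - 1) +
          p j / real j * (real N * (exp (- (x / real N) * real j) - 1))) \<longlonglongrightarrow> t j / real j * 0 + p j / real j * (- (x * real j))"
        by (intro tendsto_intros 1 2)
      moreover have "t j / real j * E + p j / real j * (real N * E) = u N j / real j * E" for E N
        by (simp add: u_def add_divide_distrib distrib_right)
      moreover have "t j / real j * 0 + p j / real j * (- (x * real j)) = - x * p j" using j by simp
      ultimately show ?thesis by (simp only:)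
    qed (simp add: p_0)
  next
    show "\<forall>\<^sub>F N in sequentially. \<forall>j. \<bar>u N j / real j * (exp (- (x / real N) * real j) - 1)\<bar> \<le> t j + x * p j"
      using eventually_gt_at_top[of 0]
    proof eventually_elim
      case (elim N)
      show ?case
      proof
        fix j
        define y where "y = (x / real N) * real j"
        have y: "y \<ge> 0" using x by (simp add: y_def)
        have e: "\<bar>exp (- y) - 1\<bar> \<le> 1" "\<bar>exp (- y) - 1\<bar> \<le> y"
          using y exp_ge_add_one_self[of "- y"] by auto
        show "\<bar>u N j / real j * (exp (- (x / real N) * real j) - 1)\<bar> \<le> t j + x * p j"
        proof (cases "j = 0")
          case False
          have "\<bar>u N j / real j * (exp (- y) - 1)\<bar> = u N j / real j * \<bar>exp (- y) - 1\<bar>"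
            using u_nonneg[of N j] by (simp add: abs_mult)
          also have "\<dots> = t j / real j * \<bar>exp (- y) - 1\<bar> + real N * p j / real j * \<bar>exp (- y) - 1\<bar>"
            by (simp add: u_def add_divide_distrib distrib_right)
          also have "\<dots> \<le> t j * 1 + real N * p j / real j * y"
            using p_nonneg[of j] t_nonneg[of j] e div_nat_le[of "t j" j] by (intro add_mono mult_mono) auto
          also have "real N * p j / real j * y = x * p j" using False elim by (simp add: y_def)
          finally show ?thesis by (simp add: y_def)
        qed (simp add: p_0 t_0)
      qed
    qed
  qed (intro summable_add summable_mult t_summable p_summable | simp)+
  also have "(\<Sum>j. - x * p j) = - x * (1 - \<nu>)" by (simp add: suminf_mult[OF p_summable] suminf_minus p_summable summable_mult p_suminf)
  finally have "(\<lambda>N. exp (\<Sum>j. u N j / real j * (exp (- (x / real N) * real j) - 1))) \<longlonglongrightarrow> exp (- x * (1 - \<nu>))"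
    by (rule tendsto_exp)
  then show ?thesis using laplace_sums[OF x] by (simp add: sums_iff)
qed

definition \<mu> :: real where "\<mu> = exp (- (1 - \<nu>))"

text \<open>Expanding the square leaves only the transforms at \<open>x = 2\<close> and
  \<open>x = 1\<close> and the total mass.\<close>

lemma laplace_variance:
  "(\<lambda>n. h N n / Z N * (exp (- (real n / real N)) - \<mu>)\<^sup>2) sums
     ((\<Sum>n. h N n / Z N * exp (- (2 / real N) * real n)) - 2 * \<mu> * (\<Sum>n. h N n / Z N * exp (- (1 / real N) * real n)) + \<mu>\<^sup>2)"
proof -
  have s2: "(\<lambda>n. h N n / Z N * exp (- (2 / real N) * real n)) sums (\<Sum>n. h N n / Z N * exp (- (2 / real N) * real n))"
    using laplace_sums[of 2 N] by (simp add: sums_iff)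
  have s1: "(\<lambda>n. h N n / Z N * exp (- (1 / real N) * real n)) sums (\<Sum>n. h N n / Z N * exp (- (1 / real N) * real n))"
    using laplace_sums[of 1 N] by (simp add: sums_iff)
  have s0: "(\<lambda>n. h N n / Z N) sums 1"
    using sums_divide[OF h_sums, of N "Z N"] Z_pos[of N] by simp
  have "(\<lambda>n. h N n / Z N * exp (- (2 / real N) * real n) - 2 * \<mu> * (h N n / Z N * exp (- (1 / real N) * real n)) + \<mu>\<^sup>2 * (h N n / Z N)) sums
     ((\<Sum>n. h N n / Z N * exp (- (2 / real N) * real n)) - 2 * \<mu> * (\<Sum>n. h N n / Z N * exp (- (1 / real N) * real n)) + \<mu>\<^sup>2 * 1)"
    by (intro sums_add sums_diff sums_mult s0 s1 s2)
  moreover have "h N n / Z N * exp (- (2 / real N) * real n) - 2 * \<mu> * (h N n / Z N * exp (- (1 / real N) * real n)) + \<mu>\<^sup>2 * (h N n / Z N)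
     = h N n / Z N * (exp (- (real n / real N)) - \<mu>)\<^sup>2" for n
  proof -
    have "exp (- (2 / real N) * real n) = (exp (- (real n / real N)))\<^sup>2"
      by (simp add: exp_double[symmetric])
    moreover have "exp (- (1 / real N) * real n) = exp (- (real n / real N))" by simp
    ultimately show ?thesis by (simp only: power2_diff) (simp add: algebra_simps)
  qed
  ultimately show ?thesis by simp
qed

lemma variance_tendsto_0:
  "(\<lambda>N. \<Sum>n. h N n / Z N * (exp (- (real n / real N)) - \<mu>)\<^sup>2) \<longlonglongrightarrow> 0"
proof -
  have "(\<lambda>N. (\<Sum>n. h N n / Z N * exp (- (2 / real N) * real n)) - 2 * \<mu> * (\<Sum>n. h N n / Z N * exp (- (1 / real N) * real n)) + \<mu>\<^sup>2)
     \<longlonglongrightarrow> exp (- 2 * (1 - \<nu>)) - 2 * \<mu> * exp (- 1 * (1 - \<nu>)) + \<mu>\<^sup>2"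
    by (intro tendsto_intros laplace_limit) auto
  also have "exp (- 2 * (1 - \<nu>)) - 2 * \<mu> * exp (- 1 * (1 - \<nu>)) + \<mu>\<^sup>2 = 0"
  proof -
    have "exp (- 2 * (1 - \<nu>)) = \<mu>\<^sup>2" unfolding \<mu>_def by (simp only: exp_double[symmetric]) (simp add: algebra_simps)
    moreover have "exp (- 1 * (1 - \<nu>)) = \<mu>" by (simp add: \<mu>_def)
    ultimately show ?thesis by (simp add: power2_eq_square)
  qed
  finally show ?thesis using laplace_variance by (simp add: sums_iff)
qed

text \<open>Encodes the joint limit, \<open>N\<close> to infinity and \<open>n / N\<close> to the
  mean \<open>1 - \<nu>\<close>, as one filter on pairs, so that the usual limit rules apply to
  functions of both.\<close>

definition bulk :: "(nat \<times> nat) filter" where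
  "bulk = filtercomap (\<lambda>(N, n). (N, real n / real N)) (sequentially \<times>\<^sub>F nhds (1 - \<nu>))"

lemma bulk_limits:
  "filterlim fst at_top bulk"
  "((\<lambda>x. real (snd x) / real (fst x)) \<longlongrightarrow> 1 - \<nu>) bulk"
proof -
  have f: "filterlim (\<lambda>(N, n). (N, real n / real N)) (sequentially \<times>\<^sub>F nhds (1 - \<nu>)) bulk"
    unfolding bulk_def by (rule filterlim_filtercomap)
  show "filterlim fst at_top bulk"
    using filterlim_compose[OF filterlim_fst f] by (simp add: case_prod_unfold)
  show "((\<lambda>x. real (snd x) / real (fst x)) \<longlongrightarrow> 1 - \<nu>) bulk"
    using filterlim_compose[OF filterlim_snd f] by (simp add: case_prod_unfold)
qed

lemma eventually_bulkD:
  assumes "eventually P bulk"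
  obtains N0 \<epsilon> where "\<epsilon> > 0" "\<And>N n. N \<ge> N0 \<Longrightarrow> \<bar>real n / real N - (1 - \<nu>)\<bar> < \<epsilon> \<Longrightarrow> P (N, n)"
proof -
  from assms obtain Q where Q: "eventually Q (sequentially \<times>\<^sub>F nhds (1 - \<nu>))"
      "\<And>x. Q ((\<lambda>(N, n). (N, real n / real N)) x) \<Longrightarrow> P x"
    unfolding bulk_def eventually_filtercomap by blast
  from Q(1) obtain A B where AB: "eventually A sequentially" "eventually B (nhds (1 - \<nu>))"
      "\<And>x y. A x \<Longrightarrow> B y \<Longrightarrow> Q (x, y)"
    unfolding eventually_prod_filter by blast
  obtain N0 where "\<And>N. N \<ge> N0 \<Longrightarrow> A N" using AB(1) unfolding eventually_sequentially by blast
  moreover obtain \<epsilon> where "\<epsilon> > 0" "\<And>y. dist y (1 - \<nu>) < \<epsilon> \<Longrightarrow> B y"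
    using AB(2) unfolding eventually_nhds_metric by blast
  ultimately show ?thesis
    using that[of \<epsilon> N0] AB(3) Q(2) by (fastforce simp: dist_real_def)
qed

text \<open>Law of large numbers for the compound Poisson weights \<open>h N n / Z N\<close>. Only the mean is
  assumed finite, so Chebyshev's inequality is applied to \<open>exp (- n / N)\<close> rather than to \<open>n\<close>.\<close>
lemma bulk_average:
  assumes bound: "\<And>N n. N \<ge> N1 \<Longrightarrow> \<bar>\<phi> N n\<bar> \<le> C"
    and lim: "((\<lambda>x. \<phi> (fst x) (snd x)) \<longlongrightarrow> L) bulk"
  shows "(\<lambda>N. \<Sum>n. h N n / Z N * \<phi> N n) \<longlonglongrightarrow> L"
proof (rule LIMSEQ_I)
  fix e :: real assume e: "e > 0"
  have C: "C \<ge> 0" using bound[of N1 0] by simp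
  define V where "V N = (\<Sum>n. h N n / Z N * (exp (- (real n / real N)) - \<mu>)\<^sup>2)" for N
  have "eventually (\<lambda>x. dist (\<phi> (fst x) (snd x)) L < e / 2) bulk"
    using lim e by (intro tendstoD) auto
  then obtain N2 \<epsilon> where \<epsilon>: "\<epsilon> > 0"
      "\<And>N n. N \<ge> N2 \<Longrightarrow> \<bar>real n / real N - (1 - \<nu>)\<bar> < \<epsilon> \<Longrightarrow> \<bar>\<phi> N n - L\<bar> < e / 2"
    by (elim eventually_bulkD) (auto simp: dist_real_def)
  define \<eta> where "\<eta> = min (\<mu> - exp (- (1 - \<nu> + \<epsilon>))) (exp (- (1 - \<nu> - \<epsilon>)) - \<mu>)"
  have \<eta>: "\<eta> > 0" using \<epsilon>(1) by (auto simp: \<eta>_def \<mu>_def)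
  \<comment> \<open>Chosen so that outside the window, where \<open>exp (- n / N)\<close> is at
    least \<open>\<eta>\<close> away from \<open>\<mu>\<close>, the quadratic term alone covers the
    trivial bound \<open>C + \<bar>L\<bar>\<close>.\<close>
  define K where "K = (C + \<bar>L\<bar>) / \<eta>\<^sup>2"
  have K: "K \<ge> 0" using C by (simp add: K_def)
  have pt: "\<bar>\<phi> N n - L\<bar> \<le> e / 2 + K * (exp (- (real n / real N)) - \<mu>)\<^sup>2" if "N \<ge> N1" "N \<ge> N2" for N n
  proof (cases "\<bar>real n / real N - (1 - \<nu>)\<bar> < \<epsilon>")
    case True
    have "0 \<le> K * (exp (- (real n / real N)) - \<mu>)\<^sup>2" using K by simp
    then show ?thesis using \<epsilon>(2)[OF that(2) True] by linarith
  next
    case False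
    then have "real n / real N \<ge> 1 - \<nu> + \<epsilon> \<or> real n / real N \<le> 1 - \<nu> - \<epsilon>" by (auto simp: abs_if split: if_splits)
    then have "exp (- (real n / real N)) \<le> exp (- (1 - \<nu> + \<epsilon>)) \<or> exp (- (real n / real N)) \<ge> exp (- (1 - \<nu> - \<epsilon>))"
      by auto
    then have "\<eta> \<le> \<bar>exp (- (real n / real N)) - \<mu>\<bar>" unfolding \<eta>_def by linarith
    then have "\<eta>\<^sup>2 \<le> (exp (- (real n / real N)) - \<mu>)\<^sup>2"
      using \<eta> by (metis abs_le_square_iff abs_of_pos)
    then have "K * \<eta>\<^sup>2 \<le> K * (exp (- (real n / real N)) - \<mu>)\<^sup>2" using K by (rule mult_left_mono)
    moreover have "K * \<eta>\<^sup>2 = C + \<bar>L\<bar>" using \<eta> by (simp add: K_def)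
    moreover have "\<bar>\<phi> N n - L\<bar> \<le> C + \<bar>L\<bar>" using bound[OF that(1), of n] by linarith
    ultimately show ?thesis using e by linarith
  qed
  have "(\<lambda>N. K * V N) \<longlonglongrightarrow> K * 0"
    unfolding V_def by (intro tendsto_intros variance_tendsto_0)
  then have "eventually (\<lambda>N. K * V N < e / 2) sequentially"
    using e by (intro order_tendstoD) auto
  then obtain N3 where N3: "\<And>N. N \<ge> N3 \<Longrightarrow> K * V N < e / 2"
    unfolding eventually_sequentially by blast
  show "\<exists>no. \<forall>N\<ge>no. norm ((\<Sum>n. h N n / Z N * \<phi> N n) - L) < e"
  proof (intro exI allI impI)
    fix N assume N: "N \<ge> max N1 (max N2 N3)"
    have q: "h N n / Z N \<ge> 0" for n using h_nonneg Z_pos by (simp add: less_imp_le)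
    have s0: "(\<lambda>n. h N n / Z N) sums 1"
      using sums_divide[OF h_sums, of N "Z N"] Z_pos[of N] by simp
    have sV: "(\<lambda>n. h N n / Z N * (exp (- (real n / real N)) - \<mu>)\<^sup>2) sums V N"
      using laplace_variance[of N] by (simp add: V_def sums_iff)
    have s1: "(\<lambda>n. h N n / Z N * (e / 2) + K * (h N n / Z N * (exp (- (real n / real N)) - \<mu>)\<^sup>2)) sums (1 * (e / 2) + K * V N)"
      by (intro sums_add sums_mult sums_mult2 s0 sV)
    have bd: "norm (h N n / Z N * (\<phi> N n - L)) \<le> h N n / Z N * (e / 2) + K * (h N n / Z N * (exp (- (real n / real N)) - \<mu>)\<^sup>2)" for n
    proof -
      have "norm (h N n / Z N * (\<phi> N n - L)) = h N n / Z N * \<bar>\<phi> N n - L\<bar>"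
        using q[of n] by (simp only: real_norm_def abs_mult abs_of_nonneg)
      also have "\<dots> \<le> h N n / Z N * (e / 2 + K * (exp (- (real n / real N)) - \<mu>)\<^sup>2)"
        using pt[of N n] N q[of n] by (intro mult_left_mono) auto
      finally show ?thesis by (simp add: algebra_simps)
    qed
    have sd: "summable (\<lambda>n. h N n / Z N * (\<phi> N n - L))"
      by (rule summable_comparison_test'[of _ 0, OF sums_summable[OF s1]]) (rule bd)
    have sL: "(\<lambda>n. h N n / Z N * L) sums (1 * L)" by (rule sums_mult2[OF s0])
    have "(\<lambda>n. h N n / Z N * (\<phi> N n - L) + h N n / Z N * L) sums ((\<Sum>n. h N n / Z N * (\<phi> N n - L)) + 1 * L)"
      by (intro sums_add sL summable_sums sd)
    moreover have "h N n / Z N * (\<phi> N n - L) + h N n / Z N * L = h N n / Z N * \<phi> N n" for n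
      by (simp only: distrib_left[symmetric]) simp
    ultimately have "(\<lambda>n. h N n / Z N * \<phi> N n) sums ((\<Sum>n. h N n / Z N * (\<phi> N n - L)) + 1 * L)"
      by (simp only:)
    then have "(\<Sum>n. h N n / Z N * \<phi> N n) - L = (\<Sum>n. h N n / Z N * (\<phi> N n - L))"
      by (simp add: sums_iff)
    then have "norm ((\<Sum>n. h N n / Z N * \<phi> N n) - L) = norm (\<Sum>n. h N n / Z N * (\<phi> N n - L))"
      by (rule arg_cong)
    also have "norm (\<Sum>n. h N n / Z N * (\<phi> N n - L)) \<le> (\<Sum>n. h N n / Z N * (e / 2) + K * (h N n / Z N * (exp (- (real n / real N)) - \<mu>)\<^sup>2))"
      by (rule norm_suminf_le[OF bd sums_summable[OF s1]])
    also have "\<dots> = e / 2 + K * V N" using s1 by (simp add: sums_iff)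
    also have "\<dots> < e" using N3[of N] N by simp
    finally show "norm ((\<Sum>n. h N n / Z N * \<phi> N n) - L) < e" .
  qed
qed

end

section \<open>One big jump\<close>

text \<open>With \<open>K' = \<bar>K\<bar> + \<bar>w / \<nu>\<bar>\<close>, \<open>(1 - \<nu>) ^ i * K'\<close> bounds the upper limits of all \<open>\<bar>X d N - w / \<nu>\<bar>\<close>
  simultaneously, by induction on \<open>i\<close>.\<close>
lemma contraction_limit:
  fixes X W :: "nat \<Rightarrow> nat \<Rightarrow> real" and a :: "nat \<Rightarrow> nat \<Rightarrow> nat \<Rightarrow> real"
  assumes rec: "\<And>d. eventually (\<lambda>N. X d N = (\<Sum>j. a d N j * X (d + j) N) + W d N) sequentially"
    and fin: "\<And>d N. finite {j. a d N j \<noteq> 0}"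
    and a_lim: "\<And>d j. (\<lambda>N. a d N j) \<longlonglongrightarrow> p j"
    and a_nonneg: "\<And>d N j. a d N j \<ge> 0"
    and a_le: "\<And>d. eventually (\<lambda>N. \<forall>j. a d N j \<le> M j) sequentially"
    and M: "summable M"
    and X: "\<And>d. eventually (\<lambda>N. \<forall>j. a d N j \<noteq> 0 \<longrightarrow> \<bar>X (d + j) N\<bar> \<le> K) sequentially"
    and X0: "\<And>d. eventually (\<lambda>N. \<bar>X d N\<bar> \<le> K) sequentially"
    and W: "\<And>d. W d \<longlonglongrightarrow> w"
    and p: "p sums (1 - \<nu>)" and \<nu>: "0 < \<nu>" "\<nu> < 1"
  shows "X d \<longlonglongrightarrow> w / \<nu>"
proof -
  \<comment> \<open>The fixed point of \<open>x = (1 - \<nu>) * x + w\<close>, the recursion in the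
    limit.\<close>
  define x where "x = w / \<nu>"
  define K' where "K' = \<bar>K\<bar> + \<bar>x\<bar>"
  have K': "K' \<ge> 0" by (simp add: K'_def)
  have sum_a: "(\<lambda>N. \<Sum>j. a d N j) \<longlonglongrightarrow> 1 - \<nu>" for d
  proof -
    have "(\<lambda>N. \<Sum>j. a d N j) \<longlonglongrightarrow> (\<Sum>j. p j)"
      by (rule tannery_uniform[OF a_lim _ M]) (use a_le a_nonneg in auto)
    then show ?thesis using p by (simp add: sums_iff)
  qed
  have main: "\<forall>d. \<forall>e>0. eventually (\<lambda>N. \<bar>X d N - x\<bar> \<le> (1 - \<nu>) ^ i * K' + e) sequentially" for i
  proof (induction i)
    case 0
    show ?case
    proof (intro allI impI)
      fix d :: nat and e :: real assume "e > 0"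
      then show "eventually (\<lambda>N. \<bar>X d N - x\<bar> \<le> (1 - \<nu>) ^ 0 * K' + e) sequentially"
        using X0[of d] by (auto elim!: eventually_mono simp: K'_def)
    qed
  next
    case (Suc i)
    define m where "m = (1 - \<nu>) ^ i * K'"
    have m: "m \<ge> 0" using K' \<nu> by (simp add: m_def)
    show ?case
    proof (intro allI impI)
      fix d :: nat and e :: real assume e: "e > 0"
      \<comment> \<open>The excess over the bound of the previous round. It tends to
        \<open>0\<close> for each \<open>j\<close> separately; domination by \<open>M j * K'\<close>
        makes its weighted sum vanish.\<close>
      define D where "D N j = max 0 (\<bar>X (d + j) N - x\<bar> - m)" for N j
      have D0: "D N j \<ge> 0" for N j by (simp add: D_def)
      have D_lim: "(\<lambda>N. D N j) \<longlonglongrightarrow> 0" for j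
      proof (rule LIMSEQ_I)
        fix r :: real assume r: "r > 0"
        have "eventually (\<lambda>N. \<bar>X (d + j) N - x\<bar> \<le> m + r / 2) sequentially"
          using Suc r unfolding m_def by simp
        then have "eventually (\<lambda>N. norm (D N j - 0) < r) sequentially"
          by (rule eventually_mono) (use r in \<open>auto simp: D_def\<close>)
        then show "\<exists>no. \<forall>N\<ge>no. norm (D N j - 0) < r" by (simp add: eventually_sequentially)
      qed
      have sum_D: "(\<lambda>N. \<Sum>j. a d N j * D N j) \<longlonglongrightarrow> (\<Sum>j. p j * 0)"
      proof (rule tannery_uniform[where M = "\<lambda>j. M j * K'"])
        show "(\<lambda>N. a d N j * D N j) \<longlonglongrightarrow> p j * 0" for j
          by (intro tendsto_mult a_lim D_lim)
        show "\<forall>\<^sub>F N in sequentially. \<forall>j. \<bar>a d N j * D N j\<bar> \<le> M j * K'"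
          using a_le[of d] X[of d]
        proof eventually_elim
          case (elim N)
          show ?case
          proof
            fix j
            show "\<bar>a d N j * D N j\<bar> \<le> M j * K'"
            proof (cases "a d N j = 0")
              case True
              then show ?thesis using elim(1) K' by (metis abs_zero mult_nonneg_nonneg mult_zero_left)
            next
              case False
              then have "\<bar>X (d + j) N\<bar> \<le> K" using elim(2) by simp
              then have "D N j \<le> K'" using m K' by (auto simp: D_def K'_def)
              then show ?thesis using elim(1) a_nonneg[of d N j] D0[of N j]
                by (simp add: abs_mult) (meson mult_mono order_trans)
            qed
          qed
        qed
      qed (use M in \<open>auto intro: summable_mult2\<close>)
      \<comment> \<open>Three contributions: the old bound contracted by the total mass
        \<open>1 - \<nu>\<close>, the vanishing excess, and the defect of \<open>x\<close> in the
        fixed-point equation.\<close>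
      have "(\<lambda>N. m * (\<Sum>j. a d N j) + (\<Sum>j. a d N j * D N j) + \<bar>W d N + x * (\<Sum>j. a d N j) - x\<bar>)
          \<longlonglongrightarrow> m * (1 - \<nu>) + (\<Sum>j. p j * 0) + \<bar>w + x * (1 - \<nu>) - x\<bar>"
        by (intro tendsto_intros sum_a sum_D W)
      also have "m * (1 - \<nu>) + (\<Sum>j. p j * 0) + \<bar>w + x * (1 - \<nu>) - x\<bar> = m * (1 - \<nu>)"
        using \<nu> by (simp add: x_def field_simps)
      finally have "eventually (\<lambda>N. m * (\<Sum>j. a d N j) + (\<Sum>j. a d N j * D N j) + \<bar>W d N + x * (\<Sum>j. a d N j) - x\<bar>
          < m * (1 - \<nu>) + e) sequentially"
        using e by (intro order_tendstoD) auto
      then show "eventually (\<lambda>N. \<bar>X d N - x\<bar> \<le> (1 - \<nu>) ^ Suc i * K' + e) sequentially"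
        using rec[of d]
      proof eventually_elim
        case (elim N)
        have summ: "summable (\<lambda>j. a d N j * Y j)" for Y
          by (rule summable_finite[OF fin[of d N]]) auto
        have summ1: "summable (\<lambda>j. a d N j)" using summ[of "\<lambda>_. 1"] by simp
        have "(\<Sum>j. a d N j * (X (d + j) N - x)) = (\<Sum>j. a d N j * X (d + j) N) - (\<Sum>j. a d N j * x)"
          unfolding right_diff_distrib by (rule suminf_diff[symmetric, OF summ summ])
        also have "(\<Sum>j. a d N j * x) = x * (\<Sum>j. a d N j)"
          using suminf_mult2[OF summ1, of x] by (simp add: mult.commute)
        finally have 1: "X d N - x = (\<Sum>j. a d N j * (X (d + j) N - x)) + (W d N + x * (\<Sum>j. a d N j) - x)"
          using elim(2) by simp
        have "\<bar>\<Sum>j. a d N j * (X (d + j) N - x)\<bar> \<le> (\<Sum>j. a d N j * (m + D N j))"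
        proof (rule norm_suminf_le[of "\<lambda>j. a d N j * (X (d + j) N - x)", unfolded real_norm_def])
          fix j
          have "\<bar>X (d + j) N - x\<bar> \<le> m + D N j" by (simp add: D_def)
          then show "\<bar>a d N j * (X (d + j) N - x)\<bar> \<le> a d N j * (m + D N j)"
            using a_nonneg[of d N j] by (simp add: abs_mult mult_left_mono)
        qed (rule summ)
        also have "\<dots> = (\<Sum>j. a d N j * m) + (\<Sum>j. a d N j * D N j)"
          unfolding distrib_left by (rule suminf_add[symmetric, OF summ summ])
        also have "(\<Sum>j. a d N j * m) = m * (\<Sum>j. a d N j)"
          using suminf_mult2[OF summ1, of m] by (simp add: mult.commute)
        finally have "\<bar>X d N - x\<bar> \<le> m * (1 - \<nu>) + e"
          using elim(1) 1 by linarith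
        then show ?case by (simp add: m_def mult_ac)
      qed
    qed
  qed
  have "X d \<longlonglongrightarrow> x"
  proof (rule LIMSEQ_I)
    fix r :: real assume r: "r > 0"
    have "(\<lambda>i. (1 - \<nu>) ^ i * K') \<longlonglongrightarrow> 0 * K'"
      using \<nu> by (intro tendsto_intros LIMSEQ_power_zero) auto
    then have "eventually (\<lambda>i. (1 - \<nu>) ^ i * K' < r / 2) sequentially"
      using r by (intro order_tendstoD) auto
    then obtain i where i: "(1 - \<nu>) ^ i * K' < r / 2" by (auto simp: eventually_sequentially)
    have "eventually (\<lambda>N. \<bar>X d N - x\<bar> \<le> (1 - \<nu>) ^ i * K' + r / 2) sequentially"
      using main r by simp
    then have "eventually (\<lambda>N. norm (X d N - x) < r) sequentially"
      by eventually_elim (use i in auto)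
    then show "\<exists>no. \<forall>N\<ge>no. norm (X d N - x) < r" by (simp add: eventually_sequentially)
  qed
  then show ?thesis by (simp add: x_def)
qed

context condensation
begin

section \<open>Polynomial bounds on \<open>h\<close> above the mean\<close>

lemma u_le_tail: "\<exists>C1>0. \<forall>N\<ge>1. \<forall>j\<ge>1. u N j \<le> real N * (C1 * real j powr - s)"
proof -
  obtain Cp where Cp: "Cp > 0" "\<And>j. norm (p j * real j powr s) \<le> Cp"
    using convergent_imp_Bseq[OF convergentI[OF p_tail]] unfolding Bseq_def by auto
  obtain Ct where Ct: "Ct > 0" "\<And>j. norm (t j * real j powr s) \<le> Ct"
    using convergent_imp_Bseq[OF convergentI[OF t_tail]] unfolding Bseq_def by auto
  show ?thesis
  proof (intro exI[of _ "Ct + Cp"] conjI allI impI)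
    fix N j :: nat assume N: "1 \<le> N" "1 \<le> j"
    have "p j * real j powr s \<le> Cp" "t j * real j powr s \<le> Ct"
      using Cp(2)[of j] Ct(2)[of j] by auto
    then have "p j \<le> Cp * real j powr - s" "t j \<le> Ct * real j powr - s"
      using N by (simp_all add: powr_minus field_simps)
    moreover have "t j \<le> real N * t j" using N t_nonneg[of j] mult_right_mono[of 1 "real N" "t j"] by simp
    ultimately have "u N j \<le> real N * (Ct * real j powr - s) + real N * (Cp * real j powr - s)"
      unfolding u_def by (smt (verit) mult_left_mono of_nat_0_le_iff)
    then show "u N j \<le> real N * ((Ct + Cp) * real j powr - s)" by (simp add: algebra_simps)
  qed (use Cp Ct in auto)
qed

lemma sum_u_le: "finite A \<Longrightarrow> sum (u N) A \<le> suminf t + real N * (1 - \<nu>)"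
  using sum_le_suminf[OF u_summable, of A N] u_nonneg u_suminf[of N] by auto

text \<open>Splitting the recursion of \<open>h\<close> at \<open>l = \<gamma> d\<close>, where \<open>d = n - \<alpha> N\<close>, the short jumps lose
  a factor \<open>\<rho> < 1\<close> because \<open>\<alpha>\<close> exceeds the mean \<open>1 - \<nu>\<close>.\<close>
lemma h_apriori:
  assumes \<alpha>: "1 - \<nu> < \<alpha>"
  shows "\<exists>C>0. eventually (\<lambda>N. \<forall>n. real n > \<alpha> * real N \<longrightarrow>
           h N n \<le> C * Z N * (real n - \<alpha> * real N) powr - s) sequentially"
proof -
  obtain C1 where C1: "C1 > 0" "\<And>N j. N \<ge> 1 \<Longrightarrow> j \<ge> 1 \<Longrightarrow> u N j \<le> real N * (C1 * real j powr - s)"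
    using u_le_tail by blast
  have \<alpha>0: "\<alpha> > 0" using \<alpha> \<nu> by linarith
  define \<beta> where "\<beta> = (1 - \<nu>) / \<alpha>"
  have \<beta>: "0 < \<beta>" "\<beta> < 1" using \<alpha> \<alpha>0 \<nu> by (auto simp: \<beta>_def)
  \<comment> \<open>Jumps up to \<open>\<gamma> * d\<close> leave a distance of at least
    \<open>g * d\<close>, which costs the factor \<open>g powr - s = 1 / y\<close>. Any
    \<open>y\<close> strictly between \<open>\<beta>\<close> and \<open>1\<close> keeps the
    resulting factor \<open>\<beta> / y\<close> below \<open>1\<close>, with room for the
    contribution of \<open>t\<close>.\<close>
  define y where "y = (1 + \<beta>) / 2"
  have y: "\<beta> < y" "y < 1" "0 < y" using \<beta> by (auto simp: y_def)
  define g where "g = y powr (1 / s)"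
  have g: "0 < g" "g < 1" using y s powr_less_mono2[of "1 / s" y 1] by (auto simp: g_def)
  have g_s: "g powr - s = 1 / y"
    using y s by (simp add: g_def powr_powr powr_minus field_simps)
  define \<gamma> where "\<gamma> = 1 - g"
  have \<gamma>: "0 < \<gamma>" "\<gamma> < 1" using g by (auto simp: \<gamma>_def)
  define \<rho> where "\<rho> = (1 + \<beta> / y) / 2"
  have by1: "\<beta> / y < 1" using y by simp
  have \<rho>: "\<beta> / y < \<rho>" "\<rho> < 1" unfolding \<rho>_def using by1 by (simp_all only: field_simps)
  \<comment> \<open>The solution of
    \<open>\<rho> * C + C1 * \<gamma> powr - s / \<alpha> = C\<close>, which closes the
    induction.\<close>
  define C where "C = C1 * \<gamma> powr - s / (\<alpha> * (1 - \<rho>))"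
  have C: "C > 0" unfolding C_def using C1 \<gamma> \<alpha>0 \<rho> by (intro divide_pos_pos mult_pos_pos) auto
  have "(\<lambda>N. (1 - \<nu> + suminf t / real N) / (\<alpha> * y)) \<longlonglongrightarrow> (1 - \<nu> + 0) / (\<alpha> * y)"
    by (intro tendsto_intros lim_const_over_n) (use \<alpha>0 y in auto)
  also have "(1 - \<nu> + 0) / (\<alpha> * y) = \<beta> / y" by (simp add: \<beta>_def)
  finally have "eventually (\<lambda>N. (1 - \<nu> + suminf t / real N) / (\<alpha> * y) < \<rho>) sequentially"
    using \<rho> by (intro order_tendstoD) auto
  then have "eventually (\<lambda>N. \<forall>n. real n > \<alpha> * real N \<longrightarrow>
           h N n \<le> C * Z N * (real n - \<alpha> * real N) powr - s) sequentially"
    using eventually_ge_at_top[of 1]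
  proof eventually_elim
    case (elim N)
    have N: "real N > 0" using elim(2) by simp
    have "real n > \<alpha> * real N \<longrightarrow> h N n \<le> C * Z N * (real n - \<alpha> * real N) powr - s" for n
    proof (induction n rule: less_induct)
      case (less n)
      show ?case
      proof
        assume n: "real n > \<alpha> * real N"
        define d where "d = real n - \<alpha> * real N"
        have d: "d > 0" using n by (simp add: d_def)
        have n0: "real n > 0" using n \<alpha>0 N by (meson less_trans mult_pos_pos)
        define A where "A = {l\<in>{1..n}. real l \<le> \<gamma> * d}"
        define B where "B = {l\<in>{1..n}. \<not> real l \<le> \<gamma> * d}"
        have fin: "finite A" "finite B" by (auto simp: A_def B_def)
        define E where "E = d powr - s"
        have E: "E > 0" using d by (simp add: E_def)
        have "sum (\<lambda>l. u N l * h N (n - l)) A \<le> sum (\<lambda>l. u N l * (C * Z N * (E / y))) A"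
        proof (rule sum_mono)
          fix l assume l: "l \<in> A"
          then have l1: "1 \<le> l" "l \<le> n" "real l \<le> \<gamma> * d" by (auto simp: A_def)
          have "real (n - l) - \<alpha> * real N = d - real l" using l1 by (simp add: d_def of_nat_diff)
          moreover have gd: "g * d \<le> d - real l" using l1 by (simp add: \<gamma>_def algebra_simps)
          moreover have gd0: "0 < g * d" using g d by simp
          ultimately have "real (n - l) > \<alpha> * real N" by linarith
          then have "h N (n - l) \<le> C * Z N * (real (n - l) - \<alpha> * real N) powr - s"
            using less[of "n - l"] l1 by simp
          also have "(real (n - l) - \<alpha> * real N) powr - s \<le> (g * d) powr - s"
            using \<open>real (n - l) - \<alpha> * real N = d - real l\<close> gd gd0 s by (intro powr_mono2') auto
          also have "(g * d) powr - s = E / y"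
            using g d g_s by (simp add: powr_mult E_def)
          finally have "h N (n - l) \<le> C * Z N * (E / y)"
            using C Z_pos[of N] by simp
          then show "u N l * h N (n - l) \<le> u N l * (C * Z N * (E / y))"
            by (rule mult_left_mono[OF _ u_nonneg])
        qed
        also have "\<dots> = sum (u N) A * (C * Z N * (E / y))" by (rule sum_distrib_right[symmetric])
        also have "\<dots> \<le> (suminf t + real N * (1 - \<nu>)) * (C * Z N * (E / y))"
          using C Z_pos[of N] E y by (intro mult_right_mono sum_u_le fin) auto
        finally have sA: "sum (\<lambda>l. u N l * h N (n - l)) A \<le> (suminf t + real N * (1 - \<nu>)) * (C * Z N * (E / y))" .
        \<comment> \<open>For long jumps the tail bound on \<open>u\<close> takes the place of the
          induction hypothesis, since the values of \<open>h\<close> that remain have total mass at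
          most \<open>Z N\<close>.\<close>
        have "(\<Sum>l\<in>B. h N (n - l)) = sum (h N) ((\<lambda>l. n - l) ` B)"
          by (subst sum.reindex) (auto simp: inj_on_def B_def)
        also have "\<dots> \<le> Z N" by (rule sum_h_le) (use fin in auto)
        finally have hB: "(\<Sum>l\<in>B. h N (n - l)) \<le> Z N" .
        have "sum (\<lambda>l. u N l * h N (n - l)) B \<le> sum (\<lambda>l. real N * (C1 * (\<gamma> powr - s * E)) * h N (n - l)) B"
        proof (rule sum_mono)
          fix l assume l: "l \<in> B"
          then have l1: "1 \<le> l" "l \<le> n" "real l \<ge> \<gamma> * d" by (auto simp: B_def)
          have "u N l \<le> real N * (C1 * real l powr - s)" using C1(2) elim(2) l1 by blast
          also have "real l powr - s \<le> (\<gamma> * d) powr - s" using l1 \<gamma> d s by (intro powr_mono2') auto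
          also have "(\<gamma> * d) powr - s = \<gamma> powr - s * E" using \<gamma> d by (simp add: powr_mult E_def)
          finally have "u N l \<le> real N * (C1 * (\<gamma> powr - s * E))" using C1(1) N by simp
          then show "u N l * h N (n - l) \<le> real N * (C1 * (\<gamma> powr - s * E)) * h N (n - l)"
            by (rule mult_right_mono[OF _ h_nonneg])
        qed
        also have "\<dots> = real N * (C1 * (\<gamma> powr - s * E)) * (\<Sum>l\<in>B. h N (n - l))" by (rule sum_distrib_left[symmetric])
        also have "\<dots> \<le> real N * (C1 * (\<gamma> powr - s * E)) * Z N"
          using hB C1(1) N E by (intro mult_left_mono) auto
        finally have sB: "sum (\<lambda>l. u N l * h N (n - l)) B \<le> real N * (C1 * (\<gamma> powr - s * E)) * Z N" .
        have "real n * h N n = (\<Sum>l=1..n. u N l * h N (n - l))" using n0 by (intro h_rec) simp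
        also have "{1..n} = A \<union> B" by (auto simp: A_def B_def)
        also have "sum (\<lambda>l. u N l * h N (n - l)) (A \<union> B) = sum (\<lambda>l. u N l * h N (n - l)) A + sum (\<lambda>l. u N l * h N (n - l)) B"
          by (rule sum.union_disjoint) (use fin in \<open>auto simp: A_def B_def\<close>)
        also have "\<dots> \<le> (suminf t + real N * (1 - \<nu>)) * (C * Z N * (E / y)) + real N * (C1 * (\<gamma> powr - s * E)) * Z N"
          using sA sB by linarith
        also have "\<dots> = (\<alpha> * real N) * (((1 - \<nu> + suminf t / real N) / (\<alpha> * y)) * C + C1 * \<gamma> powr - s / \<alpha>) * (Z N * E)"
          using N \<alpha>0 y by (simp add: field_simps)
        also have "\<dots> \<le> (\<alpha> * real N) * (\<rho> * C + C1 * \<gamma> powr - s / \<alpha>) * (Z N * E)"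
          using elim(1) \<alpha>0 N C Z_pos[of N] E by (intro mult_right_mono mult_left_mono add_mono) auto
        also have "\<rho> * C + C1 * \<gamma> powr - s / \<alpha> = C"
        proof -
          have "C1 * \<gamma> powr - s / \<alpha> = (1 - \<rho>) * C" using \<rho> \<alpha>0 by (simp add: C_def)
          then show ?thesis by (simp add: algebra_simps)
        qed
        also have "(\<alpha> * real N) * C * (Z N * E) \<le> real n * C * (Z N * E)"
          using n C Z_pos[of N] E by (intro mult_right_mono) auto
        finally have "real n * h N n \<le> real n * (C * Z N * E)" by (simp add: mult_ac)
        then show "h N n \<le> C * Z N * (real n - \<alpha> * real N) powr - s"
          using n0 by (simp add: E_def d_def)
      qed
    qed
    then show ?case by blast
  qed
  then show ?thesis using C by blast
qed

text \<open>Instance \<open>\<alpha> = 1 - \<nu> / 2\<close> of the a priori bound, at distance at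
  least \<open>(\<nu> / 4) * N\<close> above \<open>\<alpha> * N\<close>. It is the uniform bound on
  \<open>X\<close> that starts the contraction.\<close>

lemma h_bound:
  "\<exists>C>0. eventually (\<lambda>N. \<forall>n. real n \<ge> (1 - \<nu> / 4) * real N \<longrightarrow> h N n * real N powr s / Z N \<le> C) sequentially"
proof -
  have "1 - \<nu> < 1 - \<nu> / 2" using \<nu> by simp
  from h_apriori[OF this] obtain C where C: "C > 0"
    "eventually (\<lambda>N. \<forall>n. real n > (1 - \<nu> / 2) * real N \<longrightarrow>
           h N n \<le> C * Z N * (real n - (1 - \<nu> / 2) * real N) powr - s) sequentially" by blast
  from C(2) eventually_ge_at_top[of 1]
  have "eventually (\<lambda>N. \<forall>n. real n \<ge> (1 - \<nu> / 4) * real N \<longrightarrow> h N n * real N powr s / Z N \<le> C * (\<nu> / 4) powr - s) sequentially"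
  proof eventually_elim
    case (elim N)
    show ?case
    proof (intro allI impI)
      fix n assume n: "real n \<ge> (1 - \<nu> / 4) * real N"
      have N: "real N > 0" using elim(2) by simp
      have \<nu>N: "\<nu> * real N > 0" using \<nu> N by simp
      have 1: "real n - (1 - \<nu> / 2) * real N \<ge> (\<nu> / 4) * real N" using n by (simp add: field_simps)
      moreover have "real n > (1 - \<nu> / 2) * real N" using 1 \<nu>N by simp
      ultimately have "h N n \<le> C * Z N * (real n - (1 - \<nu> / 2) * real N) powr - s" using elim(1) by blast
      also have "(real n - (1 - \<nu> / 2) * real N) powr - s \<le> ((\<nu> / 4) * real N) powr - s"
        using 1 \<nu>N s by (intro powr_mono2') auto
      also have "((\<nu> / 4) * real N) powr - s = (\<nu> / 4) powr - s * real N powr - s"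
        using \<nu> N by (intro powr_mult)
      finally have "h N n \<le> C * Z N * ((\<nu> / 4) powr - s * real N powr - s)"
        using C(1) Z_pos[of N] by simp
      then have "h N n * real N powr s \<le> C * Z N * ((\<nu> / 4) powr - s * real N powr - s) * real N powr s"
        by (rule mult_right_mono) simp
      also have "\<dots> = C * (\<nu> / 4) powr - s * Z N"
        using N by (simp add: powr_minus)
      finally show "h N n * real N powr s / Z N \<le> C * (\<nu> / 4) powr - s"
        using Z_pos[of N] by (simp add: pos_divide_le_eq)
    qed
  qed
  moreover have "C * (\<nu> / 4) powr - s > 0" using C \<nu> by simp
  ultimately show ?thesis by blast
qed

text \<open>If the remainder \<open>n\<close> lies in the bulk, the jump from \<open>N - d\<close>
  to it has length close to \<open>\<nu> * N\<close>, where the tail \<open>c * j powr - s\<close>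
  of \<open>p\<close> applies and \<open>t\<close> is negligible.\<close>

lemma bulk_jump:
  "((\<lambda>x. real (fst x - d - snd x) / real (fst x)) \<longlongrightarrow> \<nu>) bulk"
  "((\<lambda>x. real (fst x) powr s * (u (fst x) (fst x - d - snd x) / real (fst x))) \<longlongrightarrow> c * \<nu> powr - s) bulk"
proof -
  have N: "filterlim (\<lambda>x. real (fst x)) at_top bulk"
    by (rule filterlim_compose[OF filterlim_real_sequentially bulk_limits(1)])
  have inv: "((\<lambda>x. y / real (fst x)) \<longlongrightarrow> 0) bulk" for y
    by (rule tendsto_divide_0[OF tendsto_const filterlim_at_top_imp_at_infinity[OF N]])
  have lim1: "((\<lambda>x. 1 - real d / real (fst x) - real (snd x) / real (fst x)) \<longlongrightarrow> 1 - 0 - (1 - \<nu>)) bulk"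
    by (intro tendsto_intros inv bulk_limits)
  have evN: "eventually (\<lambda>x. fst x \<ge> 1) bulk"
    using bulk_limits(1) by (simp add: filterlim_at_top)
  have ev: "eventually (\<lambda>x. 1 - real d / real (fst x) - real (snd x) / real (fst x) > \<nu> / 2) bulk"
    using lim1 \<nu> by (intro order_tendstoD) auto
  \<comment> \<open>Truncated and real subtraction agree here because the limit \<open>\<nu>\<close>
    is positive.\<close>
  have ev2: "eventually (\<lambda>x. 1 - real d / real (fst x) - real (snd x) / real (fst x) = real (fst x - d - snd x) / real (fst x)) bulk"
    using ev evN
  proof eventually_elim
    case (elim x)
    then have p: "real (fst x) > 0" by simp
    have "1 - real d / real (fst x) - real (snd x) / real (fst x) = (real (fst x) - real d - real (snd x)) / real (fst x)"
      using p by (simp add: field_simps)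
    moreover have "0 < (real (fst x) - real d - real (snd x)) / real (fst x)"
      using elim(1) \<nu> calculation by linarith
    then have "real (fst x) - real d - real (snd x) > 0" using p by (simp add: zero_less_divide_iff)
    then have "real (fst x - d - snd x) = real (fst x) - real d - real (snd x)" by linarith
    ultimately show ?case by simp
  qed
  show l1: "((\<lambda>x. real (fst x - d - snd x) / real (fst x)) \<longlongrightarrow> \<nu>) bulk"
    using Lim_transform_eventually[OF lim1 ev2] by simp
  have evj: "eventually (\<lambda>x. real (fst x - d - snd x) / real (fst x) > 0) bulk"
    using l1 \<nu> by (intro order_tendstoD) auto
  have "filterlim (\<lambda>x. real (fst x - d - snd x) / real (fst x) * real (fst x)) at_top bulk"
    by (rule filterlim_tendsto_pos_mult_at_top[OF l1 \<nu>(1) N])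
  then have "filterlim (\<lambda>x. real (fst x - d - snd x)) at_top bulk"
    by (rule filterlim_mono_eventually[OF _ order_refl order_refl])
       (use evN in \<open>auto elim!: eventually_mono\<close>)
  then have j: "filterlim (\<lambda>x. fst x - d - snd x) at_top bulk"
    by (simp add: filterlim_sequentially_iff_filterlim_real)
  have "((\<lambda>x. (p (fst x - d - snd x) * real (fst x - d - snd x) powr s
       + t (fst x - d - snd x) * real (fst x - d - snd x) powr s * (1 / real (fst x)))
       * (real (fst x - d - snd x) / real (fst x)) powr - s) \<longlongrightarrow> (c + 0 * 0) * \<nu> powr - s) bulk"
    by (intro tendsto_intros inv l1 filterlim_compose[OF p_tail j] filterlim_compose[OF t_tail j])
       (use \<nu> in auto)
  moreover have "eventually (\<lambda>x. (p (fst x - d - snd x) * real (fst x - d - snd x) powr s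
       + t (fst x - d - snd x) * real (fst x - d - snd x) powr s * (1 / real (fst x)))
       * (real (fst x - d - snd x) / real (fst x)) powr - s =
       real (fst x) powr s * (u (fst x) (fst x - d - snd x) / real (fst x))) bulk"
    using evj evN
  proof eventually_elim
    case (elim x)
    define k where "k = fst x - d - snd x"
    define N where "N = fst x"
    have "real N > 0" using elim by (simp add: N_def)
    moreover have "real k > 0" using elim by (simp add: k_def N_def zero_less_divide_iff)
    ultimately have "(p k * real k powr s + t k * real k powr s * (1 / real N)) * (real k / real N) powr - s
      = real N powr s * (u N k / real N)"
      by (simp add: powr_divide powr_minus u_def field_simps)
    then show ?case by (simp add: k_def N_def)
  qed
  ultimately show "((\<lambda>x. real (fst x) powr s * (u (fst x) (fst x - d - snd x) / real (fst x))) \<longlongrightarrow> c * \<nu> powr - s) bulk"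
    by (simp add: Lim_transform_eventually)
qed

text \<open>Indexed by the remainder \<open>n = N - d - j\<close>, the sum is an average over the
  compound Poisson law, evaluated by \<open>bulk_average\<close>. \<open>Q_big\<close> keeps the
  integrand bounded and \<open>Q_near\<close> makes it the full jump weight in the bulk, so the
  limit does not depend on the cutoff \<open>Q\<close>.\<close>

lemma jump_sum:
  assumes \<delta>: "\<delta> > 0" and Q_big: "\<And>N j. Q N j \<Longrightarrow> \<delta> * real N \<le> real j"
    and \<epsilon>: "\<epsilon> > 0" and Q_near: "\<And>N j. \<bar>real j - \<nu> * real N\<bar> \<le> \<epsilon> * real N \<Longrightarrow> Q N j"
  shows "(\<lambda>N. real N powr s / Z N * (\<Sum>j\<in>{j\<in>{1..N - d}. Q N j}. u N j / real N * h N (N - d - j)))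
    \<longlonglongrightarrow> c * \<nu> powr - s"
proof -
  obtain C1 where C1: "C1 > 0" "\<And>N j. N \<ge> 1 \<Longrightarrow> j \<ge> 1 \<Longrightarrow> u N j \<le> real N * (C1 * real j powr - s)"
    using u_le_tail by blast
  define \<phi> where "\<phi> N n = (if n + d < N \<and> Q N (N - d - n) then real N powr s * (u N (N - d - n) / real N) else 0)" for N n
  have "(\<lambda>N. \<Sum>n. h N n / Z N * \<phi> N n) \<longlonglongrightarrow> c * \<nu> powr - s"
  proof (rule bulk_average[of 1 _ "C1 * \<delta> powr - s"])
    fix N n :: nat assume N: "N \<ge> 1"
    show "\<bar>\<phi> N n\<bar> \<le> C1 * \<delta> powr - s"
    proof (cases "n + d < N \<and> Q N (N - d - n)")
      case True
      define j where "j = N - d - n"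
      have j: "j \<ge> 1" "\<delta> * real N \<le> real j" using True Q_big[of N j] by (auto simp: j_def)
      have "u N j \<le> real N * (C1 * real j powr - s)" using C1(2)[OF N j(1)] .
      also have "real j powr - s \<le> (\<delta> * real N) powr - s" using j \<delta> N s by (intro powr_mono2') auto
      also have "(\<delta> * real N) powr - s = \<delta> powr - s * real N powr - s" using \<delta> N by (intro powr_mult)
      finally have "u N j \<le> real N * (C1 * (\<delta> powr - s * real N powr - s))" using C1(1) N by (simp add: mult_left_mono)
      then have "u N j / real N \<le> C1 * (\<delta> powr - s * real N powr - s)"
        using N by (simp add: divide_le_eq mult.commute)
      then have "real N powr s * (u N j / real N) \<le> real N powr s * (C1 * (\<delta> powr - s * real N powr - s))"
        by (rule mult_left_mono) simp
      also have "\<dots> = C1 * \<delta> powr - s"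
        using N by (simp add: powr_minus)
      finally have "real N powr s * (u N j / real N) \<le> C1 * \<delta> powr - s" .
      moreover have "0 \<le> real N powr s * (u N j / real N)" using u_nonneg[of N j] by simp
      ultimately show ?thesis using True by (simp add: \<phi>_def j_def)
    qed (use C1 in \<open>auto simp: \<phi>_def\<close>)
  next
    have "eventually (\<lambda>x. \<bar>real (fst x - d - snd x) / real (fst x) - \<nu>\<bar> < min \<epsilon> \<nu>) bulk"
      using tendstoD[OF bulk_jump(1)[of d], of "min \<epsilon> \<nu>"] \<epsilon> \<nu> by (simp add: dist_real_def)
    moreover have "eventually (\<lambda>x. fst x \<ge> 1) bulk"
      using bulk_limits(1) by (simp add: filterlim_at_top)
    ultimately have "eventually (\<lambda>x. real (fst x) powr s * (u (fst x) (fst x - d - snd x) / real (fst x)) = \<phi> (fst x) (snd x)) bulk"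
    proof eventually_elim
      case (elim x)
      define N j where "N = fst x" and "j = fst x - d - snd x"
      have N: "real N > 0" using elim by (simp add: N_def)
      have a: "\<bar>real j / real N - \<nu>\<bar> < min \<epsilon> \<nu>" using elim by (simp add: N_def j_def)
      have "real j - \<nu> * real N = (real j / real N - \<nu>) * real N"
        using N by (simp add: left_diff_distrib)
      then have "\<bar>real j - \<nu> * real N\<bar> = \<bar>real j / real N - \<nu>\<bar> * real N"
        by (simp add: abs_mult)
      also have "\<dots> \<le> \<epsilon> * real N" using a N by (intro mult_right_mono) auto
      finally have "Q N j" by (rule Q_near)
      moreover have "real j / real N > 0" using a by linarith
      then have "j > 0" using N by (simp add: zero_less_divide_iff)
      then have "snd x + d < N" by (auto simp: j_def N_def)
      ultimately show ?case by (simp add: \<phi>_def N_def j_def)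
    qed
    then show "((\<lambda>x. \<phi> (fst x) (snd x)) \<longlongrightarrow> c * \<nu> powr - s) bulk"
      by (rule Lim_transform_eventually[OF bulk_jump(2)])
  qed
  moreover have "(\<Sum>n. h N n / Z N * \<phi> N n) = real N powr s / Z N * (\<Sum>j\<in>{j\<in>{1..N - d}. Q N j}. u N j / real N * h N (N - d - j))" for N
  proof -
    have "(\<Sum>n. h N n / Z N * \<phi> N n) = (\<Sum>n\<in>{n. n + d < N \<and> Q N (N - d - n)}. h N n / Z N * \<phi> N n)"
      by (rule suminf_finite) (auto simp: \<phi>_def intro: finite_subset[of _ "{..N}"])
    also have "\<dots> = (\<Sum>j\<in>{j\<in>{1..N - d}. Q N j}. real N powr s / Z N * (u N j / real N * h N (N - d - j)))"
      by (rule sum.reindex_bij_witness[where i = "\<lambda>j. N - d - j" and j = "\<lambda>n. N - d - n"])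
         (auto simp: \<phi>_def)
    also have "\<dots> = real N powr s / Z N * (\<Sum>j\<in>{j\<in>{1..N - d}. Q N j}. u N j / real N * h N (N - d - j))"
      by (rule sum_distrib_left[symmetric])
    finally show ?thesis .
  qed
  ultimately show ?thesis by simp
qed

text \<open>The power of \<open>N\<close> is dictated by a single jump \<open>j\<close> of order
  \<open>N\<close>, whose rate \<open>u N j / real j\<close> is of order
  \<open>N powr - s\<close>.\<close>

definition X :: "nat \<Rightarrow> nat \<Rightarrow> real" where "X d N = h N (N - d) * real N powr s / Z N"

lemma X_nonneg: "X d N \<ge> 0"
  unfolding X_def using h_nonneg[of N "N - d"] Z_pos[of N] by simp

lemma u_over_limit: "(\<lambda>N. u N j / real (N - d)) \<longlonglongrightarrow> p j"
proof -
  have "(\<lambda>N. t j / (real N - real d) + p j * (real N / (real N - real d))) \<longlonglongrightarrow> 0 + p j * 1"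
    by (intro tendsto_intros) real_asymp+
  moreover have "eventually (\<lambda>N. t j / (real N - real d) + p j * (real N / (real N - real d)) = u N j / real (N - d)) sequentially"
    using eventually_ge_at_top[of d]
    by eventually_elim (simp add: u_def add_divide_distrib of_nat_diff mult.commute)
  ultimately show ?thesis by (simp add: Lim_transform_eventually)
qed

text \<open>Short jumps lead to \<open>X (d + j)\<close> with limiting weights \<open>p j\<close> of
  total mass \<open>1 - \<nu>\<close>, and long jumps contribute \<open>c * \<nu> powr - s\<close>.
  The limit is the fixed point of the resulting recursion.\<close>

lemma X_limit: "X d \<longlonglongrightarrow> c * \<nu> powr - s / \<nu>"
proof -
  \<comment> \<open>With \<open>d \<le> \<delta> * N\<close> eventually and short jumps
    \<open>j < \<delta> * N\<close>, the argument \<open>N - d - j\<close> stays above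
    \<open>(1 - \<nu> / 4) * N\<close>, the range of \<open>h_bound\<close>.\<close>
  define \<delta> where "\<delta> = \<nu> / 8"
  have \<delta>: "\<delta> > 0" using \<nu> by (simp add: \<delta>_def)
  obtain K where K: "K > 0" "eventually (\<lambda>N. \<forall>n. real n \<ge> (1 - \<nu> / 4) * real N \<longrightarrow> h N n * real N powr s / Z N \<le> K) sequentially"
    using h_bound by blast
  define a where "a d N j = (if 1 \<le> j \<and> j \<le> N - d \<and> \<not> \<delta> * real N \<le> real j then u N j / real (N - d) else 0)" for d N j :: nat
  define W where "W d N = real N / real (N - d) * (real N powr s / Z N *
      (\<Sum>j\<in>{j\<in>{1..N - d}. \<delta> * real N \<le> real j}. u N j / real N * h N (N - d - j)))" for d N
  show ?thesis
  \<comment> \<open>The factor \<open>2\<close> in \<open>M\<close> comes from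
    \<open>N - d \<ge> N / 2\<close> for large \<open>N\<close>.\<close>
  proof (rule contraction_limit[where p = p and a = a and W = W and K = K and M = "\<lambda>j. 2 * t j + 2 * p j"])
    fix d
    show "eventually (\<lambda>N. X d N = (\<Sum>j. a d N j * X (d + j) N) + W d N) sequentially"
      using eventually_gt_at_top[of d]
    proof eventually_elim
      case (elim N)
      define A where "A = {j\<in>{1..N - d}. \<not> \<delta> * real N \<le> real j}"
      define B where "B = {j\<in>{1..N - d}. \<delta> * real N \<le> real j}"
      have "real (N - d) * h N (N - d) = (\<Sum>j=1..N-d. u N j * h N (N - d - j))"
        using elim by (intro h_rec) simp
      also have "{1..N-d} = A \<union> B" by (auto simp: A_def B_def)
      also have "(\<Sum>j\<in>A \<union> B. u N j * h N (N - d - j)) = (\<Sum>j\<in>A. u N j * h N (N - d - j)) + (\<Sum>j\<in>B. u N j * h N (N - d - j))"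
        by (rule sum.union_disjoint) (auto simp: A_def B_def)
      finally have h: "h N (N - d) = (\<Sum>j\<in>A. u N j * h N (N - d - j)) / real (N - d) + (\<Sum>j\<in>B. u N j * h N (N - d - j)) / real (N - d)"
        using elim by (simp add: eq_divide_eq add_divide_distrib[symmetric] mult.commute)
      have "(\<Sum>j. a d N j * X (d + j) N) = (\<Sum>j\<in>A. a d N j * X (d + j) N)"
        by (rule suminf_finite) (auto simp: A_def a_def)
      also have "\<dots> = (\<Sum>j\<in>A. u N j * h N (N - d - j) * (real N powr s / Z N / real (N - d)))"
        by (rule sum.cong[OF refl]) (auto simp: A_def a_def X_def mult_ac)
      also have "\<dots> = (\<Sum>j\<in>A. u N j * h N (N - d - j)) / real (N - d) * (real N powr s / Z N)"
        unfolding sum_distrib_right[symmetric] by simp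
      finally have 1: "(\<Sum>j. a d N j * X (d + j) N) = (\<Sum>j\<in>A. u N j * h N (N - d - j)) / real (N - d) * (real N powr s / Z N)" .
      have "(\<Sum>j\<in>B. u N j / real N * h N (N - d - j)) = (\<Sum>j\<in>B. u N j * h N (N - d - j)) / real N"
        unfolding sum_divide_distrib by simp
      then have "W d N = (\<Sum>j\<in>B. u N j * h N (N - d - j)) / real (N - d) * (real N powr s / Z N)"
        using elim unfolding W_def B_def[symmetric] by simp
      moreover have "X d N = ((\<Sum>j\<in>A. u N j * h N (N - d - j)) / real (N - d) + (\<Sum>j\<in>B. u N j * h N (N - d - j)) / real (N - d))
          * (real N powr s / Z N)"
        by (simp only: X_def h times_divide_eq_right)
      ultimately show ?case unfolding 1 by (simp only: distrib_right)
    qed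
    show "finite {j. a d N j \<noteq> 0}" for N
      by (rule finite_subset[of _ "{..N - d}"]) (auto simp: a_def)
    show "(\<lambda>N. a d N j) \<longlonglongrightarrow> p j" for j
    proof (cases "j = 0")
      case True
      then show ?thesis by (simp add: a_def p_0)
    next
      case False
      have "filterlim (\<lambda>N. \<delta> * real N) at_top sequentially"
        using \<delta> by real_asymp
      then have "eventually (\<lambda>N. \<delta> * real N > real j) sequentially" by (simp add: filterlim_at_top_dense)
      then have "eventually (\<lambda>N. u N j / real (N - d) = a d N j) sequentially"
        using eventually_gt_at_top[of "d + j"] by eventually_elim (use False in \<open>simp add: a_def\<close>)
      then show ?thesis by (rule Lim_transform_eventually[OF u_over_limit])
    qed
    show "a d N j \<ge> 0" for N j
      by (simp add: a_def u_nonneg)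
    show "eventually (\<lambda>N. \<forall>j. a d N j \<le> 2 * t j + 2 * p j) sequentially"
      using eventually_ge_at_top[of "2 * d + 2"]
    proof eventually_elim
      case (elim N)
      show ?case
      proof
        fix j
        define r where "r = real (N - d)"
        have r: "r \<ge> real N / 2" "r \<ge> 1" unfolding r_def using elim by linarith+
        have "t j * 1 \<le> t j * (2 * r)" using r t_nonneg[of j] by (intro mult_left_mono) auto
        moreover have "p j * real N \<le> p j * (2 * r)" using r p_nonneg[of j] by (intro mult_left_mono) auto
        ultimately have "u N j \<le> (2 * t j + 2 * p j) * r"
          by (simp add: u_def algebra_simps)
        then have "u N j / real (N - d) \<le> 2 * t j + 2 * p j"
          using r by (simp add: divide_le_eq flip: r_def)
        then show "a d N j \<le> 2 * t j + 2 * p j" using t_nonneg[of j] p_nonneg[of j] by (simp add: a_def)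
      qed
    qed
    have dN: "eventually (\<lambda>N. real d \<le> \<delta> * real N) sequentially"
    proof -
      have "filterlim (\<lambda>N. \<delta> * real N) at_top sequentially"
        using \<delta> by real_asymp
      then show ?thesis by (simp add: filterlim_at_top)
    qed
    show "eventually (\<lambda>N. \<forall>j. a d N j \<noteq> 0 \<longrightarrow> \<bar>X (d + j) N\<bar> \<le> K) sequentially"
      using dN K(2)
    proof eventually_elim
      case (elim N)
      show ?case
      proof (intro allI impI)
        fix j assume "a d N j \<noteq> 0"
        then have j: "1 \<le> j" "j \<le> N - d" "real j < \<delta> * real N" by (auto simp: a_def split: if_splits)
        then have "real (N - (d + j)) = real N - real d - real j" by linarith
        then have "real (N - (d + j)) \<ge> (1 - \<nu> / 4) * real N"
          using j elim(1) by (simp add: \<delta>_def algebra_simps)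
        then show "\<bar>X (d + j) N\<bar> \<le> K"
          using elim(2) X_nonneg[of "d + j" N] unfolding abs_of_nonneg[OF X_nonneg] by (simp add: X_def)
      qed
    qed
    show "eventually (\<lambda>N. \<bar>X d N\<bar> \<le> K) sequentially"
      using dN K(2)
    proof eventually_elim
      case (elim N)
      have "0 \<le> \<nu> * real N" using \<nu> by simp
      then have "real (N - d) \<ge> (1 - \<nu> / 4) * real N"
        using elim(1) by (simp add: \<delta>_def algebra_simps)
      then show "\<bar>X d N\<bar> \<le> K"
        using elim(2) unfolding abs_of_nonneg[OF X_nonneg] by (simp add: X_def)
    qed
    show "W d \<longlonglongrightarrow> c * \<nu> powr - s"
    proof -
      have near: "\<delta> * real N \<le> real j" if "\<bar>real j - \<nu> * real N\<bar> \<le> \<nu> / 2 * real N" for N j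
      proof -
        have "real j \<ge> \<nu> * real N - \<nu> / 2 * real N" using that by linarith
        moreover have "0 \<le> \<nu> * real N" using \<nu> by simp
        ultimately show ?thesis unfolding \<delta>_def by linarith
      qed
      have "(\<lambda>N. real N / (real N - real d)) \<longlonglongrightarrow> 1" by real_asymp
      moreover have "eventually (\<lambda>N. real N / (real N - real d) = real N / real (N - d)) sequentially"
        using eventually_ge_at_top[of d] by eventually_elim (simp add: of_nat_diff)
      ultimately have "(\<lambda>N. real N / real (N - d)) \<longlonglongrightarrow> 1" by (rule Lim_transform_eventually)
      from tendsto_mult[OF this jump_sum[OF \<delta>, of "\<lambda>N j. \<delta> * real N \<le> real j" "\<nu> / 2" d]]
      show ?thesis unfolding W_def using near \<nu> by simp
    qed
  qed (use p_sums \<nu> t_summable p_summable in \<open>auto intro!: summable_add summable_mult\<close>)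
qed

lemma X_limit_pos: "c * \<nu> powr - s / \<nu> > 0"
  using c \<nu> by simp

lemma h_pos: "eventually (\<lambda>N. h N N > 0) sequentially"
proof -
  have "eventually (\<lambda>N. X 0 N > 0) sequentially"
    using X_limit X_limit_pos by (rule order_tendstoD)
  then show ?thesis
  proof eventually_elim
    case (elim N)
    then show ?case using h_nonneg[of N N] by (cases "h N N = 0") (auto simp: X_def)
  qed
qed

text \<open>The limit of \<open>X d\<close> does not depend on \<open>d\<close>, and the
  normalisation cancels.\<close>

lemma h_ratio: "(\<lambda>N. h N (N - d) / h N N) \<longlonglongrightarrow> 1"
proof -
  have "(\<lambda>N. X d N / X 0 N) \<longlonglongrightarrow> (c * \<nu> powr - s / \<nu>) / (c * \<nu> powr - s / \<nu>)"
    by (intro tendsto_divide X_limit) (use X_limit_pos in linarith)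
  moreover have "eventually (\<lambda>N. X d N / X 0 N = h N (N - d) / h N N) sequentially"
    using eventually_gt_at_top[of 0]
  proof eventually_elim
    case (elim N)
    then have "real N powr s / Z N \<noteq> 0" using Z_pos[of N] by simp
    moreover have "X d N = h N (N - d) * (real N powr s / Z N)" "X 0 N = h N N * (real N powr s / Z N)"
      by (simp_all add: X_def)
    ultimately show ?case by (simp only: nonzero_mult_divide_mult_cancel_right not_False_eq_True)
  qed
  ultimately show ?thesis using c \<nu> by (simp add: Lim_transform_eventually)
qed

section \<open>Limits for patterns of short and giant cycles\<close>

definition cc :: "nat \<Rightarrow> nat \<Rightarrow> nat set list \<Rightarrow> real" where
  "cc N n Js = cycle_coeff (u N) n Js"

lemma cc_nonneg: "cc N n Js \<ge> 0"
  unfolding cc_def by (rule cycle_coeff_nonneg) (rule u_nonneg)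

lemma cc_Nil: "cc N n [] = h N n"
  by (simp add: cc_def h_def)

lemma cc_Cons: "cc N n (J # Js) = (\<Sum>l\<in>{1..n} \<inter> J. u N l / real n * cc N (n - l) Js)"
  by (simp add: cc_def sum_divide_distrib)

text \<open>Induction over all \<open>d\<close> at once: a first cycle of length \<open>l\<close>
  turns \<open>N - d\<close> into \<open>N - (d + l)\<close> at the limiting price
  \<open>p l\<close>, while the weights keep the same \<open>N\<close>. Truncation at
  \<open>K\<close> allows termwise limits.\<close>

lemma short_cycles:
  "(\<lambda>N. cc N (N - d) (replicate m {1..K}) / h N N) \<longlonglongrightarrow> (\<Sum>l=1..K. p l) ^ m"
proof (induction m arbitrary: d)
  case 0
  then show ?case using h_ratio by (simp add: cc_Nil)
next
  case (Suc m)
  have "(\<lambda>N. \<Sum>l=1..K. u N l / real (N - d) * (cc N (N - (d + l)) (replicate m {1..K}) / h N N))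
      \<longlonglongrightarrow> (\<Sum>l=1..K. p l * (\<Sum>l=1..K. p l) ^ m)"
    by (intro tendsto_sum tendsto_mult u_over_limit Suc.IH)
  moreover have "eventually (\<lambda>N. (\<Sum>l=1..K. u N l / real (N - d) * (cc N (N - (d + l)) (replicate m {1..K}) / h N N))
      = cc N (N - d) (replicate (Suc m) {1..K}) / h N N) sequentially"
    using eventually_ge_at_top[of "d + K"]
  proof eventually_elim
    case (elim N)
    then have e: "{1..N - d} \<inter> {1..K} = {1..K}" by auto
    show ?case
      unfolding replicate_Suc cc_Cons sum_divide_distrib e by simp
  qed
  ultimately show ?case by (simp add: Lim_transform_eventually sum_distrib_right)
qed

definition win :: "real \<Rightarrow> nat \<Rightarrow> nat set" where
  "win \<epsilon> N = {l. \<bar>real l - \<nu> * real N\<bar> \<le> \<epsilon> * real N}"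

text \<open>The window around \<open>\<nu> * N\<close> carries the whole long-jump contribution
  \<open>c * \<nu> powr - s\<close>; division by the limit of \<open>X 0\<close> leaves the mass
  \<open>\<nu>\<close>.\<close>

lemma giant_cycle:
  assumes \<epsilon>: "0 < \<epsilon>" "\<epsilon> < \<nu>"
  shows "(\<lambda>N. \<Sum>l\<in>{1..N - d} \<inter> win \<epsilon> N. u N l / real N * (h N (N - d - l) / h N N)) \<longlonglongrightarrow> \<nu>"
proof -
  have "(\<lambda>N. real N powr s / Z N * (\<Sum>l\<in>{l\<in>{1..N - d}. l \<in> win \<epsilon> N}. u N l / real N * h N (N - d - l)))
      \<longlonglongrightarrow> c * \<nu> powr - s"
  proof (rule jump_sum[of "\<nu> - \<epsilon>" _ \<epsilon>])
    fix N j :: nat assume "j \<in> win \<epsilon> N"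
    then have "\<nu> * real N - \<epsilon> * real N \<le> real j" by (auto simp: win_def)
    then show "(\<nu> - \<epsilon>) * real N \<le> real j" by (simp add: left_diff_distrib)
  qed (use \<epsilon> in \<open>auto simp: win_def\<close>)
  then have "(\<lambda>N. real N powr s / Z N * (\<Sum>l\<in>{l\<in>{1..N - d}. l \<in> win \<epsilon> N}. u N l / real N * h N (N - d - l)) / X 0 N)
      \<longlonglongrightarrow> c * \<nu> powr - s / (c * \<nu> powr - s / \<nu>)"
    by (intro tendsto_divide X_limit) (use X_limit_pos in linarith)+
  also have "c * \<nu> powr - s / (c * \<nu> powr - s / \<nu>) = \<nu>" using c \<nu> by simp
  finally have "(\<lambda>N. real N powr s / Z N * (\<Sum>l\<in>{l\<in>{1..N - d}. l \<in> win \<epsilon> N}. u N l / real N * h N (N - d - l)) / X 0 N)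
      \<longlonglongrightarrow> \<nu>" .
  moreover have "eventually (\<lambda>N. real N powr s / Z N * (\<Sum>l\<in>{l\<in>{1..N - d}. l \<in> win \<epsilon> N}. u N l / real N * h N (N - d - l)) / X 0 N
      = (\<Sum>l\<in>{1..N - d} \<inter> win \<epsilon> N. u N l / real N * (h N (N - d - l) / h N N))) sequentially"
    using eventually_gt_at_top[of 0]
  proof eventually_elim
    case (elim N)
    let ?q = "real N powr s / Z N" and ?S = "\<Sum>l\<in>{1..N - d} \<inter> win \<epsilon> N. u N l / real N * h N (N - d - l)"
    have "?q \<noteq> 0" using Z_pos[of N] elim by simp
    moreover have "X 0 N = ?q * h N N" by (simp add: X_def)
    ultimately have "?q * ?S / X 0 N = ?S / h N N" by (simp only: nonzero_mult_divide_mult_cancel_left not_False_eq_True)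
    also have "\<dots> = (\<Sum>l\<in>{1..N - d} \<inter> win \<epsilon> N. u N l / real N * (h N (N - d - l) / h N N))"
      by (simp add: sum_divide_distrib)
    finally show ?case by (simp add: Int_def)
  qed
  ultimately show ?thesis by (rule Lim_transform_eventually)
qed

text \<open>After a cycle from the window at most \<open>(1 - \<nu> + \<epsilon>) * N\<close> points
  remain, so a further short cycle \<open>k\<close> has weight at least
  \<open>p k / (1 - \<nu> + \<epsilon>)\<close>. The convergent minorant \<open>g\<close> stands in
  for a statement on lower limits.\<close>

lemma giant_then_short:
  assumes \<epsilon>: "0 < \<epsilon>" "\<epsilon> < \<nu>" "\<epsilon> < 1 - \<nu>"
  shows "\<exists>g. g \<longlonglongrightarrow> \<nu> * ((\<Sum>l=1..K. p l) / (1 - \<nu> + \<epsilon>)) ^ r \<and>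
    eventually (\<lambda>N. g N \<le> (\<Sum>l\<in>{1..N - d} \<inter> win \<epsilon> N.
       u N l / real N * (cc N (N - d - l) (replicate r {1..K}) / h N N))) sequentially"
proof (induction r arbitrary: d)
  case 0
  show ?case
    by (intro exI[of _ "\<lambda>N. \<Sum>l\<in>{1..N - d} \<inter> win \<epsilon> N. u N l / real N * (h N (N - d - l) / h N N)"])
       (use giant_cycle[OF \<epsilon>(1,2), of d] in \<open>simp add: cc_Nil\<close>)
next
  case (Suc r)
  define b where "b = 1 - \<nu> + \<epsilon>"
  have b: "b > 0" using \<epsilon> \<nu> by (simp add: b_def)
  let ?V = "\<lambda>d r N. \<Sum>l\<in>{1..N - d} \<inter> win \<epsilon> N. u N l / real N * (cc N (N - d - l) (replicate r {1..K}) / h N N)"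
  have "\<exists>g. \<forall>d. g d \<longlonglongrightarrow> \<nu> * ((\<Sum>l=1..K. p l) / b) ^ r \<and> eventually (\<lambda>N. g d N \<le> ?V d r N) sequentially"
    unfolding b_def by (rule choice, rule allI, rule Suc)
  then obtain g where g: "\<And>d. g d \<longlonglongrightarrow> \<nu> * ((\<Sum>l=1..K. p l) / b) ^ r"
    "\<And>d. eventually (\<lambda>N. g d N \<le> ?V d r N) sequentially"
    by blast
  define G where "G N = (\<Sum>k=1..K. p k / b * g (d + k) N)" for N
  have "G \<longlonglongrightarrow> (\<Sum>k=1..K. p k / b * (\<nu> * ((\<Sum>l=1..K. p l) / b) ^ r))"
    unfolding G_def by (intro tendsto_intros g)
  also have "(\<Sum>k=1..K. p k / b * (\<nu> * ((\<Sum>l=1..K. p l) / b) ^ r)) = \<nu> * ((\<Sum>l=1..K. p l) / b) ^ Suc r"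
    by (simp add: sum_distrib_right[symmetric] sum_divide_distrib[symmetric])
  finally have lim: "G \<longlonglongrightarrow> \<nu> * ((\<Sum>l=1..K. p l) / b) ^ Suc r" .
  have "filterlim (\<lambda>N. (1 - \<nu> - \<epsilon>) * real N) at_top sequentially"
    using \<epsilon> by real_asymp
  then have "eventually (\<lambda>N. (1 - \<nu> - \<epsilon>) * real N \<ge> real d + real K + 1) sequentially"
    by (simp add: filterlim_at_top)
  moreover have "eventually (\<lambda>N. \<forall>k\<in>{1..K}. g (d + k) N \<le> ?V (d + k) r N) sequentially"
    by (rule eventually_ball_finite) (use g(2) in auto)
  ultimately have "eventually (\<lambda>N. G N \<le> ?V d (Suc r) N) sequentially"
    using eventually_gt_at_top[of 0]
  proof eventually_elim
    case (elim N)
    have N: "real N > 0" using elim by simp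
    have hN: "h N N \<ge> 0" by (rule h_nonneg)
    let ?cc = "\<lambda>n. cc N n (replicate r {1..K}) / h N N"
    have cc0: "?cc n \<ge> 0" for n using cc_nonneg hN by simp
    have "G N \<le> (\<Sum>k=1..K. p k / b * ?V (d + k) r N)"
      unfolding G_def using elim(2) b p_nonneg by (intro sum_mono mult_left_mono) auto
    also have "\<dots> \<le> (\<Sum>k=1..K. p k / b * (\<Sum>l\<in>{1..N - d} \<inter> win \<epsilon> N. u N l / real N * ?cc (N - d - l - k)))"
    proof (intro sum_mono mult_left_mono)
      fix k
      \<comment> \<open>A short cycle after the giant one is traded for one removed before it:
        \<open>N - (d + k) - l\<close> equals \<open>N - d - l - k\<close>, so the induction
        hypothesis at \<open>d + k\<close> applies.\<close>
      have "?V (d + k) r N = (\<Sum>l\<in>{1..N - (d + k)} \<inter> win \<epsilon> N. u N l / real N * ?cc (N - d - l - k))"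
        by (intro sum.cong refl) (simp add: diff_diff_add add_ac)
      also have "\<dots> \<le> (\<Sum>l\<in>{1..N - d} \<inter> win \<epsilon> N. u N l / real N * ?cc (N - d - l - k))"
      proof (rule sum_mono2)
        show "0 \<le> u N l / real N * ?cc (N - d - l - k)" for l
          by (intro mult_nonneg_nonneg cc0) (simp add: u_nonneg)
      qed auto
      finally show "?V (d + k) r N \<le> (\<Sum>l\<in>{1..N - d} \<inter> win \<epsilon> N. u N l / real N * ?cc (N - d - l - k))" .
    qed (use b p_nonneg in auto)
    also have "\<dots> = (\<Sum>l\<in>{1..N - d} \<inter> win \<epsilon> N. u N l / real N * (\<Sum>k=1..K. p k / b * ?cc (N - d - l - k)))"
      unfolding sum_distrib_left by (subst sum.swap) (simp add: mult_ac)
    also have "\<dots> \<le> ?V d (Suc r) N"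
    proof (intro sum_mono mult_left_mono)
      fix l assume l: "l \<in> {1..N - d} \<inter> win \<epsilon> N"
      define n where "n = N - d - l"
      have l1: "real l \<le> \<nu> * real N + \<epsilon> * real N" "real l \<ge> \<nu> * real N - \<epsilon> * real N"
        using l by (auto simp: win_def)
      have n_eq: "real n = real N - real d - real l" using l by (auto simp: n_def)
      have "real n \<ge> (1 - \<nu> - \<epsilon>) * real N - real d" using n_eq l1 by (simp add: algebra_simps)
      then have "real n \<ge> real K + 1" using elim(1) by linarith
      then have nK: "n \<ge> K" "n > 0" by auto
      have nb: "real n \<le> b * real N" using n_eq l1 by (simp add: b_def algebra_simps)
      have "(\<Sum>k=1..K. p k / b * ?cc (n - k)) \<le> (\<Sum>k=1..K. u N k / real n * ?cc (n - k))"
      proof (intro sum_mono mult_right_mono cc0)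
        fix k
        have "p k * real n \<le> p k * (b * real N)" using nb p_nonneg by (rule mult_left_mono)
        also have "\<dots> \<le> b * u N k" using b t_nonneg[of k] by (simp add: u_def algebra_simps)
        finally show "p k / b \<le> u N k / real n"
          using b nK by (simp add: divide_le_eq mult.commute pos_le_divide_eq)
      qed
      also have "\<dots> = cc N n (replicate (Suc r) {1..K}) / h N N"
      proof -
        have e: "{1..n} \<inter> {1..K} = {1..K}" using nK by auto
        show ?thesis unfolding replicate_Suc cc_Cons sum_divide_distrib e by simp
      qed
      finally show "(\<Sum>k=1..K. p k / b * ?cc (N - d - l - k)) \<le> cc N (N - d - l) (replicate (Suc r) {1..K}) / h N N"
        by (simp only: n_def)
    qed (use u_nonneg in auto)
    finally show ?case .
  qed
  with lim show ?case unfolding b_def by blast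
qed

text \<open>Cycles before the giant one are peeled off as in \<open>short_cycles\<close>, with
  limiting weights \<open>p l\<close>; those after it are settled by
  \<open>giant_then_short\<close>.\<close>

lemma giant_cycle_event:
  assumes \<epsilon>: "0 < \<epsilon>" "\<epsilon> < \<nu>" "\<epsilon> < 1 - \<nu>"
  shows "\<exists>g. g \<longlonglongrightarrow> (\<Sum>l=1..K. p l) ^ k * (\<nu> * ((\<Sum>l=1..K. p l) / (1 - \<nu> + \<epsilon>)) ^ r) \<and>
    eventually (\<lambda>N. g N \<le> cc N (N - d) (replicate k {1..K} @ win \<epsilon> N # replicate r {1..K}) / h N N) sequentially"
proof (induction k arbitrary: d)
  case 0
  from giant_then_short[OF \<epsilon>, of K r d] obtain g where g: "g \<longlonglongrightarrow> \<nu> * ((\<Sum>l=1..K. p l) / (1 - \<nu> + \<epsilon>)) ^ r"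
    "eventually (\<lambda>N. g N \<le> (\<Sum>l\<in>{1..N - d} \<inter> win \<epsilon> N.
       u N l / real N * (cc N (N - d - l) (replicate r {1..K}) / h N N))) sequentially" by blast
  have "eventually (\<lambda>N. g N \<le> cc N (N - d) (replicate 0 {1..K} @ win \<epsilon> N # replicate r {1..K}) / h N N) sequentially"
    using g(2) eventually_gt_at_top[of d]
  proof eventually_elim
    case (elim N)
    \<comment> \<open>The recursion divides by \<open>N - d\<close> instead of \<open>N\<close>,
      which only helps a lower bound.\<close>
    have "(\<Sum>l\<in>{1..N - d} \<inter> win \<epsilon> N. u N l / real N * (cc N (N - d - l) (replicate r {1..K}) / h N N))
      \<le> (\<Sum>l\<in>{1..N - d} \<inter> win \<epsilon> N. u N l / real (N - d) * (cc N (N - d - l) (replicate r {1..K}) / h N N))"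
      using elim u_nonneg cc_nonneg h_nonneg
      by (intro sum_mono mult_right_mono divide_left_mono) auto
    also have "\<dots> = cc N (N - d) (replicate 0 {1..K} @ win \<epsilon> N # replicate r {1..K}) / h N N"
      by (simp add: cc_Cons sum_divide_distrib)
    finally show ?case using elim(1) by linarith
  qed
  with g(1) show ?case by auto
next
  case (Suc k)
  let ?L = "\<lambda>k N. replicate k {1..K} @ win \<epsilon> N # replicate r {1..K}"
  have "\<exists>g. \<forall>d. g d \<longlonglongrightarrow> (\<Sum>l=1..K. p l) ^ k * (\<nu> * ((\<Sum>l=1..K. p l) / (1 - \<nu> + \<epsilon>)) ^ r) \<and>
      eventually (\<lambda>N. g d N \<le> cc N (N - d) (?L k N) / h N N) sequentially"
    by (rule choice, rule allI, rule Suc)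
  then obtain g where g: "\<And>d. g d \<longlonglongrightarrow> (\<Sum>l=1..K. p l) ^ k * (\<nu> * ((\<Sum>l=1..K. p l) / (1 - \<nu> + \<epsilon>)) ^ r)"
    "\<And>d. eventually (\<lambda>N. g d N \<le> cc N (N - d) (?L k N) / h N N) sequentially"
    by blast
  define G where "G N = (\<Sum>l=1..K. u N l / real (N - d) * g (d + l) N)" for N
  have "G \<longlonglongrightarrow> (\<Sum>l=1..K. p l * ((\<Sum>l=1..K. p l) ^ k * (\<nu> * ((\<Sum>l=1..K. p l) / (1 - \<nu> + \<epsilon>)) ^ r)))"
    unfolding G_def by (intro tendsto_sum tendsto_mult u_over_limit g)
  moreover have "eventually (\<lambda>N. \<forall>l\<in>{1..K}. g (d + l) N \<le> cc N (N - (d + l)) (?L k N) / h N N) sequentially"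
    by (rule eventually_ball_finite) (use g(2) in auto)
  then have "eventually (\<lambda>N. G N \<le> cc N (N - d) (?L (Suc k) N) / h N N) sequentially"
    using eventually_ge_at_top[of "d + K"]
  proof eventually_elim
    case (elim N)
    have "G N \<le> (\<Sum>l=1..K. u N l / real (N - d) * (cc N (N - (d + l)) (?L k N) / h N N))"
      unfolding G_def using elim u_nonneg by (intro sum_mono mult_left_mono) auto
    also have "\<dots> = cc N (N - d) (?L (Suc k) N) / h N N"
    proof -
      have e: "{1..N - d} \<inter> {1..K} = {1..K}" using elim by auto
      show ?thesis unfolding replicate_Suc append_Cons cc_Cons sum_divide_distrib e by simp
    qed
    finally show ?case .
  qed
  moreover have "(\<Sum>l=1..K. p l * Q) = (\<Sum>l=1..K. p l) * Q" for Q
    by (rule sum_distrib_right[symmetric])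
  ultimately show ?case unfolding power_Suc mult.assoc by auto
qed

end

section \<open>Singularity analysis\<close>

text \<open>Cauchy's coefficient formula over a parameter interval, ready for comparison with real
  integrals.\<close>

lemma circle_mean_value:
  assumes f: "f holomorphic_on ball 0 1" and \<rho>: "0 < \<rho>" "\<rho> < 1"
  defines "e \<equiv> \<lambda>t::real. complex_of_real \<rho> * exp (2 * of_real pi * \<i> * of_real t)"
  shows "((\<lambda>t. f (e t) / e t ^ j) has_integral ((deriv ^^ j) f 0 / fact j)) {0..1}"
proof -
  have cp: "circlepath 0 \<rho> t = e t" for t
    by (simp add: circlepath e_def)
  have e0: "e t \<noteq> 0" for t using \<rho> by (simp add: e_def)
  have "f holomorphic_on cball 0 \<rho>" using f \<rho> by (auto intro: holomorphic_on_subset)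
  then have "((\<lambda>u. f u / (u - 0) ^ Suc j) has_contour_integral ((2 * pi * \<i>) / (fact j) * (deriv ^^ j) f 0)) (circlepath 0 \<rho>)"
    using \<rho> by (intro Cauchy_has_contour_integral_higher_derivative_circlepath)
      (auto intro: holomorphic_on_imp_continuous_on holomorphic_on_subset)
  then have "((\<lambda>t. f (e t) / e t ^ Suc j * (2 * pi * \<i> * e t)) has_integral ((2 * pi * \<i>) / (fact j) * (deriv ^^ j) f 0)) {0..1}"
    unfolding has_contour_integral
    by (simp add: cp vector_derivative_circlepath e_def mult_ac)
  then have "((\<lambda>t. (1 / (2 * pi * \<i>)) * (f (e t) / e t ^ Suc j * (2 * pi * \<i> * e t))) has_integral
      ((1 / (2 * pi * \<i>)) * ((2 * pi * \<i>) / (fact j) * (deriv ^^ j) f 0))) {0..1}"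
    by (rule has_integral_mult_right)
  moreover have "(1 / (2 * pi * \<i>)) * (f (e t) / e t ^ Suc j * (2 * pi * \<i> * e t)) = f (e t) / e t ^ j" for t
    using e0[of t] by (simp add: field_simps)
  moreover have "(1 / (2 * pi * \<i>)) * ((2 * pi * \<i>) / (fact j) * (deriv ^^ j) f 0) = (deriv ^^ j) f 0 / fact j"
    by simp
  ultimately show ?thesis by (simp only:)
qed

text \<open>The kernel is the real part of \<open>(1 + z) / (1 - z)\<close>, whose mean over a
  circle is its value \<open>1\<close> at the origin.\<close>

lemma poisson_kernel_integral:
  assumes \<rho>: "0 < \<rho>" "\<rho> < 1"
  defines "e \<equiv> \<lambda>t::real. complex_of_real \<rho> * exp (2 * of_real pi * \<i> * of_real t)"
  shows "((\<lambda>t. (1 - \<rho>\<^sup>2) / (norm (1 - e t))\<^sup>2) has_integral 1) {0..1}"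
proof -
  have "(\<lambda>z. (1 + z) / (1 - z)) holomorphic_on ball (0::complex) 1"
    by (intro holomorphic_intros) auto
  from circle_mean_value[OF this \<rho>, of 0]
  have "((\<lambda>t. (1 + e t) / (1 - e t)) has_integral 1) {0..1}"
    by (simp add: e_def)
  then have "((\<lambda>t. Re ((1 + e t) / (1 - e t))) has_integral Re 1) {0..1}"
    by (rule has_integral_Re)
  moreover have "Re ((1 + e t) / (1 - e t)) = (1 - \<rho>\<^sup>2) / (norm (1 - e t))\<^sup>2" for t
  proof -
    have "norm (e t) = \<rho>" using \<rho> by (simp add: e_def norm_mult)
    then have "\<rho>\<^sup>2 = (Re (e t))\<^sup>2 + (Im (e t))\<^sup>2" by (metis cmod_power2)
    then have "Re ((1 + e t) * cnj (1 - e t)) = 1 - \<rho>\<^sup>2"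
      by (simp add: power2_eq_square algebra_simps)
    then show ?thesis
      by (subst complex_div_cnj) (simp only: Re_divide_of_real of_real_power[symmetric])
  qed
  ultimately show ?thesis by simp
qed

text \<open>Transfer of a bound on \<open>f\<close> to its coefficients. For \<open>\<beta> \<ge> 2\<close> it suffices to integrate over
  circles inside the disc of convergence, and \<open>\<bar>1 - z\<bar>\<^sup>-\<^sup>\<beta>\<close> is dominated by the Poisson kernel.\<close>
lemma coeff_bound:
  fixes a :: "nat \<Rightarrow> complex"
  assumes sums: "\<And>z. norm z < 1 \<Longrightarrow> (\<lambda>j. a j * z ^ j) sums f z"
    and bound: "\<And>z. norm z < 1 \<Longrightarrow> norm (f z) \<le> C * norm (1 - z) powr - \<beta>"
    and \<beta>: "\<beta> \<ge> 2"
  shows "\<exists>K. \<forall>j\<ge>1. norm (a j) \<le> K * real j powr (\<beta> - 1)"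
proof (intro exI allI impI)
  fix j :: nat assume j: "j \<ge> 1"
  have C: "C \<ge> 0" using bound[of 0] norm_ge_zero[of "f 0"] by (simp del: norm_ge_zero)
  \<comment> \<open>This radius keeps \<open>1 / \<rho> ^ j\<close> below \<open>exp 1\<close> while
    \<open>1 - \<rho>\<close> is of order \<open>1 / j\<close>.\<close>
  define \<rho> where "\<rho> = real j / (real j + 1)"
  have \<rho>: "0 < \<rho>" "\<rho> < 1" using j by (auto simp: \<rho>_def)
  have \<rho>1: "1 - \<rho> = 1 / (real j + 1)" by (simp add: \<rho>_def field_simps)
  define e where "e t = complex_of_real \<rho> * exp (2 * of_real pi * \<i> * of_real t)" for t :: real
  have ne: "norm (e t) = \<rho>" for t using \<rho> by (simp add: e_def norm_mult)
  have hol: "f holomorphic_on ball 0 1"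
    by (rule power_series_holomorphic[of 0 1 a]) (use sums in simp)
  have "f has_fps_expansion Abs_fps a"
  proof (rule has_fps_expansionI)
    have "eventually (\<lambda>u. norm u < 1) (nhds (0::complex))"
      using eventually_nhds_in_open[of "ball (0::complex) 1" 0] by simp
    then show "\<forall>\<^sub>F u in nhds 0. (\<lambda>n. fps_nth (Abs_fps a) n * u ^ n) sums f u"
      by eventually_elim (simp add: sums)
  qed
  from fps_nth_fps_expansion[OF this, of j] have a: "a j = (deriv ^^ j) f 0 / fact j" by simp
  have int: "((\<lambda>t. f (e t) / e t ^ j) has_integral a j) {0..1}"
    using circle_mean_value[OF hol \<rho>, of j] unfolding a e_def .
  define D where "D = C * (1 - \<rho>) powr (2 - \<beta>) / \<rho> ^ j / (1 - \<rho>\<^sup>2)"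
  have r2: "1 - \<rho>\<^sup>2 > 0" using \<rho> by (simp add: power_less_one_iff abs_square_less_1)
  have int2: "((\<lambda>t. D * ((1 - \<rho>\<^sup>2) / (norm (1 - e t))\<^sup>2)) has_integral (D * 1)) {0..1}"
    by (rule has_integral_mult_right) (use poisson_kernel_integral[OF \<rho>] in \<open>simp add: e_def\<close>)
  have pt: "norm (f (e t) / e t ^ j) \<le> D * ((1 - \<rho>\<^sup>2) / (norm (1 - e t))\<^sup>2)" for t
  proof -
    define d where "d = norm (1 - e t)"
    have d1: "d \<ge> 1 - \<rho>" using norm_triangle_ineq2[of 1 "e t"] ne[of t] by (simp add: d_def)
    then have d: "d > 0" using \<rho> by linarith
    have "norm (f (e t)) \<le> C * d powr - \<beta>" using bound[of "e t"] ne[of t] \<rho> by (simp add: d_def)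
    \<comment> \<open>The exponent \<open>2\<close> is split off for the Poisson kernel; the rest
      has exponent \<open>2 - \<beta> \<le> 0\<close> and is largest at
      \<open>d = 1 - \<rho>\<close>.\<close>
    also have "d powr - \<beta> = d powr (2 - \<beta>) * d powr - 2" by (simp add: powr_add[symmetric])
    also have "d powr - 2 = 1 / d\<^sup>2" using d by (simp add: powr_minus_divide powr_numeral)
    also have "C * (d powr (2 - \<beta>) * (1 / d\<^sup>2)) \<le> C * ((1 - \<rho>) powr (2 - \<beta>) * (1 / d\<^sup>2))"
      using C d1 \<rho> \<beta> by (intro mult_left_mono mult_right_mono powr_mono2') auto
    finally have "norm (f (e t)) / \<rho> ^ j \<le> C * ((1 - \<rho>) powr (2 - \<beta>) * (1 / d\<^sup>2)) / \<rho> ^ j"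
      using \<rho> by (intro divide_right_mono) auto
    also have "\<dots> = D * ((1 - \<rho>\<^sup>2) / d\<^sup>2)" using r2 by (simp add: D_def)
    finally show ?thesis by (simp add: norm_divide norm_power ne d_def)
  qed
  have "norm (integral {0..1} (\<lambda>t. f (e t) / e t ^ j)) \<le> integral {0..1} (\<lambda>t. D * ((1 - \<rho>\<^sup>2) / (norm (1 - e t))\<^sup>2))"
    using int int2 pt by (intro Henstock_Kurzweil_Integration.integral_norm_bound_integral) (auto intro: has_integral_integrable)
  then have "norm (a j) \<le> D" using integral_unique[OF int] integral_unique[OF int2] by simp
  also have "D \<le> C * exp 1 * 2 powr (\<beta> - 1) * real j powr (\<beta> - 1)"
  proof -
    have 1: "(1 - \<rho>) powr (2 - \<beta>) = (real j + 1) powr (\<beta> - 2)"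
      unfolding \<rho>1 using powr_minus_divide[of "real j + 1" "2 - \<beta>"] by (simp add: powr_divide)
    have 2: "1 / \<rho> ^ j \<le> exp 1"
    proof -
      have "1 / \<rho> = 1 + 1 / real j" using j by (simp add: \<rho>_def field_simps)
      also have "\<dots> \<le> exp (1 / real j)" using exp_ge_add_one_self[of "1 / real j"] by simp
      finally have "(1 / \<rho>) ^ j \<le> exp (1 / real j) ^ j" using \<rho> by (intro power_mono) auto
      also have "\<dots> = exp 1" using j by (simp flip: exp_of_nat_mult)
      finally show ?thesis by (simp add: power_one_over)
    qed
    have "1 - \<rho> \<le> 1 - \<rho>\<^sup>2" using \<rho> by (simp add: power2_eq_square mult_left_le)
    then have 3: "1 / (1 - \<rho>\<^sup>2) \<le> real j + 1"
      using \<rho> r2 frac_le[of 1 1 "1 - \<rho>" "1 - \<rho>\<^sup>2"] unfolding \<rho>1 by simp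
    have "D = C * (real j + 1) powr (\<beta> - 2) * (1 / \<rho> ^ j) * (1 / (1 - \<rho>\<^sup>2))"
      by (simp add: D_def 1)
    also have "\<dots> \<le> C * (real j + 1) powr (\<beta> - 2) * exp 1 * (real j + 1)"
      using C 2 3 r2 \<rho> by (intro mult_mono) auto
    also have "\<dots> = C * exp 1 * ((real j + 1) powr (\<beta> - 2) * (real j + 1) powr 1)" by simp
    also have "\<dots> = C * exp 1 * (real j + 1) powr (\<beta> - 1)" by (simp only: powr_add[symmetric]) simp
    also have "\<dots> \<le> C * exp 1 * (2 * real j) powr (\<beta> - 1)"
      using C j \<beta> by (intro mult_left_mono powr_mono2) auto
    also have "\<dots> = C * exp 1 * 2 powr (\<beta> - 1) * real j powr (\<beta> - 1)"
      by (simp add: powr_mult)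
    finally show ?thesis .
  qed
  finally show "norm (a j) \<le> C * exp 1 * 2 powr (\<beta> - 1) * real j powr (\<beta> - 1)" .
qed

text \<open>\<open>Arg\<close> jumps on the negative axis, but its absolute value is determined by
  its cosine. In this form openness is visible and the point \<open>R\<close> is excluded
  automatically.\<close>

lemma Delta0_eq:
  assumes "0 < \<phi>" "\<phi> < pi"
  shows "Delta0 R \<eta> \<phi> = {z. norm z < R * norm (1 + complex_of_real \<eta> * exp (\<i> * complex_of_real \<phi>))} \<inter>
    {z. Re (z - of_real R) < norm (z - of_real R) * cos \<phi>}"
proof -
  have "\<bar>Arg w\<bar> > \<phi> \<longleftrightarrow> Re w < norm w * cos \<phi>" if w: "w \<noteq> 0" for w
  proof -
    have "\<bar>Arg w\<bar> \<le> pi" using Arg_bounded[of w] by auto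
    then have "\<bar>Arg w\<bar> > \<phi> \<longleftrightarrow> cos \<bar>Arg w\<bar> < cos \<phi>"
      using assms by (intro cos_mono_less_eq[symmetric]) auto
    also have "cos \<bar>Arg w\<bar> = Re w / norm w" using cos_Arg[OF w] by (simp add: abs_if)
    finally show ?thesis using w by (simp add: divide_less_eq mult.commute)
  qed
  then have "z \<noteq> of_real R \<and> \<bar>Arg (z - of_real R)\<bar> > \<phi> \<longleftrightarrow> Re (z - of_real R) < norm (z - of_real R) * cos \<phi>" for z
    by (cases "z = of_real R") auto
  then show ?thesis
    unfolding Delta0_def by auto
qed

lemma open_Delta0: "0 < \<phi> \<Longrightarrow> \<phi> < pi \<Longrightarrow> open (Delta0 R \<eta> \<phi>)"
  unfolding Delta0_eq by (intro open_Int open_Collect_less continuous_intros)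

text \<open>Points of the closed disc satisfy \<open>Re (z - R) \<le> 0\<close>, and
  \<open>\<phi> < pi / 2\<close> makes \<open>cos \<phi>\<close> positive and hence the outer radius
  larger than \<open>R\<close>.\<close>

lemma cball_subset_Delta0:
  assumes "R > 0" "\<eta> > 0" "0 < \<phi>" "\<phi> < pi / 2"
  shows "cball 0 R - {complex_of_real R} \<subseteq> Delta0 R \<eta> \<phi>"
proof
  fix z assume z: "z \<in> cball 0 R - {complex_of_real R}"
  have c: "cos \<phi> > 0" using assms by (intro cos_gt_zero) auto
  have "1 < 1 + \<eta> * cos \<phi>" using c assms by simp
  also have "\<dots> = Re (1 + complex_of_real \<eta> * exp (\<i> * complex_of_real \<phi>))"
    by (simp add: Re_exp)
  also have "\<dots> \<le> norm (1 + complex_of_real \<eta> * exp (\<i> * complex_of_real \<phi>))" by (rule complex_Re_le_cmod)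
  finally have "norm z < R * norm (1 + complex_of_real \<eta> * exp (\<i> * complex_of_real \<phi>))"
    using z assms by (simp add: order_le_less_trans[of "norm z" R])
  moreover have "Re (z - of_real R) \<le> 0" using z complex_Re_le_cmod[of z] by simp
  moreover have "0 < norm (z - of_real R) * cos \<phi>" using z c by simp
  ultimately show "z \<in> Delta0 R \<eta> \<phi>"
    using assms by (subst Delta0_eq) auto
qed

section \<open>The power series of \<open>gbr\<close> and its radial limit\<close>

lemma gfun_eval_fps: "gfun \<kappa> = eval_fps (Abs_fps (gcoeff \<kappa>))"
  by (rule ext) (simp add: gfun_def eval_fps_def gcoeff_def)

lemma gfun_holomorphic:
  assumes "conv_radius (gcoeff \<kappa>) = ereal R"
  shows "gfun \<kappa> holomorphic_on ball 0 R"
  unfolding gfun_eval_fps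
  by (rule holomorphic_on_eval_fps) (simp add: fps_conv_radius_def assms)

lemma fps_nth_higher_deriv:
  "fps_nth ((fps_deriv ^^ n) F) k = pochhammer (of_nat k + 1) n * fps_nth (F :: 'a :: {comm_ring_1, semiring_no_zero_divisors} fps) (k + n)"
proof (induction n arbitrary: k)
  case (Suc n)
  have "fps_nth ((fps_deriv ^^ Suc n) F) k = of_nat (k + 1) * (pochhammer (of_nat (Suc k) + 1) n * fps_nth F (Suc k + n))"
    by (simp add: Suc)
  also have "\<dots> = pochhammer (of_nat k + 1) (Suc n) * fps_nth F (k + Suc n)"
    by (simp add: pochhammer_rec add_ac mult_ac)
  finally show ?case .
qed simp

text \<open>The Pochhammer symbol is the falling factorial \<open>j (j - 1) ... (j - n + 1)\<close>
  from \<open>n\<close> differentiations; multiplication by \<open>z ^ n\<close> restores the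
  exponent \<open>j\<close>.\<close>

definition gbr_coeff :: "(nat \<Rightarrow> real) \<Rightarrow> nat \<Rightarrow> nat \<Rightarrow> real" where
  "gbr_coeff \<kappa> n j = (if j < n then 0 else pochhammer (real (j - n) + 1) n * (\<kappa> j / real j))"

lemma gbr_sums:
  assumes rad: "conv_radius (gcoeff \<kappa>) = ereal R" and R: "R > 0" and z: "norm z < R"
  shows "(\<lambda>j. of_real (gbr_coeff \<kappa> n j) * z ^ j) sums gbr (gfun \<kappa>) n z"
proof -
  define F where "F = Abs_fps (gcoeff \<kappa>)"
  have "gfun \<kappa> has_fps_expansion F"
    unfolding gfun_eval_fps F_def using R
    by (intro eval_fps_has_fps_expansion) (simp add: fps_conv_radius_def rad)
  then have "(deriv ^^ n) (gfun \<kappa>) has_fps_expansion (fps_deriv ^^ n) F"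
    by (induction n) (auto intro: has_fps_expansion_deriv)
  then have exp: "gbr (gfun \<kappa>) n has_fps_expansion (fps_X ^ n * (fps_deriv ^^ n) F)"
    unfolding gbr_def by (intro has_fps_expansion_mult has_fps_expansion_fps_X_power)
  have "gbr (gfun \<kappa>) n holomorphic_on eball 0 (ereal R)"
    unfolding gbr_def using gfun_holomorphic[OF rad] by (intro holomorphic_intros) auto
  from has_fps_expansion_imp_sums_complex[OF exp this] z
  have "(\<lambda>j. fps_nth (fps_X ^ n * (fps_deriv ^^ n) F) j * z ^ j) sums gbr (gfun \<kappa>) n z" by simp
  moreover have "fps_nth (fps_X ^ n * (fps_deriv ^^ n) F) j = of_real (gbr_coeff \<kappa> n j)" for j
  proof (cases "j < n")
    case False
    have "pochhammer (complex_of_nat (j - n) + 1) n = of_real (pochhammer (real (j - n) + 1) n)"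
      by (simp add: pochhammer_of_real[symmetric])
    then show ?thesis using False
      by (simp add: fps_X_power_mult_nth fps_nth_higher_deriv gbr_coeff_def F_def gcoeff_def)
  qed (simp add: fps_X_power_mult_nth gbr_coeff_def)
  ultimately show ?thesis by simp
qed

lemma pochhammer_ratio_limit:
  "(\<lambda>j. pochhammer (real (j - n) + 1) n / real j ^ n) \<longlonglongrightarrow> 1"
proof -
  have "(\<lambda>j. \<Prod>i=0..<n. (real j - real n + 1 + real i) / real j) \<longlonglongrightarrow> (\<Prod>i=0..<n. 1)"
    by (intro tendsto_prod) real_asymp
  moreover have "eventually (\<lambda>j. (\<Prod>i=0..<n. (real j - real n + 1 + real i) / real j) = pochhammer (real (j - n) + 1) n / real j ^ n) sequentially"
    using eventually_ge_at_top[of n]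
    by eventually_elim (simp add: pochhammer_prod prod_dividef of_nat_diff)
  ultimately show ?thesis by (simp add: Lim_transform_eventually)
qed

lemma gbr_coeff_1: "gbr_coeff \<kappa> 1 j = (if j = 0 then 0 else \<kappa> j)"
  by (simp add: gbr_coeff_def of_nat_diff)

text \<open>\<open>gbrR\<close> is defined by \<open>Lim\<close>, which is informative only once a
  limit exists. Nonnegative coefficients supply it: a divergent series would give infinity, against
  \<open>less\<close>, and a convergent one is handled by dominated convergence.\<close>

lemma gbrR_one:
  assumes rad: "conv_radius (gcoeff \<kappa>) = ereal R" and R: "R > 0"
    and nonneg: "\<forall>j\<ge>1. \<kappa> j \<ge> 0" and less: "gbrR \<kappa> R 1 < 1"
  defines "p \<equiv> \<lambda>j. if j = 0 then 0 else \<kappa> j * R ^ j"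
  shows "summable p" "real_of_ereal (gbrR \<kappa> R 1) = suminf p" "suminf p < 1"
proof -
  have p0: "p j \<ge> 0" for j using nonneg R by (auto simp: p_def Suc_le_eq)
  define F where "F r = Re (gbr (gfun \<kappa>) 1 (complex_of_real r))" for r
  have ev: "eventually (\<lambda>r. 0 < r \<and> r < R) (at_left R)"
    using eventually_at_left_real[OF R] by (auto elim: eventually_mono)
  have sums: "(\<lambda>j. p j * (r / R) ^ j) sums F r" if "0 < r" "r < R" for r
  proof -
    have "norm (complex_of_real r) < R" using that by simp
    from sums_Re[OF gbr_sums[OF rad R this, of 1]]
    have "(\<lambda>j. gbr_coeff \<kappa> 1 j * r ^ j) sums F r"
      by (simp add: F_def flip: of_real_power of_real_mult)
    moreover have "gbr_coeff \<kappa> 1 j * r ^ j = p j * (r / R) ^ j" for j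
      using R gbr_coeff_1[of \<kappa> j] by (simp add: p_def power_divide)
    ultimately show ?thesis by simp
  qed
  have lim1: "((\<lambda>r. p j * (r / R) ^ j) \<longlongrightarrow> p j) (at_left R)" for j
    using R by (auto intro!: tendsto_eq_intros)
  show sp: "summable p"
  proof (rule ccontr)
    assume ns: "\<not> summable p"
    have "((\<lambda>r. ereal (F r)) \<longlongrightarrow> \<infinity>) (at_left R)"
      unfolding tendsto_PInfty
    proof
      fix B :: real
      obtain M where M: "sum p {..<M} > B"
        using ns summableI_nonneg_bounded[of p B] p0 by (meson not_le)
      have "((\<lambda>r. \<Sum>j<M. p j * (r / R) ^ j) \<longlongrightarrow> sum p {..<M}) (at_left R)"
        by (intro tendsto_sum lim1)
      then have "eventually (\<lambda>r. (\<Sum>j<M. p j * (r / R) ^ j) > B) (at_left R)"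
        using M by (rule order_tendstoD)
      then show "eventually (\<lambda>r. ereal B < ereal (F r)) (at_left R)"
        using ev
      proof eventually_elim
        case (elim r)
        have "(\<Sum>j<M. p j * (r / R) ^ j) \<le> (\<Sum>j. p j * (r / R) ^ j)"
          using sums[of r] elim p0 R by (intro sum_le_suminf) (auto simp: sums_iff)
        then show ?case using elim sums[of r] by (simp add: sums_iff)
      qed
    qed
    then have "gbrR \<kappa> R 1 = \<infinity>"
      unfolding gbrR_def F_def by (intro tendsto_Lim) auto
    then show False using less by simp
  qed
  have "(F \<longlongrightarrow> suminf p) (at_left R)"
  proof -
    have "((\<lambda>r. \<Sum>j. p j * (r / R) ^ j) \<longlongrightarrow> suminf p) (at_left R)"
    proof (rule tannery_uniform[OF lim1 _ sp])
      show "\<forall>\<^sub>F r in at_left R. \<forall>k. \<bar>p k * (r / R) ^ k\<bar> \<le> p k"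
        using ev
      proof eventually_elim
        case (elim r)
        have "p k * (r / R) ^ k \<le> p k" for k
          using elim p0[of k] by (intro mult_left_le power_le_one) auto
        then show ?case using elim p0 by (simp add: abs_mult)
      qed
    qed simp
    moreover have "eventually (\<lambda>r. (\<Sum>j. p j * (r / R) ^ j) = F r) (at_left R)"
      using ev by eventually_elim (use sums in \<open>simp add: sums_iff\<close>)
    ultimately show ?thesis by (rule Lim_transform_eventually)
  qed
  then have "((\<lambda>r. ereal (F r)) \<longlongrightarrow> ereal (suminf p)) (at_left R)" by (rule tendsto_ereal)
  then have "gbrR \<kappa> R 1 = ereal (suminf p)"
    unfolding gbrR_def F_def by (intro tendsto_Lim) auto
  then show "real_of_ereal (gbrR \<kappa> R 1) = suminf p" "suminf p < 1" using less by auto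
qed

text \<open>The expansion is known only near \<open>R\<close>; on the rest of the closed disc, which
  lies in \<open>Delta0\<close>, compactness bounds \<open>gbr G n\<close>. Replacing the factor
  \<open>(z / R) ^ n\<close> by \<open>1\<close> leaves an error smaller than the main term by one
  power of \<open>1 - w\<close>, whence \<open>min \<delta> 1\<close>.\<close>

lemma gbr_remainder_bound:
  fixes R \<eta> \<phi> s a \<delta> :: real
  assumes R: "R > 0" and \<eta>: "\<eta> > 0" and \<phi>: "0 < \<phi>" "\<phi> < pi / 2"
    and rad: "conv_radius (gcoeff \<kappa>) = ereal R"
    and hol: "G holomorphic_on Delta0 R \<eta> \<phi>" and eq: "\<forall>z\<in>ball 0 R. G z = gfun \<kappa> z"
    and \<delta>: "0 < \<delta>"
    and big: "(\<lambda>z. gbr G n z - (z / of_real R) ^ n * (of_real b * (1 - z / of_real R) powr of_real (s - real n)))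
       \<in> bigo (at (of_real R) within Delta0 R \<eta> \<phi>) (\<lambda>z. (1 - z / of_real R) powr of_real (s - real n + \<delta>))"
    and n: "real n \<ge> s + 3"
  shows "\<exists>C. \<forall>w. norm w < 1 \<longrightarrow> norm (gbr (gfun \<kappa>) n (of_real R * w) - of_real b * (1 - w) powr of_real (s - real n))
      \<le> C * norm (1 - w) powr - (real n - s - min \<delta> 1)"
proof -
  let ?D = "Delta0 R \<eta> \<phi>"
  have oD: "open ?D" using \<phi> by (intro open_Delta0) auto
  have sub: "cball 0 R - {of_real R} \<subseteq> ?D" by (rule cball_subset_Delta0[OF R \<eta> \<phi>])
  obtain c1 where c1: "c1 > 0" "eventually (\<lambda>z. norm (gbr G n z - (z / of_real R) ^ n * (of_real b * (1 - z / of_real R) powr of_real (s - real n)))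
     \<le> c1 * norm ((1 - z / of_real R) powr of_real (s - real n + \<delta>))) (at (of_real R) within ?D)"
    using big by (elim landau_o.bigE)
  obtain d0 where d0: "d0 > 0" "\<And>z. z \<in> ?D \<Longrightarrow> z \<noteq> of_real R \<Longrightarrow> dist z (of_real R) < d0 \<Longrightarrow>
     norm (gbr G n z - (z / of_real R) ^ n * (of_real b * (1 - z / of_real R) powr of_real (s - real n)))
     \<le> c1 * norm ((1 - z / of_real R) powr of_real (s - real n + \<delta>))"
    using c1(2) unfolding eventually_at by blast
  define r0 where "r0 = min (d0 / R) 1"
  have r0: "0 < r0" "r0 \<le> 1" using d0 R by (auto simp: r0_def)
  define S where "S = {z. norm z \<le> R} \<inter> {z. R * r0 \<le> dist z (of_real R :: complex)}"
  have "compact S"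
  proof -
    have "S = cball 0 R \<inter> {z. R * r0 \<le> dist z (of_real R)}" by (auto simp: S_def)
    moreover have "closed {z. R * r0 \<le> dist z (of_real R :: complex)}"
      by (intro closed_Collect_le continuous_intros)
    ultimately show ?thesis by (simp add: compact_Int_closed)
  qed
  moreover have "continuous_on S (gbr G n)"
  proof -
    have "gbr G n holomorphic_on ?D" unfolding gbr_def using hol oD by (intro holomorphic_intros)
    moreover have "S \<subseteq> ?D"
    proof
      fix z assume z: "z \<in> S"
      have "0 < R * r0" using r0 R by simp
      then have "0 < dist z (of_real R)" using z by (simp only: S_def) auto
      then show "z \<in> ?D" using z sub by (auto simp: S_def)
    qed
    ultimately show ?thesis using holomorphic_on_imp_continuous_on continuous_on_subset by blast
  qed
  ultimately have "bounded (gbr G n ` S)" using compact_continuous_image compact_imp_bounded by blast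
  then obtain B where B: "B > 0" "\<And>z. z \<in> S \<Longrightarrow> norm (gbr G n z) \<le> B"
    unfolding bounded_pos by blast
  define \<beta> where "\<beta> = real n - s - min \<delta> 1"
  have \<beta>: "\<beta> \<ge> 2" using n \<delta> by (simp add: \<beta>_def)
  define C where "C = max (c1 + \<bar>b\<bar> * real n) ((B + \<bar>b\<bar> * r0 powr (s - real n)) * 2 powr \<beta>)"
  have "norm (gbr (gfun \<kappa>) n (of_real R * w) - of_real b * (1 - w) powr of_real (s - real n)) \<le> C * norm (1 - w) powr - \<beta>"
    if w: "norm w < 1" for w
  proof -
    define z where "z = of_real R * w"
    define d where "d = norm (1 - w)"
    have w1: "w \<noteq> 1" using w by auto
    have d: "d > 0" using w1 by (simp add: d_def)
    have d2: "d \<le> 2" using w norm_triangle_ineq4[of 1 w] by (simp add: d_def)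
    have nz: "norm z < R" using w R by (simp add: z_def norm_mult)
    have zR: "z \<noteq> of_real R" using nz R by auto
    have zD: "z \<in> ?D" using sub nz zR by auto
    have distz: "dist z (of_real R) = R * d"
    proof -
      have "z - of_real R = of_real R * (w - 1)" by (simp add: z_def algebra_simps)
      then show ?thesis using R by (simp add: dist_norm norm_mult d_def norm_minus_commute)
    qed
    have zw: "z / of_real R = w" using R by (simp add: z_def)
    have "(deriv ^^ n) G z = (deriv ^^ n) (gfun \<kappa>) z"
    proof (rule higher_deriv_transform_within_open[of _ "ball 0 R"])
      have "ball 0 R \<subseteq> ?D" using sub by auto
      then show "G holomorphic_on ball 0 R" using hol holomorphic_on_subset by blast
      show "gfun \<kappa> holomorphic_on ball 0 R" by (rule gfun_holomorphic[OF rad])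
    qed (use nz eq in auto)
    then have gz: "gbr (gfun \<kappa>) n z = gbr G n z" by (simp add: gbr_def)
    have np: "norm ((1 - w) powr of_real x) = d powr x" for x :: real
      by (simp add: d_def norm_powr_real_powr')
    have db: "d powr - \<beta> > 0" using d by simp
    show ?thesis
    proof (cases "d < r0")
      case True
      then have "dist z (of_real R) < d0" using R by (simp add: distz r0_def field_simps)
      from d0(2)[OF zD zR this]
      have "norm (gbr G n z - w ^ n * (of_real b * (1 - w) powr of_real (s - real n))) \<le> c1 * d powr (s - real n + \<delta>)"
        unfolding zw np .
      also have "d powr (s - real n + \<delta>) \<le> d powr - \<beta>"
        using d True r0 by (intro powr_mono') (auto simp: \<beta>_def)
      finally have "norm (gbr G n z - w ^ n * (of_real b * (1 - w) powr of_real (s - real n))) \<le> c1 * d powr - \<beta>"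
        using c1(1) by simp
      \<comment> \<open>\<open>w ^ n - 1\<close> vanishes at \<open>w = 1\<close>, which improves
        the exponent \<open>s - n\<close> by \<open>1\<close>.\<close>
      moreover have "norm ((w ^ n - 1 ^ n) * (of_real b * (1 - w) powr of_real (s - real n))) \<le> \<bar>b\<bar> * real n * d powr - \<beta>"
      proof -
        have "norm (w ^ n - 1 ^ n) \<le> real n * norm (w - 1)" using w by (intro norm_power_diff) auto
        also have "norm (w - 1) = d" by (simp add: d_def norm_minus_commute)
        finally have "norm ((w ^ n - 1 ^ n) * (of_real b * (1 - w) powr of_real (s - real n))) \<le> (real n * d) * (\<bar>b\<bar> * d powr (s - real n))"
          unfolding norm_mult np norm_of_real by (intro mult_right_mono) auto
        also have "\<dots> = \<bar>b\<bar> * real n * (d powr 1 * d powr (s - real n))" using d by simp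
        also have "d powr 1 * d powr (s - real n) = d powr (1 + (s - real n))" by (rule powr_add[symmetric])
        also have "d powr (1 + (s - real n)) \<le> d powr - \<beta>"
          using d True r0 \<delta> by (intro powr_mono') (auto simp: \<beta>_def)
        finally show ?thesis by (simp add: mult_left_mono)
      qed
      ultimately have "norm ((gbr G n z - w ^ n * (of_real b * (1 - w) powr of_real (s - real n))) +
          (w ^ n - 1 ^ n) * (of_real b * (1 - w) powr of_real (s - real n))) \<le> c1 * d powr - \<beta> + \<bar>b\<bar> * real n * d powr - \<beta>"
        by (intro norm_triangle_mono) auto
      also have "\<dots> = (c1 + \<bar>b\<bar> * real n) * d powr - \<beta>" by (simp add: distrib_right)
      also have "\<dots> \<le> C * d powr - \<beta>" using db by (intro mult_right_mono) (auto simp: C_def)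
      also have "(gbr G n z - w ^ n * (of_real b * (1 - w) powr of_real (s - real n))) +
          (w ^ n - 1 ^ n) * (of_real b * (1 - w) powr of_real (s - real n)) = gbr G n z - of_real b * (1 - w) powr of_real (s - real n)"
        by (simp add: algebra_simps)
      finally show ?thesis using gz by (simp add: z_def d_def)
    next
      case False
      then have "z \<in> S" using nz R by (simp add: S_def distz)
      then have "norm (gbr G n z - of_real b * (1 - w) powr of_real (s - real n)) \<le> B + \<bar>b\<bar> * d powr (s - real n)"
        using B(2)[of z] np[of "s - real n"] by (intro norm_triangle_le_diff) (simp add: norm_mult)
      also have "d powr (s - real n) \<le> r0 powr (s - real n)"
        using False r0 n by (intro powr_mono2') auto
      finally have 1: "norm (gbr G n z - of_real b * (1 - w) powr of_real (s - real n)) \<le> B + \<bar>b\<bar> * r0 powr (s - real n)"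
        by (simp add: mult_left_mono)
      \<comment> \<open>Away from the singularity a constant bound suffices, since
        \<open>d \<le> 2\<close> keeps \<open>d powr - \<beta>\<close> at least
        \<open>2 powr - \<beta>\<close>.\<close>
      have "1 \<le> 2 powr \<beta> * d powr - \<beta>"
      proof -
        have "2 powr - \<beta> \<le> d powr - \<beta>" using d d2 \<beta> by (intro powr_mono2') auto
        then have "2 powr \<beta> * 2 powr - \<beta> \<le> 2 powr \<beta> * d powr - \<beta>" by (intro mult_left_mono) auto
        then show ?thesis by (simp add: powr_add[symmetric])
      qed
      moreover have "0 \<le> B + \<bar>b\<bar> * r0 powr (s - real n)" using B by (intro add_nonneg_nonneg) auto
      ultimately have "(B + \<bar>b\<bar> * r0 powr (s - real n)) * 1 \<le> (B + \<bar>b\<bar> * r0 powr (s - real n)) * (2 powr \<beta> * d powr - \<beta>)"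
        by (intro mult_left_mono)
      also have "\<dots> = ((B + \<bar>b\<bar> * r0 powr (s - real n)) * 2 powr \<beta>) * d powr - \<beta>" by simp
      also have "\<dots> \<le> C * d powr - \<beta>" using db by (intro mult_right_mono) (auto simp: C_def)
      finally show ?thesis using gz 1 by (simp add: z_def d_def)
    qed
  qed
  then show ?thesis unfolding \<beta>_def by blast
qed

text \<open>The coefficients of \<open>(1 - w) powr (s - n)\<close> behave like
  \<open>j powr (n - s - 1) / Gamma (n - s)\<close>, and the remainder is smaller by
  \<open>j powr - \<delta>\<close>. Dividing by the falling factorial, of order
  \<open>j ^ n\<close>, undoes the differentiations; the last unit in the exponent comes from
  \<open>\<kappa> j / j\<close>.\<close>

lemma kappa_tail:
  fixes R s b :: real
  assumes R: "R > 0" and rad: "conv_radius (gcoeff \<kappa>) = ereal R"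
    and n: "real n \<ge> s + 3" and \<delta>: "0 < \<delta>" "\<delta> \<le> 1"
    and bound: "\<forall>w. norm w < 1 \<longrightarrow> norm (gbr (gfun \<kappa>) n (of_real R * w) - of_real b * (1 - w) powr of_real (s - real n))
      \<le> C * norm (1 - w) powr - (real n - s - \<delta>)"
  shows "(\<lambda>j. \<kappa> j * R ^ j * real j powr s) \<longlonglongrightarrow> b / Gamma (real n - s)"
proof -
  define z where "z = complex_of_real (s - real n)"
  define q where "q j = gbr_coeff \<kappa> n j * R ^ j" for j
  define v where "v j = of_real b * ((-1) ^ j * (z gchoose j))" for j
  have "\<exists>K. \<forall>j\<ge>1. norm (of_real (q j) - v j) \<le> K * real j powr ((real n - s - \<delta>) - 1)"
  proof (rule coeff_bound)
    fix w :: complex assume w: "norm w < 1"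
    have "norm (of_real R * w) < R" using w R by (simp add: norm_mult)
    from gbr_sums[OF rad R this, of n]
    have 1: "(\<lambda>j. of_real (q j) * w ^ j) sums gbr (gfun \<kappa>) n (of_real R * w)"
      by (simp add: q_def power_mult_distrib mult_ac)
    have "(\<lambda>j. (z gchoose j) * (- w) ^ j) sums (1 + - w) powr z"
      using w by (intro gen_binomial_complex) simp
    then have "(\<lambda>j. of_real b * ((z gchoose j) * (- w) ^ j)) sums (of_real b * (1 + - w) powr z)"
      by (rule sums_mult)
    moreover have "of_real b * ((z gchoose j) * (- w) ^ j) = v j * w ^ j" for j
      by (subst power_minus) (simp add: v_def mult_ac)
    ultimately have 2: "(\<lambda>j. v j * w ^ j) sums (of_real b * (1 - w) powr z)" by simp
    show "(\<lambda>j. (of_real (q j) - v j) * w ^ j) sums (gbr (gfun \<kappa>) n (of_real R * w) - of_real b * (1 - w) powr of_real (s - real n))"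
      using sums_diff[OF 1 2] by (simp add: left_diff_distrib z_def)
  qed (use bound n \<delta> in auto)
  then obtain K where K: "\<And>j. j \<ge> 1 \<Longrightarrow> norm (of_real (q j) - v j) \<le> K * real j powr ((real n - s - \<delta>) - 1)" by blast
  define m where "m = s - real n + 1"
  have "(\<lambda>j. (of_real (q j) - v j) * of_real (real j powr m)) \<longlonglongrightarrow> 0"
  proof (rule Lim_null_comparison)
    show "eventually (\<lambda>j. norm ((of_real (q j) - v j) * of_real (real j powr m)) \<le> K * real j powr - \<delta>) sequentially"
      using eventually_ge_at_top[of 1]
    proof eventually_elim
      case (elim j)
      have "norm ((of_real (q j) - v j) * of_real (real j powr m)) \<le> K * real j powr ((real n - s - \<delta>) - 1) * real j powr m"
        using K[OF elim] by (simp add: norm_mult mult_right_mono)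
      also have "\<dots> = K * real j powr - \<delta>"
        by (simp add: mult.assoc powr_add[symmetric] m_def)
      finally show ?case .
    qed
    have "(\<lambda>j. real j powr - \<delta>) \<longlonglongrightarrow> 0" using \<delta> by real_asymp
    then show "(\<lambda>j. K * real j powr - \<delta>) \<longlonglongrightarrow> 0" using tendsto_mult_right_zero by blast
  qed
  moreover have "(\<lambda>j. v j * of_real (real j powr m)) \<longlonglongrightarrow> of_real b * inverse (Gamma (- z))"
  proof -
    have "(\<lambda>j. of_real b * ((z gchoose j) / ((-1) ^ j / exp ((z + 1) * of_real (ln (real j)))))) \<longlonglongrightarrow> of_real b * inverse (Gamma (- z))"
      by (intro tendsto_intros gbinomial_asymptotic)
    moreover have "eventually (\<lambda>j. of_real b * ((z gchoose j) / ((-1) ^ j / exp ((z + 1) * of_real (ln (real j))))) = v j * of_real (real j powr m)) sequentially"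
      using eventually_ge_at_top[of 1]
    proof eventually_elim
      case (elim j)
      have "exp ((z + 1) * of_real (ln (real j))) = of_real (exp (m * ln (real j)))"
        by (simp add: z_def m_def exp_of_real[symmetric])
      also have "exp (m * ln (real j)) = real j powr m" using elim by (simp add: powr_def)
      finally have e: "exp ((z + 1) * of_real (ln (real j))) = of_real (real j powr m)" .
      have "(1::complex) / (-1) ^ j = (-1) ^ j" by (simp add: field_simps flip: power_add power_mult_distrib)
      then show ?case unfolding e v_def by (simp add: divide_inverse) 
    qed
    ultimately show ?thesis by (rule Lim_transform_eventually)
  qed
  ultimately have "(\<lambda>j. (of_real (q j) - v j) * of_real (real j powr m) + v j * of_real (real j powr m)) \<longlonglongrightarrow> 0 + of_real b * inverse (Gamma (- z))"
    by (rule tendsto_add)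
  moreover have "(of_real (q j) - v j) * of_real (real j powr m) + v j * of_real (real j powr m) = of_real (q j * real j powr m)" for j
    by (simp add: algebra_simps)
  moreover have "of_real b * inverse (Gamma (- z)) = complex_of_real (b / Gamma (real n - s))"
  proof -
    have "- z = complex_of_real (real n - s)" by (simp add: z_def)
    then show ?thesis by (simp only: Gamma_complex_of_real) (simp add: divide_inverse)
  qed
  ultimately have "(\<lambda>j. complex_of_real (q j * real j powr m)) \<longlonglongrightarrow> complex_of_real (b / Gamma (real n - s))"
    by simp
  then have "(\<lambda>j. q j * real j powr m) \<longlonglongrightarrow> b / Gamma (real n - s)"
    by (simp only: tendsto_of_real_iff)
  then have "(\<lambda>j. q j * real j powr m / (pochhammer (real (j - n) + 1) n / real j ^ n)) \<longlonglongrightarrow> b / Gamma (real n - s) / 1"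
    by (intro tendsto_divide pochhammer_ratio_limit) auto
  moreover have "eventually (\<lambda>j. q j * real j powr m / (pochhammer (real (j - n) + 1) n / real j ^ n) = \<kappa> j * R ^ j * real j powr s) sequentially"
    using eventually_ge_at_top[of "n + 1"]
  proof eventually_elim
    case (elim j)
    then have j: "real j > 0" by simp
    have P: "pochhammer (real (j - n) + 1) n > 0" by (rule pochhammer_pos) simp
    have "real j powr m = real j powr s / real j powr real n * real j"
      using j by (simp add: m_def powr_add powr_diff)
    also have "real j powr real n = real j ^ n" using j by (simp add: powr_realpow)
    finally have "real j powr m = real j powr s / real j ^ n * real j" .
    then show ?case using elim j P by (simp add: q_def gbr_coeff_def)
  qed
  ultimately show ?thesis by (simp add: Lim_transform_eventually)
qed

text \<open>Regularity at \<open>R\<close> fills the only gap that \<open>Delta0\<close> leaves in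
  the closed disc. By compactness \<open>G\<close> is holomorphic on a larger disc, so its
  coefficients, scaled by \<open>R ^ j\<close>, decay exponentially.\<close>

lemma theta_decay:
  fixes R \<eta> \<phi> \<epsilon> s :: real
  assumes R: "R > 0" and \<eta>: "\<eta> > 0" and \<phi>: "0 < \<phi>" "\<phi> < pi / 2" and \<epsilon>: "\<epsilon> > 0"
    and hol: "G holomorphic_on (Delta0 R \<eta> \<phi> \<union> ball (of_real R) \<epsilon>)"
    and sums: "\<forall>z\<in>ball 0 R. (\<lambda>j. gcoeff \<theta> j * z ^ j) sums G z"
  shows "(\<lambda>j. \<theta> j * R ^ j * real j powr s) \<longlonglongrightarrow> 0"
proof -
  let ?U = "Delta0 R \<eta> \<phi> \<union> ball (complex_of_real R) \<epsilon>"
  have "open ?U" using \<phi> by (intro open_Un open_Delta0) auto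
  moreover have "cball 0 R \<subseteq> ?U" using cball_subset_Delta0[OF R \<eta> \<phi>] \<epsilon> by auto
  ultimately obtain e where e: "e > 0" "(\<Union>x\<in>cball 0 R. ball x e) \<subseteq> ?U"
    using compact_subset_open_imp_ball_epsilon_subset[of "cball 0 R" ?U] by auto
  have "ball 0 (R + e) \<subseteq> ?U"
  proof
    fix z :: complex assume z: "z \<in> ball 0 (R + e)"
    show "z \<in> ?U"
    proof (cases "norm z \<le> R")
      case True
      then show ?thesis using e by (intro subsetD[OF e(2)] UN_I[of z]) auto
    next
      case False
      then have nz: "norm z > 0" using R by linarith
      \<comment> \<open>The radial projection onto the circle of radius \<open>R\<close>, at
        distance \<open>norm z - R < e\<close> from \<open>z\<close>.\<close>
      define x where "x = of_real (R / norm z) * z"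
      have "norm x = R" using nz R unfolding x_def norm_mult norm_of_real by simp
      moreover have "dist x z < e"
      proof -
        have "x - z = of_real (R / norm z - 1) * z" by (simp add: x_def algebra_simps)
        then have "norm (x - z) = \<bar>R / norm z - 1\<bar> * norm z" by (simp only: norm_mult norm_of_real)
        also have "\<bar>R / norm z - 1\<bar> = 1 - R / norm z" using False nz by (simp add: abs_if field_simps)
        also have "(1 - R / norm z) * norm z = norm z - R" using nz by (simp add: field_simps)
        finally show ?thesis using z by (simp add: dist_norm)
      qed
      ultimately show ?thesis by (intro subsetD[OF e(2)] UN_I[of x]) auto
    qed
  qed
  then have holb: "G holomorphic_on ball 0 (R + e)" using hol holomorphic_on_subset by blast
  have exp: "G has_fps_expansion Abs_fps (gcoeff \<theta>)"
  proof (rule has_fps_expansionI)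
    have "eventually (\<lambda>u. u \<in> ball 0 R) (nhds (0::complex))"
      using R by (intro eventually_nhds_in_open) auto
    then show "\<forall>\<^sub>F u in nhds 0. (\<lambda>n. fps_nth (Abs_fps (gcoeff \<theta>)) n * u ^ n) sums G u"
      by eventually_elim (use sums in simp)
  qed
  define r where "r = R + e / 2"
  have r: "r > R" "r > 0" "r < R + e" using e R by (auto simp: r_def)
  have "(\<lambda>j. gcoeff \<theta> j * of_real r ^ j) sums G (of_real r)"
    using has_fps_expansion_imp_sums_complex[OF exp, of "ereal (R + e)" "of_real r"] holb r by simp
  then have "(\<lambda>j. gcoeff \<theta> j * of_real r ^ j) \<longlonglongrightarrow> 0"
    using sums_summable summable_LIMSEQ_zero by blast
  then have "Bseq (\<lambda>j. gcoeff \<theta> j * of_real r ^ j)" by (intro convergent_imp_Bseq convergentI)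
  then obtain B where B: "B > 0" "\<And>j. norm (gcoeff \<theta> j * of_real r ^ j) \<le> B" unfolding Bseq_def by auto
  define q where "q = R / r"
  have q: "0 < q" "q < 1" using r R by (auto simp: q_def)
  show ?thesis
  proof (rule Lim_null_comparison)
    show "eventually (\<lambda>j. norm (\<theta> j * R ^ j * real j powr s) \<le> B * (real j powr (s + 1) * q ^ j)) sequentially"
      using eventually_ge_at_top[of 1]
    proof eventually_elim
      case (elim j)
      have "\<bar>\<theta> j\<bar> / real j * r ^ j \<le> B" using B(2)[of j] r by (simp add: gcoeff_def norm_mult norm_power norm_divide)
      then have "\<bar>\<theta> j\<bar> \<le> B * real j / r ^ j" using r elim by (simp add: field_simps)
      then have "\<bar>\<theta> j\<bar> * (R ^ j * real j powr s) \<le> B * real j / r ^ j * (R ^ j * real j powr s)"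
        using R by (intro mult_right_mono) auto
      also have "\<dots> = B * (real j powr (s + 1) * q ^ j)" using elim by (simp add: q_def power_divide powr_add)
      finally show ?case using R by (simp add: abs_mult mult_ac)
    qed
    have "(\<lambda>j. real j powr (s + 1) * q ^ j) \<longlonglongrightarrow> 0" using q by real_asymp
    then show "(\<lambda>j. B * (real j powr (s + 1) * q ^ j)) \<longlonglongrightarrow> 0" using tendsto_mult_right_zero by blast
  qed
qed

section \<open>Convergence in distribution\<close>

text \<open>Lower bounds on the masses suffice: the deviations \<open>\<Delta> i\<close> are at
  least \<open>- e'\<close> with sum at most \<open>0\<close>, so their absolute values sum to at
  most \<open>2 * card I * e'\<close>, and the mass outside all \<open>A i\<close> is at most
  \<open>card I * e'\<close>. This is the origin of the factor \<open>3\<close>.\<close>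

lemma mixture_estimate:
  fixes w F :: "'a \<Rightarrow> real" and y \<pi> :: "nat \<Rightarrow> real"
  assumes S: "finite S" and w: "\<And>x. x \<in> S \<Longrightarrow> w x \<ge> 0" "sum w S = 1"
    and I: "finite I" and A: "\<And>i. i \<in> I \<Longrightarrow> A i \<subseteq> S" "disjoint_family_on A I"
    and F: "\<And>x. x \<in> S \<Longrightarrow> \<bar>F x\<bar> \<le> B" and y: "\<And>i. i \<in> I \<Longrightarrow> \<bar>y i\<bar> \<le> B"
    and close: "\<And>i x. i \<in> I \<Longrightarrow> x \<in> A i \<Longrightarrow> \<bar>F x - y i\<bar> \<le> e"
    and low: "\<And>i. i \<in> I \<Longrightarrow> sum w (A i) \<ge> \<pi> i - e'" and \<pi>: "sum \<pi> I = 1"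
    and e: "e \<ge> 0" "e' \<ge> 0" and B: "B \<ge> 0"
  shows "\<bar>(\<Sum>x\<in>S. w x * F x) - (\<Sum>i\<in>I. \<pi> i * y i)\<bar> \<le> e + 3 * B * real (card I) * e'"
proof -
  define U where "U = (\<Union>i\<in>I. A i)"
  define \<Delta> where "\<Delta> i = sum w (A i) - \<pi> i" for i
  have finA: "finite (A i)" if "i \<in> I" for i using A(1)[OF that] S finite_subset by blast
  have U: "U \<subseteq> S" using A(1) by (auto simp: U_def)
  have wA: "w x \<ge> 0" if "i \<in> I" "x \<in> A i" for i x using w(1) A(1) that by blast
  have sumU: "(\<Sum>x\<in>U. g x) = (\<Sum>i\<in>I. \<Sum>x\<in>A i. g x)" for g :: "'a \<Rightarrow> real"
    unfolding U_def using I finA A(2) by (intro sum.UNION_disjoint) (auto simp: disjoint_family_on_def)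
  have split: "(\<Sum>x\<in>S. g x) = (\<Sum>i\<in>I. \<Sum>x\<in>A i. g x) + (\<Sum>x\<in>S - U. g x)" for g :: "'a \<Rightarrow> real"
    using sum.subset_diff[OF U S, of g] sumU[of g] by simp
  have rest: "(\<Sum>x\<in>S - U. w x) = - (\<Sum>i\<in>I. \<Delta> i)"
    using split[of w] w(2) \<pi> by (simp add: \<Delta>_def sum_subtractf)
  have \<Delta>sum: "(\<Sum>i\<in>I. \<Delta> i) \<le> 0"
    using rest sum_nonneg[of "S - U" w] w(1) by (simp add: subset_iff)
  have \<Delta>: "\<Delta> i \<ge> - e'" if "i \<in> I" for i using low[OF that] by (simp add: \<Delta>_def)
  have "(\<Sum>i\<in>I. \<Delta> i) \<ge> (\<Sum>i\<in>I. - e')" using \<Delta> by (rule sum_mono)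
  then have \<Delta>low: "- (\<Sum>i\<in>I. \<Delta> i) \<le> real (card I) * e'" by simp
  have "(\<Sum>i\<in>I. \<bar>\<Delta> i\<bar>) \<le> (\<Sum>i\<in>I. \<Delta> i + 2 * e')"
    using \<Delta> e by (intro sum_mono) (force simp: abs_if)
  also have "\<dots> = (\<Sum>i\<in>I. \<Delta> i) + 2 * (real (card I) * e')" by (simp add: sum.distrib)
  finally have \<Delta>abs: "(\<Sum>i\<in>I. \<bar>\<Delta> i\<bar>) \<le> 2 * (real (card I) * e')" using \<Delta>sum by linarith
  have "(\<Sum>i\<in>I. \<pi> i * y i) = (\<Sum>i\<in>I. \<Sum>x\<in>A i. w x * y i) - (\<Sum>i\<in>I. \<Delta> i * y i)"
    by (simp add: \<Delta>_def sum_subtractf[symmetric] sum_distrib_right[symmetric] algebra_simps)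
  moreover have "(\<Sum>i\<in>I. \<Sum>x\<in>A i. w x * F x) - (\<Sum>i\<in>I. \<Sum>x\<in>A i. w x * y i) = (\<Sum>i\<in>I. \<Sum>x\<in>A i. w x * (F x - y i))"
    by (simp add: sum_subtractf[symmetric] right_diff_distrib)
  ultimately have eq: "(\<Sum>x\<in>S. w x * F x) - (\<Sum>i\<in>I. \<pi> i * y i) =
      (\<Sum>i\<in>I. \<Sum>x\<in>A i. w x * (F x - y i)) + (\<Sum>i\<in>I. \<Delta> i * y i) + (\<Sum>x\<in>S - U. w x * F x)"
    using split[of "\<lambda>x. w x * F x"] by linarith
  have "\<bar>\<Sum>i\<in>I. \<Sum>x\<in>A i. w x * (F x - y i)\<bar> \<le> (\<Sum>i\<in>I. \<Sum>x\<in>A i. w x * e)"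
    using close wA by (intro order.trans[OF sum_abs] sum_mono) (auto simp: abs_mult intro: mult_left_mono)
  also have "\<dots> = sum w U * e" by (simp add: sumU sum_distrib_right)
  also have "sum w U \<le> sum w S" using U S w(1) by (intro sum_mono2) auto
  then have "sum w U * e \<le> e" using e w(2) by (simp add: mult_left_le_one_le mult_right_mono[of _ 1 e, simplified])
  finally have 1: "\<bar>\<Sum>i\<in>I. \<Sum>x\<in>A i. w x * (F x - y i)\<bar> \<le> e" .
  have "\<bar>\<Sum>i\<in>I. \<Delta> i * y i\<bar> \<le> (\<Sum>i\<in>I. \<bar>\<Delta> i\<bar> * B)"
    using y by (intro order.trans[OF sum_abs] sum_mono) (auto simp: abs_mult intro: mult_left_mono)
  also have "\<dots> = (\<Sum>i\<in>I. \<bar>\<Delta> i\<bar>) * B" by (rule sum_distrib_right[symmetric])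
  also have "\<dots> \<le> 2 * (real (card I) * e') * B" using \<Delta>abs B by (rule mult_right_mono)
  finally have 2: "\<bar>\<Sum>i\<in>I. \<Delta> i * y i\<bar> \<le> 2 * (real (card I) * e') * B" .
  have "\<bar>\<Sum>x\<in>S - U. w x * F x\<bar> \<le> (\<Sum>x\<in>S - U. w x * B)"
    using F w(1) by (intro order.trans[OF sum_abs] sum_mono) (auto simp: abs_mult intro: mult_left_mono)
  also have "\<dots> = (- (\<Sum>i\<in>I. \<Delta> i)) * B" by (simp add: sum_distrib_right[symmetric] rest)
  also have "\<dots> \<le> (real (card I) * e') * B" using \<Delta>low B by (rule mult_right_mono)
  finally have 3: "\<bar>\<Sum>x\<in>S - U. w x * F x\<bar> \<le> (real (card I) * e') * B" .
  have "3 * B * real (card I) * e' = 2 * (real (card I) * e') * B + (real (card I) * e') * B" by simp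
  then show ?thesis using 1 2 3 eq by linarith
qed

text \<open>All elements of \<open>Rm m\<close> agree outside \<open>{1..m}\<close>, so only
  finitely many coordinates of a basic open set matter and the smallest of their radii
  works.\<close>

lemma Rm_continuous_box:
  assumes f: "continuous_on (Rm m) f" and y: "y \<in> Rm m" and e: "e > 0"
  shows "\<exists>\<epsilon>>0. \<forall>x\<in>Rm m. (\<forall>i\<in>{1..m}. \<bar>x i - y i\<bar> \<le> \<epsilon>) \<longrightarrow> \<bar>f x - f y\<bar> < (e :: real)"
proof -
  have "open (ball (f y) e)" "f y \<in> ball (f y) e" using e by auto
  with f y obtain U where U: "open U" "y \<in> U" "\<And>x. x \<in> Rm m \<Longrightarrow> x \<in> U \<Longrightarrow> f x \<in> ball (f y) e"
    unfolding continuous_on_topological by metis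
  have "openin (product_topology (\<lambda>i. euclidean) UNIV) U" using U(1) by (simp add: open_fun_def)
  from product_topology_open_contains_basis[OF this U(2)]
  obtain X where X: "y \<in> (\<Pi>\<^sub>E i\<in>UNIV. X i)" "\<And>i. open (X i)" "(\<Pi>\<^sub>E i\<in>UNIV. X i) \<subseteq> U"
    by auto
  have "\<exists>r>0. cball (y i) r \<subseteq> X i" for i
    using X(1,2) open_contains_cball by (metis PiE_mem UNIV_I)
  then obtain r where r: "\<And>i. r i > 0" "\<And>i. cball (y i) (r i) \<subseteq> X i" by metis
  define \<epsilon> where "\<epsilon> = Min (insert 1 (r ` {1..m}))"
  have \<epsilon>: "\<epsilon> > 0" using r(1) by (simp add: \<epsilon>_def)
  have \<epsilon>r: "\<epsilon> \<le> r i" if "i \<in> {1..m}" for i unfolding \<epsilon>_def using that by (intro Min_le) auto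
  have "\<bar>f x - f y\<bar> < e" if x: "x \<in> Rm m" and xy: "\<forall>i\<in>{1..m}. \<bar>x i - y i\<bar> \<le> \<epsilon>" for x
  proof -
    have "x i \<in> X i" for i
    proof (cases "i \<in> {1..m}")
      case True
      then have "x i \<in> cball (y i) (r i)" using xy \<epsilon>r[OF True] by (force simp: dist_real_def)
      then show ?thesis using r(2) by blast
    next
      case False
      then have "x i = y i" using x y by (simp add: Rm_def)
      then show ?thesis using r[of i] by auto
    qed
    then have "x \<in> U" using X(3) by auto
    then show ?thesis using U(3)[OF x] by (simp add: dist_real_def abs_minus_commute)
  qed
  then show ?thesis using \<epsilon> by blast
qed

section \<open>Position of the giant cycle and the geometric law\<close>

lemma Xvec_in_Rm: "Xvec m k \<in> Rm m" and Lvec_in_Rm: "Lvec \<nu> m N \<sigma> \<in> Rm m"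
  by (auto simp: Xvec_def Lvec_def Rm_def)

context condensation
begin

text \<open>The geometric law stopped at \<open>m\<close>: for \<open>k < m\<close> the limiting
  probability that the giant cycle is number \<open>k + 1\<close>, for \<open>k = m\<close> that it
  is not among the first \<open>m\<close>.\<close>

definition \<pi> :: "nat \<Rightarrow> nat \<Rightarrow> real" where
  "\<pi> m k = (if k < m then (1 - \<nu>) ^ k * \<nu> else (1 - \<nu>) ^ m)"

lemma geometric_partial_sum: "(\<Sum>k<m. (1 - \<nu>) ^ k * \<nu>) = 1 - (1 - \<nu>) ^ m"
proof -
  have "(\<Sum>k<m. (1 - \<nu>) ^ k * \<nu>) = (\<Sum>k<m. (1 - \<nu>) ^ k) * \<nu>"
    by (rule sum_distrib_right[symmetric])
  then show ?thesis using one_diff_power_eq[of "1 - \<nu>" m] by simp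
qed

lemma sum_\<pi>: "(\<Sum>k\<le>m. \<pi> m k) = 1"
proof -
  have "(\<Sum>k\<le>m. \<pi> m k) = (\<Sum>k<m. (1 - \<nu>) ^ k * \<nu>) + (1 - \<nu>) ^ m"
    by (simp add: \<pi>_def flip: lessThan_Suc_atMost)
  also note geometric_partial_sum
  finally show ?thesis by simp
qed

definition cycle_event :: "nat \<Rightarrow> real \<Rightarrow> nat \<Rightarrow> nat \<Rightarrow> nat \<Rightarrow> nat set list" where
  "cycle_event m \<epsilon> K N k = (if k < m then replicate k {1..K} @ win \<epsilon> N # replicate (m - 1 - k) {1..K}
     else replicate m {1..K})"

text \<open>The parameters are fixed in the order \<open>\<epsilon>\<close>, \<open>K\<close>,
  \<open>N\<close>. With the full mass \<open>1 - \<nu>\<close> in place of the truncated sum,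
  \<open>V\<close> tends to \<open>(1 - \<nu>) ^ k * \<nu>\<close> as \<open>\<epsilon>\<close>
  tends to \<open>0\<close>; then \<open>K\<close> is so large that the strict inequalities
  persist.\<close>

lemma event_lower:
  assumes e: "e > 0" and \<epsilon>0: "\<epsilon>0 > 0"
  shows "\<exists>\<epsilon> K. 0 < \<epsilon> \<and> \<epsilon> < \<nu> \<and> \<epsilon> \<le> \<epsilon>0 \<and>
    eventually (\<lambda>N. \<forall>k\<le>m. \<pi> m k - e \<le> cc N N (cycle_event m \<epsilon> K N k) / h N N) sequentially"
proof -
  define P where "P K = (\<Sum>l=1..K. p l)" for K
  define V where "V \<epsilon> x k = x ^ k * (\<nu> * (x / (1 - \<nu> + \<epsilon>)) ^ (m - 1 - k))" for \<epsilon> x :: real and k :: nat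
  have "eventually (\<lambda>\<epsilon>. \<forall>k\<in>{..<m}. V \<epsilon> (1 - \<nu>) k > (1 - \<nu>) ^ k * \<nu> - e) (at_right 0)"
  proof (rule eventually_ball_finite)
    show "\<forall>k\<in>{..<m}. eventually (\<lambda>\<epsilon>. V \<epsilon> (1 - \<nu>) k > (1 - \<nu>) ^ k * \<nu> - e) (at_right 0)"
    proof
      fix k
      have "((\<lambda>\<epsilon>. V \<epsilon> (1 - \<nu>) k) \<longlongrightarrow> (1 - \<nu>) ^ k * (\<nu> * ((1 - \<nu>) / (1 - \<nu> + 0)) ^ (m - 1 - k))) (at_right 0)"
        unfolding V_def using \<nu> by (intro tendsto_intros) auto
      then show "eventually (\<lambda>\<epsilon>. V \<epsilon> (1 - \<nu>) k > (1 - \<nu>) ^ k * \<nu> - e) (at_right 0)"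
        using e \<nu> by (intro order_tendstoD) auto
    qed
  qed simp
  moreover have "eventually (\<lambda>\<epsilon>. 0 < \<epsilon> \<and> \<epsilon> < min \<epsilon>0 (min \<nu> (1 - \<nu>))) (at_right 0)"
    using eventually_at_right_real[of 0 "min \<epsilon>0 (min \<nu> (1 - \<nu>))"] \<epsilon>0 \<nu>
    by (auto elim: eventually_mono)
  ultimately have "eventually (\<lambda>\<epsilon>. (\<forall>k\<in>{..<m}. V \<epsilon> (1 - \<nu>) k > (1 - \<nu>) ^ k * \<nu> - e) \<and>
      0 < \<epsilon> \<and> \<epsilon> < min \<epsilon>0 (min \<nu> (1 - \<nu>))) (at_right 0)" by (rule eventually_conj)
  then obtain \<epsilon> where \<epsilon>: "\<forall>k\<in>{..<m}. V \<epsilon> (1 - \<nu>) k > (1 - \<nu>) ^ k * \<nu> - e" "0 < \<epsilon>" "\<epsilon> < \<epsilon>0" "\<epsilon> < \<nu>" "\<epsilon> < 1 - \<nu>"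
    using eventually_happens'[of "at_right (0::real)"] by auto
  have P: "P \<longlonglongrightarrow> 1 - \<nu>"
  proof -
    have "P = (\<lambda>K. \<Sum>l\<le>K. p l)"
    proof
      fix K :: nat
      have "{..K} = insert 0 {1..K}" by auto
      then show "P K = (\<Sum>l\<le>K. p l)" by (simp add: P_def p_0)
    qed
    then show ?thesis using p_sums by (simp add: sums_def_le)
  qed
  have "eventually (\<lambda>K. \<forall>k\<in>{..<m}. V \<epsilon> (P K) k > (1 - \<nu>) ^ k * \<nu> - e) sequentially"
  proof (rule eventually_ball_finite)
    show "\<forall>k\<in>{..<m}. eventually (\<lambda>K. V \<epsilon> (P K) k > (1 - \<nu>) ^ k * \<nu> - e) sequentially"
    proof
      fix k assume k: "k \<in> {..<m}"
      have "(\<lambda>K. V \<epsilon> (P K) k) \<longlonglongrightarrow> V \<epsilon> (1 - \<nu>) k"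
        unfolding V_def using \<nu> \<epsilon> by (intro tendsto_intros P) auto
      then show "eventually (\<lambda>K. V \<epsilon> (P K) k > (1 - \<nu>) ^ k * \<nu> - e) sequentially"
        using \<epsilon>(1) k by (intro order_tendstoD(1)) auto
    qed
  qed simp
  moreover have "eventually (\<lambda>K. P K ^ m > (1 - \<nu>) ^ m - e) sequentially"
    by (rule order_tendstoD(1)[OF tendsto_power[OF P]]) (use e in simp)
  ultimately have "eventually (\<lambda>K. (\<forall>k\<in>{..<m}. V \<epsilon> (P K) k > (1 - \<nu>) ^ k * \<nu> - e) \<and> P K ^ m > (1 - \<nu>) ^ m - e) sequentially"
    by (rule eventually_conj)
  then obtain K where K: "\<forall>k\<in>{..<m}. V \<epsilon> (P K) k > (1 - \<nu>) ^ k * \<nu> - e" "P K ^ m > (1 - \<nu>) ^ m - e"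
    using eventually_happens'[of sequentially] by auto
  have "eventually (\<lambda>N. \<forall>k\<in>{..m}. \<pi> m k - e \<le> cc N N (cycle_event m \<epsilon> K N k) / h N N) sequentially"
  proof (rule eventually_ball_finite)
    show "\<forall>k\<in>{..m}. eventually (\<lambda>N. \<pi> m k - e \<le> cc N N (cycle_event m \<epsilon> K N k) / h N N) sequentially"
    proof
      fix k assume "k \<in> {..m}"
      show "eventually (\<lambda>N. \<pi> m k - e \<le> cc N N (cycle_event m \<epsilon> K N k) / h N N) sequentially"
      proof (cases "k < m")
        case True
        from giant_cycle_event[OF \<epsilon>(2,4,5), of K k "m - 1 - k" 0]
        obtain g where g: "g \<longlonglongrightarrow> V \<epsilon> (P K) k"
          "eventually (\<lambda>N. g N \<le> cc N N (cycle_event m \<epsilon> K N k) / h N N) sequentially"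
          using True by (auto simp: V_def P_def cycle_event_def)
        have "eventually (\<lambda>N. g N > (1 - \<nu>) ^ k * \<nu> - e) sequentially"
          using K(1) True by (intro order_tendstoD(1)[OF g(1)]) auto
        then show ?thesis using g(2) by eventually_elim (use True in \<open>simp add: \<pi>_def\<close>)
      next
        case False
        have "(\<lambda>N. cc N N (cycle_event m \<epsilon> K N k) / h N N) \<longlonglongrightarrow> P K ^ m"
          using short_cycles[of 0 m K] False by (simp add: cycle_event_def P_def)
        then have "eventually (\<lambda>N. cc N N (cycle_event m \<epsilon> K N k) / h N N > (1 - \<nu>) ^ m - e) sequentially"
          using K(2) by (rule order_tendstoD(1))
        then show ?thesis by eventually_elim (use False in \<open>simp add: \<pi>_def\<close>)
      qed
    qed
  qed simp
  then show ?thesis using \<epsilon> by (intro exI[of _ \<epsilon>] exI[of _ K]) (auto elim: eventually_mono)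
qed

text \<open>After scaling, the giant cycle is within \<open>\<epsilon> / \<nu>\<close> of
  \<open>1\<close> and short ones are within \<open>K / (N * \<nu>)\<close> of \<open>0\<close>.
  Lists count from \<open>0\<close> and vectors from \<open>1\<close>, hence
  \<open>k + 1\<close>.\<close>

lemma cycle_event_close:
  assumes ev: "lex_event {1..N} (cycle_event m \<epsilon> K N k) \<sigma>" and N: "real N > 0"
    and \<epsilon>: "\<epsilon> / \<nu> \<le> r" and K: "real K / (real N * \<nu>) \<le> r" and k: "k \<le> m" and i: "i \<in> {1..m}"
  shows "\<bar>Lvec \<nu> m N \<sigma> i - Xvec m (k + 1) i\<bar> \<le> r"
proof -
  obtain j where j: "i = Suc j" "j < m" using i by (cases i) auto
  have L: "Lvec \<nu> m N \<sigma> i = real (lex_length {1..N} \<sigma> j) / (real N * \<nu>)"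
    using i j by (simp add: Lvec_def lexL_eq_lex_length)
  have len: "length (cycle_event m \<epsilon> K N k) = m" using k by (auto simp: cycle_event_def)
  have J: "lex_length {1..N} \<sigma> j \<in> cycle_event m \<epsilon> K N k ! j"
    using ev j len by (simp add: lex_event_def)
  have N\<nu>: "real N * \<nu> > 0" using N \<nu> by simp
  show ?thesis
  proof (cases "j = k")
    case True
    then have "cycle_event m \<epsilon> K N k ! j = win \<epsilon> N" using j by (simp add: cycle_event_def nth_append)
    then have "\<bar>real (lex_length {1..N} \<sigma> j) - \<nu> * real N\<bar> \<le> \<epsilon> * real N" using J by (simp add: win_def)
    moreover have "Lvec \<nu> m N \<sigma> i - 1 = (real (lex_length {1..N} \<sigma> j) - \<nu> * real N) / (real N * \<nu>)"
      using N \<nu> by (simp add: L diff_divide_distrib)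
    ultimately have "\<bar>Lvec \<nu> m N \<sigma> i - 1\<bar> \<le> \<epsilon> * real N / (real N * \<nu>)"
      using N\<nu> by (simp only: abs_divide abs_of_pos) (rule divide_right_mono, auto)
    also have "\<dots> = \<epsilon> / \<nu>" using N by simp
    finally show ?thesis using \<epsilon> i j True by (simp add: Xvec_def)
  next
    case False
    then have "cycle_event m \<epsilon> K N k ! j = {1..K}"
      using j by (auto simp: cycle_event_def nth_append nth_Cons' )
    then have "real (lex_length {1..N} \<sigma> j) \<le> real K" using J by simp
    then have "real (lex_length {1..N} \<sigma> j) / (real N * \<nu>) \<le> real K / (real N * \<nu>)"
      using N\<nu> by (intro divide_right_mono) auto
    moreover have "0 \<le> real (lex_length {1..N} \<sigma> j) / (real N * \<nu>)" using N\<nu> by simp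
    moreover have "Xvec m (k + 1) i = 0" using False j by (simp add: Xvec_def)
    ultimately show ?thesis using K by (simp add: L)
  qed
qed

lemma lexicographic_cycles_limit:
  fixes f :: "(nat \<Rightarrow> real) \<Rightarrow> real"
  assumes tilt: "\<And>N j. j \<ge> 1 \<Longrightarrow> u N j = (\<theta> j + real N * \<kappa> j) * R ^ j" and R: "R > 0"
    and nonneg: "\<forall>j\<ge>1. \<theta> j \<ge> 0" "\<forall>j\<ge>1. \<kappa> j \<ge> 0"
    and f: "continuous_on (Rm m) f" "bounded (f ` Rm m)"
  shows "(\<lambda>N. EN \<theta> \<kappa> N (\<lambda>\<sigma>. f (Lvec \<nu> m N \<sigma>))) \<longlonglongrightarrow> (\<Sum>k\<le>m. \<pi> m k * f (Xvec m (k + 1)))"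
proof (rule LIMSEQ_I)
  fix r :: real assume r: "r > 0"
  obtain B where B: "B > 0" "\<And>x. x \<in> Rm m \<Longrightarrow> \<bar>f x\<bar> \<le> B"
    using f(2) unfolding bounded_pos by auto
  have "\<forall>k. \<exists>\<epsilon>>0. \<forall>x\<in>Rm m. (\<forall>i\<in>{1..m}. \<bar>x i - Xvec m (k + 1) i\<bar> \<le> \<epsilon>) \<longrightarrow> \<bar>f x - f (Xvec m (k + 1))\<bar> < r / 2"
    by (intro allI Rm_continuous_box f Xvec_in_Rm) (use r in simp)
  then obtain \<epsilon>k where \<epsilon>k: "\<And>k. \<epsilon>k k > 0"
    "\<And>k x. x \<in> Rm m \<Longrightarrow> (\<forall>i\<in>{1..m}. \<bar>x i - Xvec m (k + 1) i\<bar> \<le> \<epsilon>k k) \<Longrightarrow> \<bar>f x - f (Xvec m (k + 1))\<bar> < r / 2"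
    by metis
  \<comment> \<open>A radius below one half makes the boxes around distinct limit vectors disjoint,
    as these differ by \<open>1\<close> in some coordinate.\<close>
  define \<rho> where "\<rho> = Min (insert (1/4) (\<epsilon>k ` {..m}))"
  have \<rho>: "\<rho> > 0" "\<rho> \<le> 1/4" using \<epsilon>k(1) by (auto simp: \<rho>_def)
  have \<rho>k: "\<rho> \<le> \<epsilon>k k" if "k \<le> m" for k unfolding \<rho>_def using that by (intro Min_le) auto
  \<comment> \<open>Makes the error in \<open>mixture_estimate\<close> equal to
    \<open>r / 2 + r / 4\<close>.\<close>
  define e' where "e' = r / (12 * B * real (Suc m))"
  have e': "e' > 0" using r B by (simp add: e'_def)
  obtain \<epsilon> K where \<epsilon>: "0 < \<epsilon>" "\<epsilon> < \<nu>" "\<epsilon> \<le> \<rho> * \<nu>"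
    and low: "eventually (\<lambda>N. \<forall>k\<le>m. \<pi> m k - e' \<le> cc N N (cycle_event m \<epsilon> K N k) / h N N) sequentially"
    using event_lower[OF e', of "\<rho> * \<nu>" m] \<rho> \<nu> by auto
  have "filterlim (\<lambda>N. \<rho> * \<nu> * real N) at_top sequentially" using \<rho> \<nu> by real_asymp
  then have "eventually (\<lambda>N. \<rho> * \<nu> * real N \<ge> real K) sequentially" by (simp add: filterlim_at_top)
  then have "eventually (\<lambda>N. norm (EN \<theta> \<kappa> N (\<lambda>\<sigma>. f (Lvec \<nu> m N \<sigma>)) - (\<Sum>k\<le>m. \<pi> m k * f (Xvec m (k + 1)))) < r) sequentially"
    using low h_pos eventually_gt_at_top[of 0]
  proof eventually_elim
    case (elim N)
    have N: "real N > 0" using elim by simp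
    define w where "w j = \<theta> j + real N * \<kappa> j" for j
    define S where "S = {\<sigma>. \<sigma> permutes {1..N}}"
    define Q where "Q = PN \<theta> \<kappa> N"
    \<comment> \<open>Boxes around the limit vectors replace the cycle events: they contain the
      events and are disjoint without further conditions on \<open>N\<close>.\<close>
    define A where "A k = {\<sigma>\<in>S. \<forall>i\<in>{1..m}. \<bar>Lvec \<nu> m N \<sigma> i - Xvec m (k + 1) i\<bar> \<le> \<rho>}" for k
    have finS: "finite S" unfolding S_def by (rule finite_permutations) simp
    have cc_eq: "cc N N Js = R ^ N * cycle_coeff w N Js" for Js
      using cycle_coeff_cong[of "u N" "\<lambda>j. w j * R ^ j"] tilt cycle_coeff_tilt[of w R N Js]
      by (simp add: cc_def w_def)
    have h_eq: "h N N = R ^ N * exp_coeff w N" using cc_eq[of "[]"] by (simp add: cc_Nil)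
    have wN: "exp_coeff w N > 0" using elim(3) R by (simp add: h_eq zero_less_mult_iff)
    have HN: "HN \<theta> \<kappa> N > 0" using wN unfolding HN_eq_exp_coeff w_def .
    have EN: "EN \<theta> \<kappa> N F = (\<Sum>\<sigma>\<in>S. Q \<sigma> * F \<sigma>)" for F by (simp add: EN_def S_def Q_def)
    have event: "(\<Sum>\<sigma>\<in>S. Q \<sigma> * of_bool (lex_event {1..N} Js \<sigma>)) = cc N N Js / h N N"
      if "\<forall>J\<in>set Js. 0 \<notin> J" for Js
      using EN_event[OF that, of \<theta> \<kappa> N] R unfolding EN cc_eq h_eq w_def by simp
    have Q0: "Q \<sigma> \<ge> 0" for \<sigma>
    proof -
      have "weight \<theta> \<kappa> N \<sigma> \<ge> 0" unfolding weight_def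
        using nonneg by (intro prod_nonneg) auto
      then show ?thesis using HN by (simp add: Q_def PN_def)
    qed
    have Q1: "sum Q S = 1"
      using event[of "[]"] elim(3) by (simp add: lex_event_def cc_Nil)
    have "norm ((\<Sum>\<sigma>\<in>S. Q \<sigma> * f (Lvec \<nu> m N \<sigma>)) - (\<Sum>k\<le>m. \<pi> m k * f (Xvec m (k + 1)))) \<le> r / 2 + 3 * B * real (card {..m}) * e'"
      unfolding real_norm_def
    proof (rule mixture_estimate[where A = A])
      show "disjoint_family_on A {..m}"
        unfolding disjoint_family_on_def
      proof (intro ballI impI)
        fix k k' assume kk: "k \<in> {..m}" "k' \<in> {..m}" "k \<noteq> k'"
        have False if "\<sigma> \<in> A k" "\<sigma> \<in> A k'" for \<sigma>
        proof -
          \<comment> \<open>The earlier giant position, where exactly one of the two limit vectors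
            has the entry \<open>1\<close>.\<close>
          define i where "i = min k k' + 1"
          have i: "i \<in> {1..m}" using kk by (auto simp: i_def)
          have "\<bar>Lvec \<nu> m N \<sigma> i - Xvec m (k + 1) i\<bar> \<le> \<rho>" "\<bar>Lvec \<nu> m N \<sigma> i - Xvec m (k' + 1) i\<bar> \<le> \<rho>"
            using that i by (auto simp: A_def)
          moreover have "\<bar>Xvec m (k + 1) i - Xvec m (k' + 1) i\<bar> = 1"
            using i kk by (auto simp: Xvec_def i_def min_def)
          ultimately show False using \<rho> by linarith
        qed
        then show "A k \<inter> A k' = {}" by blast
      qed
      show "\<bar>f (Lvec \<nu> m N \<sigma>) - f (Xvec m (k + 1))\<bar> \<le> r / 2" if "k \<in> {..m}" "\<sigma> \<in> A k" for k \<sigma>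
        using \<epsilon>k(2)[OF Lvec_in_Rm, of \<nu> N \<sigma> k] that \<rho>k[of k] by (force simp: A_def)
      show "sum Q (A k) \<ge> \<pi> m k - e'" if k: "k \<in> {..m}" for k
      proof -
        let ?Js = "cycle_event m \<epsilon> K N k"
        have "0 \<notin> win \<epsilon> N" using \<epsilon> N \<nu> by (simp add: win_def)
        then have "\<forall>J\<in>set ?Js. 0 \<notin> J" by (auto simp: cycle_event_def)
        from event[OF this] have "cc N N ?Js / h N N = (\<Sum>\<sigma>\<in>S. Q \<sigma> * of_bool (lex_event {1..N} ?Js \<sigma>))" by simp
        also have "\<dots> = (\<Sum>\<sigma>\<in>{\<sigma>\<in>S. lex_event {1..N} ?Js \<sigma>}. Q \<sigma>)"
          using finS by (intro sum.mono_neutral_cong_right) auto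
        also have "\<dots> \<le> sum Q (A k)"
        proof (rule sum_mono2)
          have 1: "\<epsilon> / \<nu> \<le> \<rho>" using \<epsilon> \<nu> by (simp add: pos_divide_le_eq)
          have 2: "real K / (real N * \<nu>) \<le> \<rho>" using elim(1) N \<nu> by (simp add: pos_divide_le_eq mult_ac)
          show "{\<sigma>\<in>S. lex_event {1..N} ?Js \<sigma>} \<subseteq> A k"
            using cycle_event_close[OF _ N 1 2] k by (auto simp: A_def)
        qed (use finS Q0 in \<open>auto simp: A_def\<close>)
        finally show ?thesis using elim(2) k by force
      qed
    qed (use finS Q0 Q1 B r e' sum_\<pi> Xvec_in_Rm Lvec_in_Rm in \<open>auto simp: A_def\<close>)
    also have "3 * B * real (card {..m}) * e' = r / 4" using B by (simp add: e'_def field_simps del: of_nat_Suc)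
    finally show ?case using r unfolding EN by simp
  qed
  then show "\<exists>no. \<forall>N\<ge>no. norm (EN \<theta> \<kappa> N (\<lambda>\<sigma>. f (Lvec \<nu> m N \<sigma>)) - (\<Sum>k\<le>m. \<pi> m k * f (Xvec m (k + 1)))) < r"
    by (simp add: eventually_sequentially)
qed

text \<open>Subtracting the terminal value \<open>g m\<close> leaves a finitely supported function.
  \<open>geometric_pmf\<close> starts at \<open>0\<close>, so it is the law of the geometric
  variable of the theorem minus one.\<close>

lemma expectation_geometric_stop:
  fixes g :: "nat \<Rightarrow> real"
  assumes g: "\<And>k. k \<ge> m \<Longrightarrow> g k = g m"
  shows "measure_pmf.expectation (geometric_pmf \<nu>) g = (\<Sum>k\<le>m. \<pi> m k * g k)"
proof -
  let ?M = "measure_pmf (geometric_pmf \<nu>)"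
  have "measure_pmf.expectation (geometric_pmf \<nu>) (\<lambda>k. g k - g m) = (\<Sum>k\<in>{..<m}. (g k - g m) * pmf (geometric_pmf \<nu>) k)"
  proof (rule integral_measure_pmf_real)
    fix k assume "g k - g m \<noteq> 0"
    then show "k \<in> {..<m}" using g[of k] by (cases "k < m") auto
  qed simp
  also have "\<dots> = (\<Sum>k<m. (1 - \<nu>) ^ k * \<nu> * g k - (1 - \<nu>) ^ k * \<nu> * g m)"
    using \<nu> by (intro sum.cong refl) (simp add: algebra_simps)
  also have "\<dots> = (\<Sum>k<m. (1 - \<nu>) ^ k * \<nu> * g k) - (\<Sum>k<m. (1 - \<nu>) ^ k * \<nu>) * g m"
    by (simp only: sum_subtractf sum_distrib_right)
  finally have 1: "measure_pmf.expectation (geometric_pmf \<nu>) (\<lambda>k. g k - g m) =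
     (\<Sum>k<m. (1 - \<nu>) ^ k * \<nu> * g k) - (\<Sum>k<m. (1 - \<nu>) ^ k * \<nu>) * g m" .
  have int: "integrable ?M (\<lambda>k. g k - g m)"
  proof (rule measure_pmf.integrable_const_bound[where B = "\<Sum>k<m. \<bar>g k - g m\<bar>"])
    have "\<bar>g k - g m\<bar> \<le> (\<Sum>k<m. \<bar>g k - g m\<bar>)" for k
    proof (cases "k < m")
      case True
      then show ?thesis by (intro member_le_sum) auto
    next
      case False
      then show ?thesis using g[of k] by (simp add: sum_nonneg)
    qed
    then show "AE k in ?M. norm (g k - g m) \<le> (\<Sum>k<m. \<bar>g k - g m\<bar>)" by simp
  qed simp
  have "measure_pmf.expectation (geometric_pmf \<nu>) (\<lambda>k. (g k - g m) + g m) =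
     measure_pmf.expectation (geometric_pmf \<nu>) (\<lambda>k. g k - g m) + g m"
    using int by (subst Bochner_Integration.integral_add) auto
  then have "measure_pmf.expectation (geometric_pmf \<nu>) g =
     (\<Sum>k<m. (1 - \<nu>) ^ k * \<nu> * g k) + (1 - (\<Sum>k<m. (1 - \<nu>) ^ k * \<nu>)) * g m"
    by (simp add: 1 algebra_simps)
  also have "1 - (\<Sum>k<m. (1 - \<nu>) ^ k * \<nu>) = (1 - \<nu>) ^ m"
    by (simp only: geometric_partial_sum)
  finally show ?thesis
    by (simp add: \<pi>_def flip: lessThan_Suc_atMost)
qed

end

text \<open>Turns the singular expansion into the real-variable assumptions of the locale, with
  \<open>c = a / Gamma (- s)\<close>: the factor \<open>Gamma (n - s)\<close> of the expansion
  cancels against that of the binomial coefficients.\<close>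

lemma hypQ_condensation:
  fixes \<theta> \<kappa> :: "nat \<Rightarrow> real" and R :: real
  assumes theta: "\<forall>j\<ge>1. \<theta> j \<ge> 0" and kappa: "\<forall>j\<ge>1. \<kappa> j \<ge> 0"
    and kappa_pos: "\<exists>j\<ge>2. \<kappa> j > 0" and Q: "hypQ \<theta> \<kappa> R"
  shows "\<exists>s c. condensation (\<lambda>j. if j = 0 then 0 else \<kappa> j * R ^ j) (\<lambda>j. if j = 0 then 0 else \<theta> j * R ^ j) s c
    (1 - real_of_ereal (gbrR \<kappa> R 1))"
proof -
  define p where "p j = (if j = 0 then 0 else \<kappa> j * R ^ j)" for j
  define t where "t j = (if j = 0 then 0 else \<theta> j * R ^ j)" for j
  from Q obtain \<eta> \<phi> G\<kappa> G\<theta> \<epsilon> s a where R: "R > 0" and rad: "conv_radius (gcoeff \<kappa>) = ereal R"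
    and \<eta>: "\<eta> > 0" and \<phi>: "0 < \<phi>" "\<phi> < pi / 2"
    and hol: "G\<kappa> holomorphic_on Delta0 R \<eta> \<phi>" and eq: "\<forall>z\<in>ball 0 R. G\<kappa> z = gfun \<kappa> z"
    and \<epsilon>: "\<epsilon> > 0" and hol\<theta>: "G\<theta> holomorphic_on (Delta0 R \<eta> \<phi> \<union> ball (complex_of_real R) \<epsilon>)"
    and sums\<theta>: "\<forall>z\<in>ball 0 R. (\<lambda>j. gcoeff \<theta> j * z ^ j) sums G\<theta> z"
    and less: "gbrR \<kappa> R 1 < 1" and s: "s > 1" "s \<notin> \<int>" and a: "a > 0"
    and expansion: "\<forall>n::nat. \<exists>\<delta>>0.
           (\<lambda>z. gbr G\<kappa> n z
                 - (z / complex_of_real R) ^ n *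
                   ((\<Sum>j | n \<le> j \<and> real j < s.
                       of_real ((-1) ^ (j - n) * real_of_ereal (gbrR \<kappa> R j) / fact (j - n))
                       * (1 - z / complex_of_real R) ^ (j - n))
                    + of_real (Gamma (real n - s) * a / Gamma (- s))
                       * (1 - z / complex_of_real R) powr complex_of_real (s - real n)))
           \<in> bigo (at (complex_of_real R) within Delta0 R \<eta> \<phi>)
               (\<lambda>z. (1 - z / complex_of_real R) powr complex_of_real (s - real n + \<delta>))"
    unfolding hypQ_def by (elim exE conjE)
  \<comment> \<open>Beyond \<open>s\<close> the polynomial part of the expansion is empty; the
    margin \<open>3\<close> leaves the exponent of the remainder at least \<open>2\<close> after
    subtracting \<open>min \<delta> 1\<close>.\<close>
  define n where "n = nat \<lceil>s\<rceil> + 3"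
  have n: "real n \<ge> s + 3" using s unfolding n_def by linarith
  define b where "b = Gamma (real n - s) * a / Gamma (- s)"
  have empty: "{j. n \<le> j \<and> real j < s} = {}" using n by auto
  obtain \<delta> where \<delta>: "\<delta> > 0" and big: "(\<lambda>z. gbr G\<kappa> n z - (z / of_real R) ^ n * (of_real b * (1 - z / of_real R) powr of_real (s - real n)))
       \<in> bigo (at (of_real R) within Delta0 R \<eta> \<phi>) (\<lambda>z. (1 - z / of_real R) powr of_real (s - real n + \<delta>))"
    using spec[OF expansion, of n] unfolding empty b_def by auto
  obtain C where C: "\<forall>w. norm w < 1 \<longrightarrow> norm (gbr (gfun \<kappa>) n (of_real R * w) - of_real b * (1 - w) powr of_real (s - real n))
      \<le> C * norm (1 - w) powr - (real n - s - min \<delta> 1)"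
    using gbr_remainder_bound[OF R \<eta> \<phi> rad hol eq \<delta> big n] by blast
  define c where "c = a / Gamma (- s)"
  have G: "Gamma (real n - s) > 0" using n by (intro Gamma_real_pos) linarith
  have lim: "(\<lambda>j. \<kappa> j * R ^ j * real j powr s) \<longlonglongrightarrow> c"
    using kappa_tail[OF R rad n _ _ C] \<delta> G by (simp add: b_def c_def)
  \<comment> \<open>Nonnegativity of \<open>\<kappa>\<close> settles the sign of \<open>c\<close>
    without a discussion of the sign of \<open>Gamma (- s)\<close>.\<close>
  have "c \<ge> 0"
  proof (rule tendsto_lowerbound[OF lim])
    show "\<forall>\<^sub>F j in sequentially. 0 \<le> \<kappa> j * R ^ j * real j powr s"
      using eventually_ge_at_top[of 1] by eventually_elim (use kappa R in simp)
  qed simp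
  \<comment> \<open>\<open>Gamma\<close> has the value \<open>0\<close> at its poles, so this uses
    that \<open>s\<close> is not an integer.\<close>
  moreover have "Gamma (- s) \<noteq> 0"
    using s(2) nonpos_Ints_subset_Ints by (auto simp: Gamma_eq_zero_iff minus_in_Ints_iff)
  then have "c \<noteq> 0" using a by (simp add: c_def)
  ultimately have c: "c > 0" by simp
  note one = gbrR_one[OF rad R kappa less, folded p_def]
  have p0: "p j \<ge> 0" and t0: "t j \<ge> 0" for j using kappa theta R by (auto simp: p_def t_def Suc_le_eq)
  obtain j0 where j0: "j0 \<ge> 2" "\<kappa> j0 > 0" using kappa_pos by blast
  \<comment> \<open>This is \<open>\<nu> < 1\<close>.\<close>
  have sp: "suminf p > 0"
    by (rule suminf_pos2[OF one(1) p0, of j0]) (use j0 R in \<open>simp add: p_def\<close>)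
  have limp: "(\<lambda>j. p j * real j powr s) \<longlonglongrightarrow> c"
    by (rule Lim_transform_eventually[OF lim])
       (use eventually_gt_at_top[of 0] in \<open>auto elim!: eventually_mono simp: p_def\<close>)
  have limt: "(\<lambda>j. t j * real j powr s) \<longlonglongrightarrow> 0"
    by (rule Lim_transform_eventually[OF theta_decay[OF R \<eta> \<phi> \<epsilon> hol\<theta> sums\<theta>, of s]])
       (use eventually_gt_at_top[of 0] in \<open>auto elim!: eventually_mono simp: t_def\<close>)
  have st: "summable t"
  proof -
    obtain Ct where Ct: "Ct > 0" "\<And>j. norm (t j * real j powr s) \<le> Ct"
      using convergent_imp_Bseq[OF convergentI[OF limt]] unfolding Bseq_def by auto
    show ?thesis
    proof (rule summable_comparison_test'[of "\<lambda>j. Ct * real j powr - s" 1])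
      show "summable (\<lambda>j. Ct * real j powr - s)"
        using s by (intro summable_mult) (simp add: summable_real_powr_iff)
      show "norm (t j) \<le> Ct * real j powr - s" if "j \<ge> 1" for j
        using Ct(2)[of j] t0[of j] that by (simp add: powr_minus field_simps)
    qed
  qed
  have "condensation p t s c (1 - suminf p)"
    by unfold_locales (use p0 t0 one sp st s c limp limt in \<open>auto simp: p_def[of 0] t_def[of 0] summable_sums\<close>)
  then show ?thesis unfolding one(2) p_def t_def by blast
qed

theorem theorem5p12:
  fixes \<theta> \<kappa> :: "nat \<Rightarrow> real" and R :: real and m :: nat
  assumes nonneg_theta: "\<forall>j\<ge>1. \<theta> j \<ge> 0"
    and nonneg_kappa: "\<forall>j\<ge>1. \<kappa> j \<ge> 0"
    and nonarith: "non_arithmetic \<kappa>"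
    and kappa_pos: "\<exists>j\<ge>2. \<kappa> j > 0"
    and Q: "hypQ \<theta> \<kappa> R"
    and m: "m \<ge> 1"
  defines "\<nu> \<equiv> 1 - real_of_ereal (gbrR \<kappa> R 1)"
  shows "\<nu> > 0 \<and>
         (\<forall>f :: (nat \<Rightarrow> real) \<Rightarrow> real.
            continuous_on (Rm m) f \<longrightarrow> bounded (f ` Rm m) \<longrightarrow>
            (\<lambda>N. EN \<theta> \<kappa> N (\<lambda>\<sigma>. f (Lvec \<nu> m N \<sigma>)))
              \<longlonglongrightarrow> measure_pmf.expectation (geometric_pmf \<nu>) (\<lambda>k. f (Xvec m (k + 1))))"
proof -
  obtain s c where "condensation (\<lambda>j. if j = 0 then 0 else \<kappa> j * R ^ j) (\<lambda>j. if j = 0 then 0 else \<theta> j * R ^ j) s c \<nu>"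
    using hypQ_condensation[OF nonneg_theta nonneg_kappa kappa_pos Q] unfolding \<nu>_def by blast
  then interpret condensation "\<lambda>j. if j = 0 then 0 else \<kappa> j * R ^ j" "\<lambda>j. if j = 0 then 0 else \<theta> j * R ^ j" s c \<nu> .
  have R: "R > 0" using Q by (simp add: hypQ_def)
  have tilt: "u N j = (\<theta> j + real N * \<kappa> j) * R ^ j" if "j \<ge> 1" for N j
    using that by (simp add: u_def distrib_right)
  \<comment> \<open>For \<open>k \<ge> m\<close> the giant cycle comes after the first
    \<open>m\<close> and the limit vector is zero, so the expectation reduces to the stopped law
    \<open>\<pi> m\<close>.\<close>
  have X: "Xvec m (k + 1) = Xvec m (m + 1)" if "k \<ge> m" for k
    using that by (auto simp: Xvec_def fun_eq_iff)
  show ?thesis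
  proof (intro conjI allI impI)
    fix f :: "(nat \<Rightarrow> real) \<Rightarrow> real"
    assume f: "continuous_on (Rm m) f" "bounded (f ` Rm m)"
    have "measure_pmf.expectation (geometric_pmf \<nu>) (\<lambda>k. f (Xvec m (k + 1))) = (\<Sum>k\<le>m. \<pi> m k * f (Xvec m (k + 1)))"
      by (rule expectation_geometric_stop) (rule arg_cong[OF X])
    then show "(\<lambda>N. EN \<theta> \<kappa> N (\<lambda>\<sigma>. f (Lvec \<nu> m N \<sigma>)))
        \<longlonglongrightarrow> measure_pmf.expectation (geometric_pmf \<nu>) (\<lambda>k. f (Xvec m (k + 1)))"
      using lexicographic_cycles_limit[OF tilt R nonneg_theta nonneg_kappa f] by simp
  qed (rule \<nu>)
qed

end
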